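(* Let $g_1,g_2:\mathbb{N}\to\mathbb{C}$ be multiplicative functions with $|g_i(n)|\le1$ for all $n$, such that \[\sum_{p}\sum_{i=1}^{2}\frac{|g_i(p)-1|^2}{p}<\infty.\] Then, as $x\to\infty$, \[\frac1x\sum_{n\le x}g_1(n+3)g_2(n+2)\mu(n+1)=o(1),\] where $\mu$ is the Möbius function.
   Context: $p$ runs over primes. *)

theory Defs
  imports
    "HOL-Analysis.Analysis"
    "HOL-Computational_Algebra.Squarefree"
    "HOL-Library.Landau_Symbols"
begin

(* Only the values at positive integers matter: a function on the positive integers
   is represented by a function on nat whose value at 0 is arbitrary. *)
definition multiplicative_fun :: "(nat \<Rightarrow> complex) \<Rightarrow> bool" where
  "multiplicative_fun g \<longleftrightarrow>
     g 1 = 1 \<and> (\<forall>m n. m > 0 \<longrightarrow> n > 0 \<longrightarrow> coprime m n \<longrightarrow> g (m * n) = g m * g n)"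

definition moebius_mu :: "nat \<Rightarrow> int" where
  "moebius_mu n = (if squarefree n then (- 1) ^ card (prime_factors n) else 0)"

end

theory Submission
  imports Defs "HOL-Complex_Analysis.Complex_Analysis" "HOL-Real_Asymp.Real_Asymp"
    "HOL-Number_Theory.Number_Theory"
begin

text \<open>
  By a Turan--Kubilius argument each \<open>g\<^sub>i\<close> is, on \<open>{1..N}\<close> and in mean, within \<open>\<epsilon>\<close> of \<open>c\<^sub>N h\<close> with
  \<open>|c\<^sub>N| \<le> 1\<close> and \<open>h\<close> a fixed periodic function: the primes above a cutoff \<open>y\<close> contribute
  approximately the constant factor \<open>exp (\<Sum>y<p\<le>\<surd>N. (g\<^sub>i(p) - 1) / p)\<close>, and the primes up to \<open>y\<close> contribute a
  function that is periodic up to a set of small density. Hence it suffices that \<open>\<mu>\<close> has mean value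
  \<open>0\<close> against every periodic function. Periodic functions reduce to Dirichlet characters, and
  for a character the mean value of \<open>\<mu> \<psi>\<close> vanishes by Newman's Tauberian theorem applied to \<open>1 / L(s,\<psi>)\<close>,
  where \<open>L\<close> has no zeros on \<open>Re s = 1\<close> by the 3-4-1 inequality and, for real \<open>\<psi>\<close> at
  \<open>s = 1\<close>, by Monsky's Lambert series argument.
\<close>

section \<open>A Tauberian theorem\<close>

text \<open>Only the series of \<open>(norm (g p - 1))\<^sup>2 / p\<close> is assumed to converge,
  not that of \<open>(g p - 1) / p\<close>. The factor contributed by the large primes may therefore
  keep turning as \<open>N\<close> grows, and no single limit function need approximate
  \<open>g\<close>. What saves the argument is that this factor depends on \<open>N\<close> but not
  on \<open>n\<close>: it leaves the sum over \<open>n\<close>, and its modulus is at most 1 because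
  \<open>Re (g p - 1) \<le> 0\<close>. The period is chosen from \<epsilon> before \<open>N\<close>
  tends to infinity, so a qualitative statement about mu in residue classes is enough, without
  uniformity in the modulus. Hence \<open>L\<close> has to be non-zero only on the closed half plane
  \<open>Re s \<ge> 1\<close>; no zero-free region beyond it and no rate of decay enter. The shifts
  cause no difficulty because only mu is asked to oscillate: both other factors are absorbed into
  one periodic function of \<open>n + 1\<close>.\<close>

lemma norm_of_nat_powr [simp]: "norm (of_nat n powr (z::complex)) = real n powr Re z"
  by (simp add: norm_powr_real_powr)

lemma powr_diff_mean_value:
  fixes a b u :: real
  assumes "0 < a" "a < b"
  obtains \<xi> where "a < \<xi>" "\<xi> < b" "b powr u - a powr u = (b - a) * (u * \<xi> powr (u - 1))"
proof -
  have "\<exists>z>a. z < b \<and> b powr u - a powr u = (b - a) * (u * z powr (u - 1))"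
    by (rule MVT2) (use assms in \<open>auto intro!: derivative_eq_intros\<close>)
  with that show ?thesis by blast
qed

lemma sum_powr_tail_le:
  fixes x :: real
  assumes "0 < x" "1 \<le> N" "N \<le> M"
  shows "(\<Sum>n\<in>{N<..M}. real n powr (-1 - x)) \<le> (real N powr -x - real M powr -x) / x"
  using assms(3)
proof (induction M rule: dec_induct)
  case (step M)
  have "0 < real M" "real M < real (Suc M)" using step assms by auto
  from powr_diff_mean_value[OF this, of "-x"] obtain \<xi> where
    \<xi>: "real M < \<xi>" "\<xi> < real (Suc M)"
       "real (Suc M) powr -x - real M powr -x = (real (Suc M) - real M) * (-x * \<xi> powr (-x - 1))" .
  have "x * real (Suc M) powr (-1 - x) \<le> x * \<xi> powr (-1-x)"
    using \<xi> assms by (intro mult_left_mono powr_mono2') auto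
  also have "\<dots> = real M powr -x - real (Suc M) powr -x"
    using \<xi>(3) by (simp add: minus_diff_commute)
  finally have "real (Suc M) powr (-1 - x) \<le> (real M powr -x - real (Suc M) powr -x) / x"
    using assms by (simp add: field_simps)
  moreover have "{N<..Suc M} = insert (Suc M) {N<..M}" using step by auto
  ultimately show ?case using step.IH by (simp add: diff_divide_distrib)
qed auto

text \<open>Comparison with the integral of \<open>t powr (u - 1)\<close>. For
  \<open>u \<le> 1\<close> the summand decreases and the integral alone suffices; for larger
  \<open>u\<close> it increases, the integral dominates only the terms below \<open>N\<close>, and
  the last term is added. Newman's left half circle meets both cases, since
  \<open>u = - Re z\<close> runs up to \<open>R\<close>.\<close>

lemma sum_powr_le:
  fixes u :: real
  assumes "0 < u"
  shows "(\<Sum>n\<le>N. real n powr (u - 1)) \<le> real N powr u / u + real N powr (u - 1)"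
proof (cases "u \<le> 1")
  case True
  have "(\<Sum>n\<le>N. real n powr (u - 1)) \<le> real N powr u / u"
  proof (induction N)
    case (Suc N)
    have "real (Suc N) powr (u - 1) \<le> (real (Suc N) powr u - real N powr u) / u"
    proof (cases "N = 0")
      case False
      hence "0 < real N" "real N < real (Suc N)" by auto
      from powr_diff_mean_value[OF this, of u] obtain \<xi> where
        \<xi>: "real N < \<xi>" "\<xi> < real (Suc N)"
           "real (Suc N) powr u - real N powr u = (real (Suc N) - real N) * (u * \<xi> powr (u - 1))" .
      have "u * real (Suc N) powr (u - 1) \<le> u * \<xi> powr (u - 1)"
        using \<xi> assms True by (intro mult_left_mono powr_mono2') auto
      also have "\<dots> = real (Suc N) powr u - real N powr u"
        using \<xi>(3) by (simp add: algebra_simps)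
      finally show ?thesis using assms by (simp add: field_simps)
    qed (use True assms in auto)
    thus ?case using Suc by (simp add: diff_divide_distrib)
  qed auto
  thus ?thesis by (smt (verit) powr_ge_zero)
next
  case False
  have "(\<Sum>n<N. real n powr (u - 1)) \<le> real N powr u / u"
  proof (induction N)
    case (Suc N)
    have "real N powr (u - 1) \<le> (real (Suc N) powr u - real N powr u) / u"
    proof (cases "N = 0")
      case False
      hence "0 < real N" "real N < real (Suc N)" by auto
      from powr_diff_mean_value[OF this, of u] obtain \<xi> where
        \<xi>: "real N < \<xi>" "\<xi> < real (Suc N)"
           "real (Suc N) powr u - real N powr u = (real (Suc N) - real N) * (u * \<xi> powr (u - 1))" .
      have "u * real N powr (u - 1) \<le> u * \<xi> powr (u - 1)"
        using \<xi> assms \<open>\<not> u \<le> 1\<close> by (intro mult_left_mono powr_mono2) auto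
      also have "\<dots> = real (Suc N) powr u - real N powr u"
        using \<xi>(3) by (simp add: algebra_simps)
      finally show ?thesis using assms by (simp add: field_simps)
    qed (use assms in auto)
    thus ?case using Suc by (simp add: diff_divide_distrib)
  qed auto
  thus ?thesis by (simp add: lessThan_Suc_atMost[symmetric])
qed

text \<open>On the circle \<open>1 / z\<close> is \<open>cnj z / R\<^sup>2\<close>, so the kernel is
  real there. Its factor \<open>Re z\<close> cancels the \<open>1 / Re z\<close> in the bounds for
  the tail and for the partial sum, which blow up near the imaginary axis.\<close>

lemma newman_kernel_circle:
  assumes "norm z = R" "R > 0"
  shows "1 / z + z / (of_real R)\<^sup>2 = of_real (2 * Re z / R\<^sup>2)"
proof -
  have "z \<noteq> 0" using assms by auto
  have "z * cnj z = (of_real R)\<^sup>2" using assms complex_norm_square[of z] by simp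
  hence "1 / z = cnj z / (of_real R)\<^sup>2" using \<open>z \<noteq> 0\<close> assms by (simp add: field_simps)
  hence "1 / z + z / (of_real R)\<^sup>2 = (cnj z + z) / (of_real R)\<^sup>2" by (simp add: add_divide_distrib)
  thus ?thesis using complex_add_cnj[of z] by (simp add: add.commute)
qed

text \<open>A Riemann-Lebesgue estimate with a rate: integration by parts on a piece of the
  imaginary axis, where the exponential has modulus 1. \<open>C\<close> depends on \<open>h\<close>
  but not on \<open>l\<close>.\<close>

lemma contour_integral_exp_linepath_bound:
  assumes V: "open V" "convex V" and h: "h holomorphic_on V" and ab: "a \<in> V" "b \<in> V"
    and re: "Re a = 0" "Re b = 0"
  obtains C where "\<And>l. l > 0 \<Longrightarrow>
     norm (contour_integral (linepath a b) (\<lambda>z. h z * exp (z * of_real l))) \<le> C / l"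
proof -
  define L where "L = closed_segment a b"
  have LV: "L \<subseteq> V" unfolding L_def using ab V(2) by (simp add: closed_segment_subset)
  have reL: "Re z = 0" if "z \<in> L" for z
    using that re by (auto simp: L_def in_segment)
  have dh: "deriv h holomorphic_on V" using h V(1) by (rule holomorphic_deriv)
  have "compact (h ` L)" "compact (deriv h ` L)"
    using h dh LV by (auto simp: L_def intro!: compact_continuous_image
        dest!: holomorphic_on_imp_continuous_on intro: continuous_on_subset)
  then obtain C1 C2 where C: "\<And>z. z \<in> L \<Longrightarrow> norm (h z) \<le> C1" "\<And>z. z \<in> L \<Longrightarrow> norm (deriv h z) \<le> C2"
    unfolding bounded_iff using compact_imp_bounded[of "h ` L"] compact_imp_bounded[of "deriv h ` L"]
    by (auto simp: bounded_iff)
  have aL: "a \<in> L" "b \<in> L" by (auto simp: L_def)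
  show ?thesis
  proof (rule that[of "2 * C1 + C2 * norm (b - a)"])
    fix l :: real assume l: "l > 0"
    let ?e = "\<lambda>z. exp (z * of_real l)"
    have *: "((\<lambda>z. h z * ?e z / of_real l) has_field_derivative (deriv h z * ?e z / of_real l + h z * ?e z)) (at z within V)"
      if "z \<in> V" for z
      using holomorphic_derivI[OF h V(1) that, of V] l 
      by (auto intro!: derivative_eq_intros simp: field_simps)
    have "((\<lambda>z. deriv h z * ?e z / of_real l + h z * ?e z) has_contour_integral
       (h b * ?e b / of_real l - h a * ?e a / of_real l)) (linepath a b)"
      using contour_integral_primitive[OF *, of "linepath a b"] LV by (simp add: L_def)
    moreover have i2: "(\<lambda>z. deriv h z * ?e z / of_real l) contour_integrable_on linepath a b"
      by (intro contour_integrable_continuous_linepath continuous_intros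
            continuous_on_subset[OF holomorphic_on_imp_continuous_on[OF dh]])
         (use LV l in \<open>auto simp: L_def\<close>)
    ultimately have i1: "((\<lambda>z. h z * ?e z) has_contour_integral
       (h b * ?e b / of_real l - h a * ?e a / of_real l - contour_integral (linepath a b) (\<lambda>z. deriv h z * ?e z / of_real l))) (linepath a b)"
      using has_contour_integral_diff[OF _ has_contour_integral_integral[OF i2]] by fastforce
    have ne: "norm (?e z) = 1" if "z \<in> L" for z using reL[OF that] by simp
    have "norm (contour_integral (linepath a b) (\<lambda>z. deriv h z * ?e z / of_real l)) \<le> C2 / l * norm (b - a)"
    proof (rule contour_integral_bound_linepath[OF i2])
      show "0 \<le> C2 / l" using C(2)[OF aL(1)] l by (smt (verit) norm_ge_zero divide_nonneg_pos)
    qed (use C(2) ne l in \<open>auto simp: norm_mult norm_divide L_def[symmetric] divide_right_mono\<close>)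
    moreover have "norm (h b * ?e b / of_real l) \<le> C1 / l" "norm (h a * ?e a / of_real l) \<le> C1 / l"
      using C(1) aL ne l by (auto simp: norm_mult norm_divide divide_right_mono)
    ultimately have "norm (contour_integral (linepath a b) (\<lambda>z. h z * ?e z)) \<le> C1 / l + C1 / l + C2 / l * norm (b - a)"
      unfolding contour_integral_unique[OF i1]
      by (smt (verit) norm_triangle_ineq4)
    also have "\<dots> = (2 * C1 + C2 * norm (b - a)) / l" by (simp add: add_divide_distrib)
    finally show "norm (contour_integral (linepath a b) (\<lambda>z. h z * ?e z)) \<le> (2 * C1 + C2 * norm (b - a)) / l" .
  qed
qed


lemma has_contour_integral_inverse_part_circlepath:
  assumes "R > 0" "s < t"
  shows "((\<lambda>z. c / z) has_contour_integral (\<i> * of_real (t - s) * c)) (part_circlepath 0 R s t)"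
proof -
  have "((\<lambda>x::real. \<i> * c) has_integral (\<i> * of_real (t - s) * c)) {s..t}"
    using has_integral_const_real[of "\<i> * c" s t] assms by (simp add: scaleR_conv_of_real mult_ac)
  thus ?thesis
    unfolding has_contour_integral_part_circlepath_iff[OF assms(2)]
    by (rule has_integral_eq[rotated]) (use assms in simp)
qed

lemma norm_powr_partial_sum_diff_le:
  fixes a :: "nat \<Rightarrow> complex"
  assumes B: "\<And>n. norm (a n) \<le> B"
    and sums: "(\<lambda>n. a n * of_nat n powr (-1 - z)) sums f" and "Re z > 0" "N \<ge> 1"
  shows "norm (f - (\<Sum>n\<le>N. a n * of_nat n powr (-1 - z))) \<le> B * real N powr (-Re z) / Re z"
proof -
  let ?t = "\<lambda>n. a n * of_nat n powr (-1 - z)"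
  have B0: "B \<ge> 0" using B[of 0] norm_ge_zero order_trans by blast
  have lim: "(\<lambda>M. sum ?t {..M} - sum ?t {..N}) \<longlonglongrightarrow> f - sum ?t {..N}"
    using sums unfolding sums_def_le by (intro tendsto_intros)
  have "norm (sum ?t {..M} - sum ?t {..N}) \<le> B * real N powr (-Re z) / Re z" if "M \<ge> N" for M
  proof -
    have "sum ?t {..M} - sum ?t {..N} = sum ?t {N<..M}"
      using that by (subst sum_diff[symmetric]) (auto intro!: sum.cong)
    also have "norm \<dots> \<le> (\<Sum>n\<in>{N<..M}. B * real n powr (-1 - Re z))"
      by (intro sum_norm_le) (auto simp: norm_mult intro!: mult_right_mono B)
    also have "\<dots> = B * (\<Sum>n\<in>{N<..M}. real n powr (-1 - Re z))"
      by (simp add: sum_distrib_left)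
    also have "\<dots> \<le> B * ((real N powr -Re z - real M powr -Re z) / Re z)"
      using assms that by (intro mult_left_mono sum_powr_tail_le B0) auto
    also have "\<dots> \<le> B * (real N powr -Re z / Re z)"
      using assms by (intro mult_left_mono divide_right_mono B0) auto
    finally show ?thesis by simp
  qed
  thus ?thesis
    by (intro tendsto_upperbound[OF tendsto_norm[OF lim]]) (auto intro!: eventually_sequentiallyI)
qed

text \<open>Cauchy's formula for the partial sum \<open>S\<close> on the circle of radius \<open>R\<close>, with Newman's kernel. On the left
  half of the circle \<open>S\<close> is bounded directly; on the right half \<open>S\<close> is compared with the limit
  \<open>z * g z\<close>, whose integral is moved to the diameter, where integration by parts gives
  \<open>C / ln N\<close>. The assumption that the limit is divisible by \<open>z\<close> removes the pole of the kernel.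
  Since \<open>0 powr w = 0\<close>, series may start at \<open>n = 0\<close>.\<close>
lemma newman_bound:
  fixes a :: "nat \<Rightarrow> complex"
  assumes B: "\<And>n. norm (a n) \<le> B"
    and U: "open U" "{z. Re z \<ge> 0} \<subseteq> U" and g: "g holomorphic_on U"
    and sums: "\<And>z. Re z > 0 \<Longrightarrow> (\<lambda>n. a n * of_nat n powr (-1 - z)) sums (z * g z)"
    and R: "R > 0"
  obtains C where "\<And>N. N \<ge> 2 \<Longrightarrow> norm (\<Sum>n\<le>N. a n / of_nat n) \<le> 2 * B / R + B / N + C / ln N"
proof -
  have B0: "B \<ge> 0" using B[of 0] norm_ge_zero order_trans by blast
  define K where "K = cball (0::complex) R \<inter> {z. Re z \<ge> 0}"
  have K: "compact K" "convex K" "K \<subseteq> U"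
    using U(2) by (auto simp: K_def compact_Int_closed closed_halfspace_Re_ge
        intro!: convex_Int convex_halfspace_Re_ge)
  then obtain e where e: "e > 0" "(\<Union>x\<in>K. ball x e) \<subseteq> U"
    using compact_subset_open_imp_ball_epsilon_subset U(1) by metis
  \<comment> \<open>The Minkowski sum of the half disc with a ball is open and convex, so every
    holomorphic function on it has a primitive. Moving the contour from the right half circle to the
    diameter then means evaluating one primitive at the same two endpoints.\<close>
  define V where "V = (\<Union>x\<in>K. \<Union>y\<in>ball 0 e. {x + y})"
  have V_eq: "V = (\<Union>x\<in>K. ball x e)"
  proof -
    have "w \<in> (\<Union>y\<in>ball 0 e. {x + y}) \<longleftrightarrow> w \<in> ball x e" for w x :: complex
      by (auto simp: dist_norm norm_minus_commute intro!: bexI[of _ "w - x"])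
    thus ?thesis unfolding V_def by blast
  qed
  have V: "open V" "convex V" "V \<subseteq> U"
    using e unfolding V_eq[symmetric] by (auto simp: V_def intro!: convex_sums K open_sums)
  have KV: "K \<subseteq> V" unfolding V_eq using e(1) by force
  \<comment> \<open>This is the limit \<open>z * g z\<close> times the kernel; the factor
    \<open>z\<close> has cancelled the pole, so \<open>h\<close> is holomorphic at 0 too.\<close>
  define h where "h = (\<lambda>z. g z * (1 + z\<^sup>2 / (of_real R)\<^sup>2))"
  have h: "h holomorphic_on V"
    unfolding h_def using R by (intro holomorphic_intros holomorphic_on_subset[OF g] V) auto
  let ?p = "\<i> * of_real R" and ?m = "-\<i> * of_real R"
  have pm: "?p \<in> V" "?m \<in> V" using KV R by (auto simp: K_def norm_mult)
  obtain C where C: "\<And>l. l > 0 \<Longrightarrow> norm (contour_integral (linepath ?m ?p) (\<lambda>z. h z * exp (z * of_real l))) \<le> C / l"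
    using contour_integral_exp_linepath_bound[OF V(1,2) h pm(2,1)] by auto
  show ?thesis
  proof (rule that[of "C / (2 * pi)"])
    fix N :: nat assume N: "N \<ge> 2"
    define S where "S = (\<lambda>z. \<Sum>n\<le>N. a n * of_nat n powr (-1 - z))"
    define E where "E = (\<lambda>z::complex. exp (z * of_real (ln (real N))))"
    define k where "k = (\<lambda>z::complex. 1 / z + z / (of_real R)\<^sup>2)"
    have nE: "norm (E z) = real N powr Re z" for z using N by (simp add: E_def powr_def)
    have "(\<lambda>z. of_nat n powr (-1 - z)) holomorphic_on UNIV" for n
      by (cases "n = 0") (auto intro!: holomorphic_intros)
    hence S_hol: "S holomorphic_on UNIV" unfolding S_def by (intro holomorphic_intros)
    define H where "H = (\<lambda>z. S z * E z * (1 + z\<^sup>2 / (of_real R)\<^sup>2))"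
    have H_hol: "H holomorphic_on UNIV" 
      unfolding H_def E_def using R by (intro holomorphic_intros S_hol) auto
    \<comment> \<open>Splitting off the pole: \<open>S * E * k\<close> is \<open>H 0 / z\<close>
      plus the entire function \<open>D\<close>. The primitive \<open>P\<close> of \<open>D\<close>
      contributes opposite amounts on the two half circles, so the two integrals add up to
      \<open>2 * pi * \<i> * H 0\<close>, and \<open>H 0\<close> is the partial sum to be
      bounded.\<close>
    define D where "D = (\<lambda>z. if z = 0 then deriv (\<lambda>z. H z - H 0) 0 else (H z - H 0) / z)"
    have "D holomorphic_on UNIV"
      by (rule pole_theorem_open_0[where g = "\<lambda>z. H z - H 0" and a = 0])
         (auto simp: D_def intro!: holomorphic_intros H_hol)
    then obtain P where P: "\<And>z. (P has_field_derivative D z) (at z)"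
      using holomorphic_convex_primitive'[of UNIV D] by auto
    let ?Ap = "part_circlepath 0 R (-pi/2) (pi/2)" and ?Am = "part_circlepath 0 R (pi/2) (3*pi/2)"
    have ends: "pathstart ?Ap = ?m" "pathfinish ?Ap = ?p" "pathstart ?Am = ?p" "pathfinish ?Am = ?m"
      using cos_3over2_pi sin_3over2_pi by (auto simp: exp_eq_polar complex_eq_iff)
    have nz: "norm z = R" if "z \<in> path_image (part_circlepath 0 R s t)" "s \<le> t" for z s t
      using in_path_image_part_circlepath[of z 0 R s t] that R by auto
    have Ap_Re: "Re z \<ge> 0" if "z \<in> path_image ?Ap" for z
      using that R by (auto simp: path_image_part_circlepath exp_eq_polar cos_ge_zero)
    have Am_Re: "Re z \<le> 0" if z: "z \<in> path_image ?Am" for z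
    proof -
      obtain x where x: "z = of_real R * exp (\<i> * of_real x)" "pi/2 \<le> x" "x \<le> 3*pi/2"
        using z by (auto simp: path_image_part_circlepath)
      have "cos (x - pi) \<ge> 0" using x by (intro cos_ge_zero) auto
      thus ?thesis using x R by (simp add: exp_eq_polar mult_nonneg_nonpos)
    qed
    have SEk: "S z * E z * k z = H 0 / z + D z" if "z \<noteq> 0" for z
    proof -
      have "z * k z = 1 + z\<^sup>2 / (of_real R)\<^sup>2"
        using that by (simp add: k_def distrib_left power2_eq_square)
      hence "H z = z * (S z * E z * k z)" by (simp add: H_def mult_ac)
      thus ?thesis using that by (simp add: D_def diff_divide_distrib)
    qed
    have S_int: "((\<lambda>z. S z * E z * k z) has_contour_integral (\<i> * of_real (t - s) * H 0 +
         (P (pathfinish (part_circlepath 0 R s t)) - P (pathstart (part_circlepath 0 R s t)))))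
         (part_circlepath 0 R s t)" if "s < t" for s t
    proof -
      have *: "(D has_contour_integral (P (pathfinish (part_circlepath 0 R s t)) - P (pathstart (part_circlepath 0 R s t))))
         (part_circlepath 0 R s t)"
        by (rule contour_integral_primitive[of UNIV]) (use P in auto)
      show ?thesis
        by (rule has_contour_integral_eq[OF has_contour_integral_add[OF has_contour_integral_inverse_part_circlepath[OF R that] *]])
           (metis SEk R less_imp_le norm_zero nz order_less_irrefl that)
    qed
    have Ip: "((\<lambda>z. S z * E z * k z) has_contour_integral (\<i> * of_real pi * H 0 + (P ?p - P ?m))) ?Ap"
      using S_int[of "-pi/2" "pi/2"] unfolding ends by simp
    have Im: "((\<lambda>z. S z * E z * k z) has_contour_integral (\<i> * of_real pi * H 0 + (P ?m - P ?p))) ?Am"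
      using S_int[of "pi/2" "3*pi/2"] unfolding ends by simp
    have "(\<lambda>z. h z * E z) holomorphic_on V" unfolding E_def by (intro holomorphic_intros h)
    then obtain Q where Q: "\<And>z. z \<in> V \<Longrightarrow> (Q has_field_derivative h z * E z) (at z within V)"
      using holomorphic_convex_primitive'[OF V(2,1)] by metis
    have ApV: "path_image ?Ap \<subseteq> V"
      using KV nz Ap_Re by (fastforce simp: K_def)
    have hI: "((\<lambda>z. h z * E z) has_contour_integral (Q ?p - Q ?m)) ?Ap"
      using contour_integral_primitive[OF Q _ ApV] unfolding ends by simp
    have "((\<lambda>z. h z * E z) has_contour_integral (Q ?p - Q ?m)) (linepath ?m ?p)"
      using contour_integral_primitive[OF Q, of "linepath ?m ?p"] pm V(2)
      by (simp add: closed_segment_subset)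
    hence Qb: "norm (Q ?p - Q ?m) \<le> C / ln N"
      using C[of "ln N"] N by (auto dest!: contour_integral_unique simp: E_def)
    have "((\<lambda>z. h z * E z - S z * E z * k z) has_contour_integral 
       ((Q ?p - Q ?m) - (\<i> * of_real pi * H 0 + (P ?p - P ?m)))) ?Ap"
      by (intro has_contour_integral_diff hI Ip)
    hence b1: "norm ((Q ?p - Q ?m) - (\<i> * of_real pi * H 0 + (P ?p - P ?m))) \<le> (2 * B / R\<^sup>2) * R * (pi/2 - -pi/2)"
    proof (rule has_contour_integral_bound_part_circlepath)
      fix z assume z: "z \<in> path_image ?Ap"
      have zR: "norm z = R" and zz: "Re z \<ge> 0" using nz[OF z] Ap_Re[OF z] by auto
      have z0: "z \<noteq> 0" using zR R by auto
      have kz: "k z = of_real (2 * Re z / R\<^sup>2)" unfolding k_def using newman_kernel_circle[OF zR R] .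
      have eq: "h z * E z - S z * E z * k z = (z * g z - S z) * E z * k z"
      proof -
        have "z * k z = 1 + z\<^sup>2 / (of_real R)\<^sup>2"
          using z0 by (simp add: k_def distrib_left power2_eq_square)
        hence "h z = z * g z * k z" by (simp add: h_def mult_ac)
        thus ?thesis by (simp add: algebra_simps)
      qed
      show "norm (h z * E z - S z * E z * k z) \<le> 2 * B / R\<^sup>2"
      proof (cases "Re z = 0")
        case False
        hence pos: "Re z > 0" using zz by simp
        have "norm (z * g z - S z) \<le> B * real N powr (-Re z) / Re z"
          unfolding S_def using norm_powr_partial_sum_diff_le[OF B sums[OF pos] pos] N by simp
        hence "norm ((z * g z - S z) * E z * k z) \<le> B * real N powr (-Re z) / Re z * real N powr Re z * (2 * Re z / R\<^sup>2)"
          unfolding norm_mult nE kz using pos by (intro mult_mono) (auto simp: B0 norm_mult norm_divide norm_power)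
        also have "\<dots> = 2 * B / R\<^sup>2 * (real N powr (-Re z) * real N powr Re z)" using pos by simp
        also have "\<dots> = 2 * B / R\<^sup>2" using N by (simp add: powr_add[symmetric])
        finally show ?thesis unfolding eq .
      qed (use B0 eq kz in auto)
    qed (use R B0 in auto)
    have b2: "norm (\<i> * of_real pi * H 0 + (P ?m - P ?p)) \<le> (2 * B / R\<^sup>2 * (1 + R / N)) * R * (3 * pi/2 - pi/2)"
    proof (rule has_contour_integral_bound_part_circlepath[OF Im])
      fix z assume z: "z \<in> path_image ?Am"
      have zR: "norm z = R" and zz: "Re z \<le> 0" using nz[OF z] Am_Re[OF z] by auto
      have kz: "k z = of_real (2 * Re z / R\<^sup>2)" unfolding k_def using newman_kernel_circle[OF zR R] .
      show "norm (S z * E z * k z) \<le> 2 * B / R\<^sup>2 * (1 + R / N)"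
      proof (cases "Re z = 0")
        case False
        define u where "u = - Re z"
        have u: "u > 0" "u \<le> R" using False zz zR abs_Re_le_cmod[of z] by (auto simp: u_def)
        have "norm (a n * of_nat n powr (-1 - z)) \<le> B * real n powr (u - 1)" for n
          using B[of n] by (simp add: norm_mult u_def minus_diff_commute mult_right_mono)
        hence "norm (S z) \<le> (\<Sum>n\<le>N. B * real n powr (u - 1))"
          unfolding S_def by (intro sum_norm_le)
        also have "\<dots> = B * (\<Sum>n\<le>N. real n powr (u - 1))" by (simp add: sum_distrib_left)
        also have "\<dots> \<le> B * (real N powr u / u + real N powr (u - 1))"
          by (intro mult_left_mono sum_powr_le u B0)
        also have "\<dots> = B * real N powr u * (1 / u + 1 / N)"
          using N by (simp add: powr_diff field_simps)
        finally have Sz: "norm (S z) \<le> B * real N powr u * (1 / u + 1 / N)" .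
        have "norm (E z) = real N powr (-u)" by (simp add: nE u_def)
        moreover have "norm (k z) = 2 * u / R\<^sup>2"
          unfolding kz using u(1) by (simp add: u_def norm_mult norm_divide norm_power)
        ultimately have "norm (S z * E z * k z) = norm (S z) * (real N powr (-u) * (2 * u / R\<^sup>2))"
          by (simp add: norm_mult)
        also have "\<dots> \<le> B * real N powr u * (1 / u + 1 / N) * (real N powr (-u) * (2 * u / R\<^sup>2))"
          using u(1) by (intro mult_right_mono Sz) auto
        also have "\<dots> = 2 * B / R\<^sup>2 * ((1 / u + 1 / N) * u) * (real N powr u * real N powr (-u))"
          by simp
        also have "(1 / u + 1 / N) * u = 1 + u / N" using u(1) by (simp add: distrib_right)
        also have "2 * B / R\<^sup>2 * (1 + u / N) * (real N powr u * real N powr (-u)) = 2 * B / R\<^sup>2 * (1 + u / N)" using N by (simp add: powr_add[symmetric])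
        also have "\<dots> \<le> 2 * B / R\<^sup>2 * (1 + R / N)"
          using u B0 by (intro mult_left_mono add_left_mono divide_right_mono) auto
        finally show ?thesis .
      qed (use B0 kz R in auto)
    qed (use R B0 in auto)
    let ?X = "(Q ?p - Q ?m) - (\<i> * of_real pi * H 0 + (P ?p - P ?m))" and ?Y = "\<i> * of_real pi * H 0 + (P ?m - P ?p)"
    have "2 * pi * norm (H 0) = norm (2 * \<i> * of_real pi * H 0)" by (simp add: norm_mult)
    also have "2 * \<i> * of_real pi * H 0 = (Q ?p - Q ?m) - ?X + ?Y" by (simp add: algebra_simps)
    also have "norm \<dots> \<le> norm (Q ?p - Q ?m) + norm ?X + norm ?Y"
      by (meson norm_triangle_ineq norm_triangle_ineq4 add_mono order_trans order_refl)
    \<comment> \<open>Each half circle has length \<open>pi * R\<close> and contributes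
      \<open>2 * pi * B / R\<close>, the left one with the extra factor \<open>1 + R / N\<close>.
      After division by \<open>2 * pi\<close> they give \<open>2 * B / R + B / N\<close>, of which
      only the first term survives for large \<open>N\<close>.\<close>
    also have "\<dots> \<le> C / ln N + (2 * B / R\<^sup>2) * R * (pi/2 - -pi/2) + (2 * B / R\<^sup>2 * (1 + R / N)) * R * (3 * pi/2 - pi/2)"
      using b1 b2 Qb by linarith
    also have "\<dots> = 2 * pi * (2 * B / R + B / N + C / (2 * pi) / ln N)"
      using R N by (simp add: field_simps power2_eq_square)
    finally have "norm (H 0) \<le> 2 * B / R + B / N + C / (2 * pi) / ln N" by simp
    moreover have "H 0 = (\<Sum>n\<le>N. a n / of_nat n)"
      unfolding H_def S_def E_def
      by (auto intro!: sum.cong simp: powr_minus_divide)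
    ultimately show "norm (\<Sum>n\<le>N. a n / of_nat n) \<le> 2 * B / R + B / N + C / (2 * pi) / ln N" by simp
  qed
qed

text \<open>The constant \<open>C\<close> of \<open>newman_bound\<close> depends on
  \<open>R\<close>, so \<open>R\<close> is fixed first, large enough for
  \<open>2 * B / R < \<epsilon>\<close>, and only then does \<open>N\<close> grow.\<close>

lemma newman_tauberian:
  fixes a :: "nat \<Rightarrow> complex"
  assumes B: "\<And>n. norm (a n) \<le> B"
    and U: "open U" "{z. Re z \<ge> 0} \<subseteq> U" and g: "g holomorphic_on U"
    and sums: "\<And>z. Re z > 0 \<Longrightarrow> (\<lambda>n. a n * of_nat n powr (-1 - z)) sums (z * g z)"
  shows "(\<lambda>N. \<Sum>n\<le>N. a n / of_nat n) \<longlonglongrightarrow> 0"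
proof (rule tendstoI)
  fix \<epsilon> :: real assume \<epsilon>: "\<epsilon> > 0"
  have B0: "B \<ge> 0" using B[of 0] norm_ge_zero order_trans by blast
  define R where "R = 4 * B / \<epsilon> + 1"
  have R: "R > 0" "2 * B / R < \<epsilon>"
  proof -
    show "R > 0" using \<epsilon> B0 by (simp add: R_def add_nonneg_pos)
    have "\<epsilon> * R = 4 * B + \<epsilon>" using \<epsilon> by (simp add: R_def field_simps)
    thus "2 * B / R < \<epsilon>" using \<open>R > 0\<close> \<epsilon> B0 by (simp add: divide_less_eq)
  qed
  obtain C where C: "\<And>N. N \<ge> 2 \<Longrightarrow> norm (\<Sum>n\<le>N. a n / of_nat n) \<le> 2 * B / R + B / N + C / ln N"
    using newman_bound[OF assms R(1)] by metis
  have "(\<lambda>N. 2 * B / R + B / real N + C / ln (real N)) \<longlonglongrightarrow> 2 * B / R + 0 + 0"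
    by (intro tendsto_intros; real_asymp)
  hence "eventually (\<lambda>N. 2 * B / R + B / real N + C / ln (real N) < \<epsilon>) sequentially"
    using R(2) by (intro order_tendstoD(2)) auto
  thus "eventually (\<lambda>N. dist (\<Sum>n\<le>N. a n / of_nat n) 0 < \<epsilon>) sequentially"
    using eventually_ge_at_top[of 2] by eventually_elim (use C in fastforce)
qed

text \<open>Abel summation: the mean of \<open>a\<close> equals \<open>s N\<close> minus the Cesaro
  mean of the earlier partial sums \<open>s n\<close> of the weighted series, and both tend to
  0.\<close>

lemma cesaro_mean_of_weighted_sums:
  fixes a :: "nat \<Rightarrow> complex"
  assumes "(\<lambda>N. \<Sum>n\<le>N. a n / of_nat n) \<longlonglongrightarrow> 0"
  shows "(\<lambda>N. (\<Sum>n=1..N. a n) / of_nat N) \<longlonglongrightarrow> 0"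
proof -
  define s where "s = (\<lambda>N. \<Sum>n\<le>N. a n / of_nat n)"
  have eq: "(\<Sum>n=1..N. a n) = of_nat N * s N - (\<Sum>n<N. s n)" for N
  proof (induction N)
    case (Suc N)
    have "of_nat (Suc N) * (a (Suc N) / of_nat (Suc N)) = a (Suc N)"
      by (simp del: of_nat_Suc)
    thus ?case using Suc by (simp add: s_def algebra_simps)
  qed (simp add: s_def)
  have lim: "s \<longlonglongrightarrow> 0" using assms unfolding s_def .
  have "(\<lambda>N. (\<Sum>n<N. s n) / of_nat N) \<longlonglongrightarrow> 0"
  proof (rule tendstoI)
    fix \<epsilon> :: real assume \<epsilon>: "\<epsilon> > 0"
    obtain M where M: "\<And>n. n \<ge> M \<Longrightarrow> norm (s n) < \<epsilon> / 2"
      using lim \<epsilon> unfolding LIMSEQ_iff by (metis diff_zero half_gt_zero)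
    define C where "C = (\<Sum>n<M. norm (s n))"
    have "(\<lambda>N. C / real N) \<longlonglongrightarrow> 0" by real_asymp
    hence "eventually (\<lambda>N. C / real N < \<epsilon> / 2) sequentially"
      using \<epsilon> by (intro order_tendstoD(2)) auto
    thus "eventually (\<lambda>N. dist ((\<Sum>n<N. s n) / of_nat N) 0 < \<epsilon>) sequentially"
      using eventually_ge_at_top[of "max 1 M"]
    proof eventually_elim
      case (elim N)
      have "norm (\<Sum>n<N. s n) \<le> (\<Sum>n<N. norm (s n))" by (rule norm_sum)
      also have "\<dots> = (\<Sum>n\<in>{..<M} \<union> {M..<N}. norm (s n))"
        using elim by (intro sum.cong) auto
      also have "\<dots> = C + (\<Sum>n\<in>{M..<N}. norm (s n))"
        unfolding C_def by (rule sum.union_disjoint) auto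
      also have "(\<Sum>n\<in>{M..<N}. norm (s n)) \<le> (\<Sum>n\<in>{M..<N}. \<epsilon> / 2)"
        using M by (intro sum_mono) (auto intro: less_imp_le)
      also have "\<dots> \<le> N * (\<epsilon> / 2)" using \<epsilon> by (auto intro: mult_right_mono)
      finally have "norm (\<Sum>n<N. s n) / N \<le> C / N + \<epsilon> / 2"
        using elim by (simp add: field_simps)
      hence "norm (\<Sum>n<N. s n) / N < \<epsilon>" using elim by linarith
      thus ?case by (simp add: norm_divide)
    qed
  qed
  hence "(\<lambda>N. s N - (\<Sum>n<N. s n) / of_nat N) \<longlonglongrightarrow> 0 - 0"
    by (intro tendsto_diff lim)
  moreover have "eventually (\<lambda>N. s N - (\<Sum>n<N. s n) / of_nat N = (\<Sum>n=1..N. a n) / of_nat N) sequentially"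
    using eventually_gt_at_top[of 0] by eventually_elim (unfold eq, simp add: diff_divide_distrib)
  ultimately show ?thesis by (simp add: filterlim_cong)
qed

section \<open>Analytic continuation of periodic Dirichlet series\<close>

lemma of_nat_segment:
  assumes "z \<in> closed_segment (of_nat n) (of_nat (Suc n) :: complex)"
  obtains x where "z = of_real x" "real n \<le> x" "x \<le> real (Suc n)"
proof -
  have "closed_segment (of_nat n) (of_nat (Suc n) :: complex) = of_real ` closed_segment (real n) (real (Suc n))"
    using closed_segment_of_real[of "real n" "real (Suc n)", where 'a = complex] by simp
  with assms obtain x where "z = of_real x" "x \<in> closed_segment (real n) (real (Suc n))" by auto
  with that show ?thesis by (auto simp: closed_segment_eq_real_ivl)
qed

lemma norm_powr_uminus_diff_le:
  fixes s z :: complex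
  assumes "n \<ge> 1" "Re s \<ge> 0" "z \<in> closed_segment (of_nat n) (of_nat (Suc n))"
  shows "norm (z powr -s - of_nat n powr -s) \<le> norm s * real n powr (-Re s - 1)"
proof -
  let ?S = "closed_segment (of_nat n) (of_nat (Suc n) :: complex)"
  have "norm (z powr -s - of_nat n powr -s) \<le> norm s * real n powr (-Re s - 1) * norm (z - of_nat n)"
  proof (rule field_differentiable_bound[where S = ?S and f' = "\<lambda>w. -s * w powr (-s - 1)"])
    fix w assume "w \<in> ?S"
    then obtain x where x: "w = of_real x" "real n \<le> x" "x \<le> real (Suc n)" by (rule of_nat_segment)
    hence "w \<notin> \<real>\<^sub>\<le>\<^sub>0" using assms by (auto simp: complex_nonpos_Reals_iff)
    thus "((\<lambda>w. w powr -s) has_field_derivative -s * w powr (-s - 1)) (at w within ?S)"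
      by (rule has_field_derivative_at_within[OF has_field_derivative_powr])
    have "norm (w powr (-s - 1)) = x powr (-Re s - 1)"
      using x assms by (simp add: norm_powr_real_powr)
    also have "\<dots> \<le> real n powr (-Re s - 1)" using x assms by (intro powr_mono2') auto
    finally show "norm (-s * w powr (-s - 1)) \<le> norm s * real n powr (-Re s - 1)"
      by (simp add: norm_mult mult_left_mono)
  qed (use assms in auto)
  also have "norm (z - of_nat n) \<le> 1"
  proof -
    obtain x where x: "z = of_real x" "real n \<le> x" "x \<le> real (Suc n)"
      using assms(3) by (rule of_nat_segment)
    have "z - of_nat n = of_real (x - real n)" by (simp add: x)
    thus ?thesis using x by (simp only: norm_of_real)
  qed
  finally show ?thesis by (simp add: mult_left_mono)
qed

text \<open>The term is an increment of \<open>f\<close>, and the derivative of \<open>f\<close>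
  vanishes at the left endpoint \<open>n\<close>. Applying the mean value inequality to
  \<open>f\<close> and to its derivative gains one power of \<open>n\<close> over
  \<open>n powr -s\<close>, which moves convergence from \<open>Re s > 1\<close> to
  \<open>Re s > 0\<close>.\<close>

lemma norm_zeta_term_le:
  fixes s :: complex
  assumes "n \<ge> 1" "Re s \<ge> 0"
  shows "norm ((s - 1) * of_nat n powr -s + of_nat (Suc n) powr (1 - s) - of_nat n powr (1 - s))
           \<le> norm (1 - s) * norm s * real n powr (-Re s - 1)"
proof -
  let ?S = "closed_segment (of_nat n) (of_nat (Suc n) :: complex)"
  define f where "f = (\<lambda>w::complex. w powr (1 - s) - (1 - s) * of_nat n powr -s * w)"
  have "norm (f (of_nat (Suc n)) - f (of_nat n)) \<le> norm (1 - s) * norm s * real n powr (-Re s - 1) * norm (of_nat (Suc n) - of_nat n :: complex)"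
  proof (rule field_differentiable_bound[where S = ?S and f' = "\<lambda>w. (1 - s) * (w powr -s - of_nat n powr -s)"])
    fix w assume w: "w \<in> ?S"
    then obtain x where x: "w = of_real x" "real n \<le> x" "x \<le> real (Suc n)" by (rule of_nat_segment)
    hence nz: "w \<notin> \<real>\<^sub>\<le>\<^sub>0" using assms by (auto simp: complex_nonpos_Reals_iff)
    show "(f has_field_derivative (1 - s) * (w powr -s - of_nat n powr -s)) (at w within ?S)"
      unfolding f_def
      by (rule derivative_eq_intros has_field_derivative_at_within[OF has_field_derivative_powr] nz refl)+
         (simp add: algebra_simps)
    show "norm ((1 - s) * (w powr -s - of_nat n powr -s)) \<le> norm (1 - s) * norm s * real n powr (-Re s - 1)"
      using norm_powr_uminus_diff_le[OF assms w] by (simp add: norm_mult mult_left_mono mult.assoc)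
  qed auto
  also have "f (of_nat (Suc n)) - f (of_nat n) = 
     (s - 1) * of_nat n powr -s + of_nat (Suc n) powr (1 - s) - of_nat n powr (1 - s)"
    by (simp add: f_def algebra_simps)
  finally show ?thesis by simp
qed

text \<open>This is \<open>(s - 1) * \<zeta>(s)\<close>, continued to \<open>Re s > 0\<close>; the term for \<open>n = 0\<close> is \<open>1\<close>.\<close>
definition zeta_reg :: "complex \<Rightarrow> complex" where
  "zeta_reg s = (\<Sum>n. (s - 1) * of_nat n powr -s + of_nat (Suc n) powr (1 - s) - of_nat n powr (1 - s))"

definition period_mean :: "nat \<Rightarrow> (nat \<Rightarrow> complex) \<Rightarrow> complex" where
  "period_mean q f = (\<Sum>m=1..q. f m) / of_nat q"

definition mean_error :: "nat \<Rightarrow> (nat \<Rightarrow> complex) \<Rightarrow> nat \<Rightarrow> complex" where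
  "mean_error q f n = (\<Sum>m=1..n. f m) - of_nat n * period_mean q f"

text \<open>By partial summation this is the Dirichlet series of \<open>f\<close> minus its mean,
  that is, the L-series of \<open>f\<close> with \<open>period_mean q f\<close> times zeta removed.
  The coefficients \<open>mean_error\<close> are periodic, hence bounded, so the series still
  converges for \<open>Re s > 0\<close>.\<close>

definition L_reg :: "nat \<Rightarrow> (nat \<Rightarrow> complex) \<Rightarrow> complex \<Rightarrow> complex" where
  "L_reg q f s = (\<Sum>n. mean_error q f n * (of_nat n powr -s - of_nat (Suc n) powr -s))"

lemma holomorphic_series_powr:
  fixes F :: "nat \<Rightarrow> complex \<Rightarrow> complex" and K :: "complex \<Rightarrow> real"
  assumes hol: "\<And>n. F n holomorphic_on {s. Re s > 0}"
    and bd: "\<And>n s. n \<ge> 1 \<Longrightarrow> Re s > 0 \<Longrightarrow> norm (F n s) \<le> K s * real n powr (-Re s - 1)"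
    and K: "continuous_on UNIV K" 
  shows "(\<lambda>s. \<Sum>n. F n s) holomorphic_on {s. Re s > 0}"
    and "\<And>s. Re s > 0 \<Longrightarrow> summable (\<lambda>n. F n s)"
proof -
  let ?S = "{s::complex. Re s > 0}"
  have S: "open ?S" by (simp add: open_halfspace_Re_gt)
  have "\<exists>g g'. \<forall>x\<in>?S. ((\<lambda>n. F n x) sums g x) \<and> ((\<lambda>n. deriv (F n) x) sums g' x) \<and> (g has_field_derivative g' x) (at x)"
  proof (rule series_and_derivative_comparison_local[OF S])
    fix n and x :: complex assume "x \<in> ?S"
    thus "(F n has_field_derivative deriv (F n) x) (at x)"
      using holomorphic_derivI[OF hol S] by blast
  next
    fix x :: complex assume x: "x \<in> ?S"
    \<comment> \<open>With this radius \<open>Re y \<ge> d\<close> holds on the whole ball, so a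
      single convergent series with terms \<open>n powr (-d - 1)\<close> dominates there.\<close>
    define d where "d = Re x / 2"
    have "bounded (K ` cball x d)"
      by (intro compact_imp_bounded compact_continuous_image continuous_on_subset[OF K]) auto
    then obtain C where C: "\<And>y. y \<in> cball x d \<Longrightarrow> norm (K y) \<le> C"
      unfolding bounded_iff by blast
    have "norm (F n y) \<le> C * real n powr (-d - 1)" if n: "n \<ge> 1" and y: "y \<in> ball x d" for n y
    proof -
      have "Re (x - y) \<le> norm (x - y)" by (rule complex_Re_le_cmod)
      hence re: "Re y \<ge> d" using y by (simp add: d_def dist_norm)
      have "Re y > 0" using re x by (simp add: d_def)
      hence "norm (F n y) \<le> K y * real n powr (-Re y - 1)" using bd n by blast
      also have "\<dots> \<le> C * real n powr (-d - 1)"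
        using C[of y] y re n by (intro mult_mono powr_mono) auto
      finally show ?thesis .
    qed
    moreover have "summable (\<lambda>n. C * real n powr (-d - 1))"
      using x by (intro summable_mult) (auto simp: summable_real_powr_iff d_def)
    ultimately show "\<exists>d h. 0 < d \<and> summable h \<and> (\<forall>\<^sub>F n in sequentially. \<forall>y\<in>ball x d \<inter> ?S. norm (F n y) \<le> h n)"
      using x by (intro exI[of _ d] exI[of _ "\<lambda>n. C * real n powr (-d - 1)"] conjI eventually_sequentiallyI[of 1])
        (auto simp: d_def)
  qed
  then obtain g g' where g: "\<And>x. x \<in> ?S \<Longrightarrow> (\<lambda>n. F n x) sums g x" 
     "\<And>x. x \<in> ?S \<Longrightarrow> (g has_field_derivative g' x) (at x)" by blast
  have "g holomorphic_on ?S" using g(2) S by (auto simp: holomorphic_on_open)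
  thus "(\<lambda>s. \<Sum>n. F n s) holomorphic_on ?S"
    by (rule holomorphic_transform) (use g(1) in \<open>auto simp: sums_iff\<close>)
  show "\<And>s. Re s > 0 \<Longrightarrow> summable (\<lambda>n. F n s)" using g(1) by (auto simp: sums_iff)
qed

lemma holomorphic_of_nat_powr: "(\<lambda>z. of_nat n powr (a * z + b)) holomorphic_on S"
  by (cases "n = 0") (auto intro!: holomorphic_intros)

lemma zeta_reg_holomorphic: "zeta_reg holomorphic_on {s. Re s > 0}"
  and zeta_reg_summable: "Re s > 0 \<Longrightarrow> 
     summable (\<lambda>n. (s - 1) * of_nat n powr -s + of_nat (Suc n) powr (1 - s) - of_nat n powr (1 - s))"
proof -
  have 1: "(\<lambda>s. (s - 1) * of_nat n powr -s + of_nat (Suc n) powr (1 - s) - of_nat n powr (1 - s))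
     holomorphic_on {s. Re s > 0}" for n
    using holomorphic_of_nat_powr[of n "-1" 0] holomorphic_of_nat_powr[of n "-1" 1]
      holomorphic_of_nat_powr[of "Suc n" "-1" 1]
    by (auto intro!: holomorphic_intros)
  note * = holomorphic_series_powr[OF 1, where K = "\<lambda>s. norm (1 - s) * norm s"]
  show "zeta_reg holomorphic_on {s. Re s > 0}"
    unfolding zeta_reg_def by (rule *(1)) (auto intro!: norm_zeta_term_le[simplified] continuous_intros)
  show "Re s > 0 \<Longrightarrow> 
     summable (\<lambda>n. (s - 1) * of_nat n powr -s + of_nat (Suc n) powr (1 - s) - of_nat n powr (1 - s))"
    by (rule *(2)) (auto intro!: norm_zeta_term_le[simplified] continuous_intros)
qed

text \<open>The residue of zeta at 1. It comes from the term \<open>n = 0\<close> alone, where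
  \<open>0 powr 0 = 0\<close> leaves the 1 standing; in all other terms the two powers
  cancel.\<close>

lemma zeta_reg_1: "zeta_reg 1 = 1"
proof -
  have "(\<lambda>n. (1 - 1) * of_nat n powr -1 + of_nat (Suc n) powr (1 - 1) - of_nat n powr (1 - 1) :: complex) 
        = (\<lambda>n. if n = 0 then 1 else 0)"
    by (auto simp: fun_eq_iff of_nat_Suc[symmetric] simp del: of_nat_Suc)
  thus ?thesis unfolding zeta_reg_def using suminf_finite[of "{0}" "\<lambda>n. if n = 0 then 1 else (0::complex)"] by simp
qed

lemma tendsto_of_nat_powr_0:
  assumes "Re s < 0"
  shows "(\<lambda>n. of_nat n powr (s::complex)) \<longlonglongrightarrow> 0"
proof (rule tendsto_norm_zero_cancel)
  show "(\<lambda>n. norm (of_nat n powr s)) \<longlonglongrightarrow> 0"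
    unfolding norm_of_nat_powr using assms by real_asymp
qed

text \<open>For \<open>Re s > 1\<close> the differences built into \<open>zeta_reg\<close> telescope
  to 0, leaving \<open>s - 1\<close> times the zeta series.\<close>

lemma zeta_sums:
  assumes "Re s > 1"
  shows "(\<lambda>n. of_nat n powr -s) sums (zeta_reg s / (s - 1))"
proof -
  have s1: "s \<noteq> 1" using assms by auto
  have "(\<lambda>n. of_nat n powr (1 - s)) \<longlonglongrightarrow> 0"
    by (rule tendsto_of_nat_powr_0) (use assms in auto)
  hence 1: "(\<lambda>n. of_nat (Suc n) powr (1 - s) - of_nat n powr (1 - s)) sums (0 - of_nat 0 powr (1 - s))"
    by (rule telescope_sums)
  have 2: "(\<lambda>n. (s - 1) * of_nat n powr -s + of_nat (Suc n) powr (1 - s) - of_nat n powr (1 - s)) sums zeta_reg s"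
    unfolding zeta_reg_def using zeta_reg_summable[of s] assms by (intro summable_sums) auto
  have "(\<lambda>n. (s - 1) * of_nat n powr -s) sums zeta_reg s"
    using sums_diff[OF 2 1] by simp
  from sums_mult[OF this, of "1 / (s - 1)"] show ?thesis using s1 by simp
qed

lemma period_mean_periodic_sum:
  assumes "q > 0" and per: "\<And>n. f (n + q) = f n"
  shows "(\<Sum>m=n+1..n+q. f m) = of_nat q * period_mean q f"
proof (induction n)
  case (Suc n)
  have "(\<Sum>m=Suc n+1..Suc n+q. f m) + f (Suc n) = (\<Sum>m=n+1..n+q. f m) + f (Suc n + q)"
  proof -
    have "{n+1..Suc n + q} = insert (Suc n) {Suc n + 1..Suc n + q}"
         "{n+1..Suc n + q} = insert (Suc n + q) {n+1..n+q}" by auto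
    hence "(\<Sum>m\<in>insert (Suc n) {Suc n + 1..Suc n + q}. f m) = (\<Sum>m\<in>insert (Suc n + q) {n+1..n+q}. f m)"
      by metis
    thus ?thesis by (simp add: add.commute)
  qed
  with Suc per[of "Suc n"] show ?case by simp
qed (use assms in \<open>auto simp: period_mean_def\<close>)

lemma mean_error_bounded:
  assumes "q > 0" and per: "\<And>n. f (n + q) = f n"
  obtains C where "C \<ge> 0" "\<And>n. norm (mean_error q f n) \<le> C"
proof -
  have *: "mean_error q f (n + q) = mean_error q f n" for n
  proof -
    have "{1..n+q} = {1..n} \<union> {n+1..n+q}" by auto
    hence "(\<Sum>m=1..n+q. f m) = (\<Sum>m=1..n. f m) + (\<Sum>m=n+1..n+q. f m)"
      using sum.union_disjoint[of "{1..n}" "{n+1..n+q}" f] by simp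
    thus ?thesis using period_mean_periodic_sum[of q f n] assms
      by (simp add: mean_error_def algebra_simps)
  qed
  have "mean_error q f n = mean_error q f (n mod q)" for n
  proof -
    have "mean_error q f (m + k * q) = mean_error q f m" for m k
      by (induction k) (use * in \<open>auto simp: algebra_simps\<close>, metis * add.assoc add.commute)
    from this[of "n mod q" "n div q"] show ?thesis by simp
  qed
  moreover have "norm (mean_error q f m) \<le> (\<Sum>m<q. norm (mean_error q f m))" if "m < q" for m
    using that by (intro member_le_sum) auto
  ultimately show ?thesis
    using assms(1) by (intro that[of "\<Sum>m<q. norm (mean_error q f m)"]) (auto intro: sum_nonneg, metis mod_less_divisor)
qed

lemma L_reg_holomorphic_aux:
  assumes "q > 0" and per: "\<And>n. f (n + q) = f n"
  shows L_reg_holomorphic: "L_reg q f holomorphic_on {s. Re s > 0}"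
    and L_reg_summable: "\<And>s. Re s > 0 \<Longrightarrow> 
       summable (\<lambda>n. mean_error q f n * (of_nat n powr -s - of_nat (Suc n) powr -s))"
proof -
  obtain C where C: "C \<ge> 0" "\<And>n. norm (mean_error q f n) \<le> C" using mean_error_bounded[of q f] assms by metis
  have 1: "(\<lambda>s. mean_error q f n * (of_nat n powr -s - of_nat (Suc n) powr -s)) holomorphic_on {s. Re s > 0}" for n
    using holomorphic_of_nat_powr[of n "-1" 0] holomorphic_of_nat_powr[of "Suc n" "-1" 0]
    by (auto intro!: holomorphic_intros)
  have 2: "norm (mean_error q f n * (of_nat n powr -s - of_nat (Suc n) powr -s)) \<le> C * norm s * real n powr (-Re s - 1)"
    if "n \<ge> 1" "Re s > 0" for n s
    using norm_powr_uminus_diff_le[of n s "of_nat (Suc n)"] that C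
    by (auto simp: norm_mult mult.assoc norm_minus_commute intro!: mult_mono)
  note * = holomorphic_series_powr[OF 1 2]
  show "L_reg q f holomorphic_on {s. Re s > 0}"
    unfolding L_reg_def by (rule *(1)) (auto intro!: continuous_intros)
  show "\<And>s. Re s > 0 \<Longrightarrow> summable (\<lambda>n. mean_error q f n * (of_nat n powr -s - of_nat (Suc n) powr -s))"
    by (rule *(2)) (auto intro!: continuous_intros)
qed

lemma periodic_partial_summation:
  "(\<Sum>n\<le>N. f n * of_nat n powr -s) = period_mean q f * (\<Sum>n\<le>N. of_nat n powr -s)
     + (\<Sum>n\<le>N. mean_error q f n * (of_nat n powr -s - of_nat (Suc n) powr -s))
     + mean_error q f N * of_nat (Suc N) powr -s"
proof (induction N)
  case (Suc N)
  have "f (Suc N) = mean_error q f (Suc N) - mean_error q f N + period_mean q f"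
    by (simp add: mean_error_def algebra_simps)
  hence "f (Suc N) * of_nat (Suc N) powr -s = mean_error q f (Suc N) * of_nat (Suc N) powr -s
     - mean_error q f N * of_nat (Suc N) powr -s + period_mean q f * of_nat (Suc N) powr -s"
    by (simp only: distrib_right left_diff_distrib)
  thus ?case using Suc by (simp add: algebra_simps del: of_nat_Suc)
qed (simp add: mean_error_def)

text \<open>The second alternative covers the point \<open>s = 1\<close> for functions of mean 0.
  There the value of the continued function must be the sum of the conditionally convergent series,
  because Monsky's argument speaks about that series.\<close>

lemma L_sums:
  assumes "q > 0" and per: "\<And>n. f (n + q) = f n" and s: "Re s > 1 \<or> Re s > 0 \<and> period_mean q f = 0"
  shows "(\<lambda>n. f n * of_nat n powr -s) sums (period_mean q f * (zeta_reg s / (s - 1)) + L_reg q f s)"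
proof -
  obtain C where C: "C \<ge> 0" "\<And>n. norm (mean_error q f n) \<le> C" using mean_error_bounded[of q f] assms(1,2) by metis
  have s0: "Re s > 0" using s by auto
  have "(\<lambda>N. of_nat (Suc N) powr -s) \<longlonglongrightarrow> 0"
    by (rule LIMSEQ_Suc, rule tendsto_of_nat_powr_0) (use s0 in auto)
  hence "(\<lambda>N. C * norm (of_nat (Suc N) powr -s)) \<longlonglongrightarrow> 0"
    by (intro tendsto_mult_right_zero tendsto_norm_zero)
  hence 1: "(\<lambda>N. mean_error q f N * of_nat (Suc N) powr -s) \<longlonglongrightarrow> 0"
    by (rule Lim_null_comparison[rotated])
       (use C in \<open>auto simp: norm_mult intro!: always_eventually mult_right_mono\<close>)
  have 2: "(\<lambda>N. \<Sum>n\<le>N. mean_error q f n * (of_nat n powr -s - of_nat (Suc n) powr -s)) \<longlonglongrightarrow> L_reg q f s"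
    unfolding L_reg_def using L_reg_summable[of q f s] assms s0
    by (auto simp: sums_def_le[symmetric] intro: summable_sums)
  have 3: "(\<lambda>N. period_mean q f * (\<Sum>n\<le>N. of_nat n powr -s)) \<longlonglongrightarrow> period_mean q f * (zeta_reg s / (s - 1))"
  proof (cases "period_mean q f = 0")
    case False
    thus ?thesis using zeta_sums[of s] s by (intro tendsto_intros) (auto simp: sums_def_le)
  qed auto
  have "(\<Sum>n\<le>N. f n * of_nat n powr -s) = period_mean q f * (\<Sum>n\<le>N. of_nat n powr -s)
     + (\<Sum>n\<le>N. mean_error q f n * (of_nat n powr -s - of_nat (Suc n) powr -s))
     + mean_error q f N * of_nat (Suc N) powr -s" for N
    by (rule periodic_partial_summation)
  moreover note tendsto_add[OF tendsto_add[OF 3 2] 1]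
  ultimately have "(\<lambda>N. \<Sum>n\<le>N. f n * of_nat n powr -s) \<longlonglongrightarrow> period_mean q f * (zeta_reg s / (s - 1)) + L_reg q f s + 0"
    by presburger
  thus ?thesis by (simp add: sums_def_le)
qed

section \<open>Sieving Dirichlet series\<close>

text \<open>Sieving one prime at a time gives the Euler product and the inverse of \<open>L\<close>:
  \<open>rough 0\<close> consists of all positive integers, and as \<open>k\<close> grows everything
  but 1 is pushed beyond \<open>k\<close>.\<close>

definition rough :: "nat \<Rightarrow> nat set" where
  "rough k = {n. n > 0 \<and> (\<forall>p. prime p \<longrightarrow> p \<le> k \<longrightarrow> \<not> p dvd n)}"

lemma rough_Suc_not_prime: "\<not> prime (Suc k) \<Longrightarrow> rough (Suc k) = rough k"
  unfolding rough_def by (auto simp: le_Suc_eq)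

lemma rough_Suc_prime:
  assumes "prime (Suc k)"
  shows "rough k = rough (Suc k) \<union> (\<lambda>m. Suc k * m) ` rough k"
    and "rough (Suc k) \<inter> (\<lambda>m. Suc k * m) ` rough k = {}"
proof -
  let ?p = "Suc k"
  have nd: "\<not> r dvd ?p" if "prime r" "r \<le> k" for r
    using primes_dvd_imp_eq[OF that(1) assms] that(2) by auto
  show "rough k = rough ?p \<union> (\<lambda>m. ?p * m) ` rough k"
  proof (intro equalityI subsetI)
    fix n assume n: "n \<in> rough k"
    show "n \<in> rough ?p \<union> (\<lambda>m. ?p * m) ` rough k"
    proof (cases "?p dvd n")
      case True
      then obtain m where m: "n = ?p * m" by auto
      have "m \<in> rough k" using n unfolding m rough_def by (auto intro: dvd_mult)
      thus ?thesis using m by auto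
    next
      case False
      thus ?thesis using n unfolding rough_def by (auto simp: le_Suc_eq)
    qed
  next
    fix n assume "n \<in> rough ?p \<union> (\<lambda>m. ?p * m) ` rough k"
    thus "n \<in> rough k"
      using nd unfolding rough_def by (auto simp: prime_dvd_mult_iff simp del: mult_Suc)
  qed
  show "rough ?p \<inter> (\<lambda>m. ?p * m) ` rough k = {}"
    using assms unfolding rough_def by (auto simp del: mult_Suc)
qed

lemma rough_subset: "rough k \<subseteq> insert 1 {k<..}"
proof
  fix n assume n: "n \<in> rough k"
  show "n \<in> insert 1 {k<..}"
  proof (cases "n = 1")
    case False
    then obtain p where "prime p" "p dvd n" using prime_factor_nat by blast
    moreover have "p \<le> n" using n \<open>p dvd n\<close> by (auto simp: rough_def intro: dvd_imp_le)
    ultimately show ?thesis using n by (auto simp: rough_def)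
  qed auto
qed

text \<open>An unconditional sum over a set, so that index sets may be split and reindexed; it is
  used for \<open>Re s > 1\<close>.\<close>

definition dirichlet_sum :: "(nat \<Rightarrow> complex) \<Rightarrow> complex \<Rightarrow> nat set \<Rightarrow> complex" where
  "dirichlet_sum f s A = (\<Sum>\<^sub>\<infinity>n\<in>A. f n * of_nat n powr -s)"

lemma dirichlet_abs_summable:
  assumes f: "\<And>n. norm (f n) \<le> 1" and s: "Re s > 1"
  shows "(\<lambda>n. norm (f n * of_nat n powr -s)) summable_on A"
proof -
  have "summable (\<lambda>n. real n powr (-Re s))" using s by (simp add: summable_real_powr_iff)
  hence "(\<lambda>n. real n powr (-Re s)) summable_on UNIV"
    by (subst summable_on_UNIV_nonneg_real_iff) auto
  hence "(\<lambda>n. real n powr (-Re s)) summable_on A" by (rule summable_on_subset_banach) auto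
  thus ?thesis
    by (rule Infinite_Sum.abs_summable_on_comparison_test')
       (use f in \<open>auto simp: norm_mult intro: mult_left_le_one_le\<close>)
qed

lemma dirichlet_summable:
  assumes f: "\<And>n. norm (f n) \<le> 1" and s: "Re s > 1"
  shows "(\<lambda>n. f n * of_nat n powr -s) summable_on A"
  using dirichlet_abs_summable[OF assms] by (rule abs_summable_summable)

text \<open>Apart from 1, all of \<open>rough k\<close> lies above \<open>k\<close>, so the rest is
  dominated by a tail of a convergent series.\<close>

lemma dirichlet_sum_rough_tendsto:
  assumes f: "\<And>n. norm (f n) \<le> 1" and s: "Re s > 1" and f1: "f 1 = 1"
  shows "(\<lambda>k. dirichlet_sum f s (rough k)) \<longlonglongrightarrow> 1"
proof -
  let ?t = "\<lambda>n. f n * of_nat n powr -s"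
  define \<sigma> where "\<sigma> = Re s - 1"
  have \<sigma>: "\<sigma> > 0" using s by (simp add: \<sigma>_def)
  have bd: "norm (dirichlet_sum f s (rough k) - 1) \<le> real k powr -\<sigma> / \<sigma>" if k: "k \<ge> 1" for k
  proof -
    have "rough k = insert 1 (rough k - {1})" by (auto simp: rough_def)
    hence "infsum ?t (rough k) = infsum ?t ({1} \<union> (rough k - {1}))" by auto
    also have "\<dots> = infsum ?t {1} + infsum ?t (rough k - {1})"
      by (intro infsum_Un_disjoint dirichlet_summable f s) auto
    finally have "dirichlet_sum f s (rough k) - 1 = infsum ?t (rough k - {1})"
      using f1 by (simp add: dirichlet_sum_def)
    also have "norm \<dots> \<le> (\<Sum>\<^sub>\<infinity>n\<in>rough k - {1}. norm (?t n))"
      by (intro norm_infsum_bound dirichlet_abs_summable f s)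
    also have "\<dots> \<le> real k powr -\<sigma> / \<sigma>"
    proof (rule infsum_le_finite_sums)
      show "(\<lambda>n. norm (?t n)) summable_on (rough k - {1})"
        by (rule dirichlet_abs_summable[OF f s])
      fix F assume F: "finite F" "F \<subseteq> rough k - {1}"
      define M where "M = Max (insert k F)"
      have M: "k \<le> M" "F \<subseteq> {k<..M}" using F rough_subset[of k] by (auto simp: M_def)
      have "(\<Sum>n\<in>F. norm (?t n)) \<le> (\<Sum>n\<in>F. real n powr (-1 - \<sigma>))"
        using f by (intro sum_mono) (auto simp: norm_mult \<sigma>_def intro: mult_left_le_one_le)
      also have "\<dots> \<le> (\<Sum>n\<in>{k<..M}. real n powr (-1 - \<sigma>))"
        by (intro sum_mono2 M) auto
      also have "\<dots> \<le> (real k powr -\<sigma> - real M powr -\<sigma>) / \<sigma>"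
        by (intro sum_powr_tail_le \<sigma> k M)
      also have "\<dots> \<le> real k powr -\<sigma> / \<sigma>" using \<sigma> by (intro divide_right_mono) auto
      finally show "(\<Sum>n\<in>F. norm (?t n)) \<le> real k powr -\<sigma> / \<sigma>" .
    qed
    finally show ?thesis .
  qed
  have "(\<lambda>k. real k powr -\<sigma> / \<sigma>) \<longlonglongrightarrow> 0" using \<sigma> by real_asymp
  hence "(\<lambda>k. dirichlet_sum f s (rough k) - 1) \<longlonglongrightarrow> 0"
    by (rule Lim_null_comparison[rotated]) (use bd in \<open>auto intro!: eventually_sequentiallyI[of 1]\<close>)
  thus ?thesis by (simp add: LIM_zero_iff)
qed

text \<open>Multiplicativity is deliberately not assumed: the splitting by divisibility serves both
  a character and its product with mu.\<close>

lemma dirichlet_sum_rough_prime: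
  assumes f: "\<And>n. norm (f n) \<le> 1" and s: "Re s > 1" and p: "prime (Suc k)"
  shows "dirichlet_sum f s (rough k) = dirichlet_sum f s (rough (Suc k))
     + of_nat (Suc k) powr -s * dirichlet_sum (\<lambda>m. f (Suc k * m)) s (rough k)"
proof -
  let ?t = "\<lambda>n. f n * of_nat n powr -s"
  let ?g = "\<lambda>m. Suc k * m"
  have "infsum ?t (rough k) = infsum ?t (rough (Suc k)) + infsum ?t (?g ` rough k)"
    by (subst rough_Suc_prime(1)[OF p])
       (intro infsum_Un_disjoint dirichlet_summable f s rough_Suc_prime(2)[OF p])
  also have "infsum ?t (?g ` rough k) = infsum (?t \<circ> ?g) (rough k)"
    by (rule infsum_reindex) (auto simp: inj_on_def simp del: mult_Suc)
  also have "?t \<circ> ?g = (\<lambda>m. of_nat (Suc k) powr -s * (f (Suc k * m) * of_nat m powr -s))"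
    using powr_times_real[of "of_nat (Suc k)" "of_nat m" "-s" for m]
    by (auto simp: fun_eq_iff simp del: mult_Suc of_nat_Suc)
  also have "infsum \<dots> (rough k) = of_nat (Suc k) powr -s * (\<Sum>\<^sub>\<infinity>m\<in>rough k. f (Suc k * m) * of_nat m powr -s)"
    by (rule infsum_cmult_right')
  finally show ?thesis unfolding dirichlet_sum_def .
qed

lemma dirichlet_sum_rough_Suc:
  assumes f: "\<And>n. norm (f n) \<le> 1" and s: "Re s > 1" and mult: "\<And>m n. f (m * n) = f m * f n"
    and p: "prime (Suc k)"
  shows "dirichlet_sum f s (rough (Suc k)) = (1 - f (Suc k) * of_nat (Suc k) powr -s) * dirichlet_sum f s (rough k)"
proof -
  have d: "dirichlet_sum (\<lambda>m. f (Suc k * m)) s (rough k) = f (Suc k) * dirichlet_sum f s (rough k)"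
    unfolding dirichlet_sum_def mult mult.assoc by (rule infsum_cmult_right')
  have alg: "b = (1 - x * c) * a" if "a = b + c * d" "d = x * a" for a b c d x :: complex
  proof -
    have "b = a - c * d" using that(1) by simp
    thus ?thesis unfolding that(2) by (simp add: algebra_simps)
  qed
  show ?thesis by (rule alg[OF dirichlet_sum_rough_prime[OF f s p] d])
qed

lemma dirichlet_sum_rough_eq_prod:
  assumes f: "\<And>n. norm (f n) \<le> 1" and s: "Re s > 1" and mult: "\<And>m n. f (m * n) = f m * f n"
  shows "dirichlet_sum f s (rough k) =
    (\<Prod>p | prime p \<and> p \<le> k. 1 - f p * of_nat p powr -s) * dirichlet_sum f s (rough 0)"
proof (induction k)
  case 0
  have "{p::nat. prime p \<and> p \<le> 0} = {}" by (auto simp: prime_gt_0_nat)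
  thus ?case by simp
next
  case (Suc k)
  show ?case
  proof (cases "prime (Suc k)")
    case True
    have "{p. prime p \<and> p \<le> Suc k} = insert (Suc k) {p. prime p \<and> p \<le> k}"
      using True by (auto simp: le_Suc_eq)
    thus ?thesis using Suc dirichlet_sum_rough_Suc[OF f s mult True] by (simp add: mult_ac)
  next
    case False
    hence "{p. prime p \<and> p \<le> Suc k} = {p. prime p \<and> p \<le> k}" by (auto simp: le_Suc_eq)
    thus ?thesis using Suc rough_Suc_not_prime[OF False] by simp
  qed
qed

lemma moebius_mu_prime_mult:
  assumes "prime p" "m > 0"
  shows "moebius_mu (p * m) = (if p dvd m then 0 else - moebius_mu m)"
proof (cases "p dvd m")
  case True
  then obtain k where "m = p * k" by auto
  hence "p\<^sup>2 dvd p * m" by (simp add: power2_eq_square)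
  moreover have "\<not> p dvd 1" using assms by auto
  ultimately have "\<not> squarefree (p * m)" by (rule not_squarefreeI)
  thus ?thesis using True by (simp add: moebius_mu_def)
next
  case False
  hence cop: "coprime p m" using assms by (simp add: prime_imp_coprime)
  have "squarefree (p * m) \<longleftrightarrow> squarefree m"
    using squarefree_mult_coprime[OF cop squarefree_prime] squarefree_multD(2) assms by blast
  moreover have "prime_factors (p * m) = insert p (prime_factors m)"
    using assms by (simp add: prime_factors_product prime_factorization_prime)
  moreover have "p \<notin> prime_factors m" using False by (auto simp: in_prime_factors_iff)
  ultimately show ?thesis using False by (simp add: moebius_mu_def)
qed

lemma moebius_mu_1: "moebius_mu 1 = 1" by (simp add: moebius_mu_def)

lemma abs_moebius_mu_le: "\<bar>moebius_mu n\<bar> \<le> 1" by (simp add: moebius_mu_def)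

lemma norm_moebius_mu_le: "norm (of_int (moebius_mu n) :: complex) \<le> 1"
  using abs_moebius_mu_le[of n] by (metis norm_of_int of_int_abs of_int_le_1_iff)

text \<open>Among the multiples \<open>p * m\<close> of the prime \<open>p\<close>, mu keeps only
  those with \<open>m\<close> prime to \<open>p\<close>, so the second part of the splitting is
  again a sum over \<open>rough (Suc k)\<close>. The Euler factor thus lands on the opposite side
  compared with \<open>dirichlet_sum_rough_Suc\<close>.\<close>

lemma dirichlet_sum_moebius_rough_Suc:
  assumes f: "\<And>n. norm (f n) \<le> 1" and s: "Re s > 1" and mult: "\<And>m n. f (m * n) = f m * f n"
    and p: "prime (Suc k)"
  defines "g \<equiv> \<lambda>n. of_int (moebius_mu n) * f n"
  shows "dirichlet_sum g s (rough k) = (1 - f (Suc k) * of_nat (Suc k) powr -s) * dirichlet_sum g s (rough (Suc k))"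
proof -
  let ?p = "Suc k"
  have g: "norm (g n) \<le> 1" for n
    using f[of n] norm_moebius_mu_le[of n] by (simp add: g_def norm_mult mult_le_one)
  have "dirichlet_sum (\<lambda>m. g (?p * m)) s (rough k) = (\<Sum>\<^sub>\<infinity>m\<in>rough ?p. - f ?p * (g m * of_nat m powr -s))"
    unfolding dirichlet_sum_def
  proof (rule infsum_cong_neutral)
    fix m assume "m \<in> rough k - rough ?p"
    hence "?p dvd m" "m > 0" using p by (auto simp: rough_def le_Suc_eq)
    thus "g (?p * m) * of_nat m powr -s = 0"
      using moebius_mu_prime_mult[OF p, of m] by (simp add: g_def del: mult_Suc)
  next
    fix m assume "m \<in> rough k \<inter> rough ?p"
    hence "\<not> ?p dvd m" "m > 0" using p by (auto simp: rough_def)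
    thus "g (?p * m) * of_nat m powr -s = - f ?p * (g m * of_nat m powr -s)"
      using moebius_mu_prime_mult[OF p, of m] by (simp add: g_def mult del: mult_Suc)
  next
    show "\<And>m. m \<in> rough ?p - rough k \<Longrightarrow> - f ?p * (g m * of_nat m powr -s) = 0"
      by (auto simp: rough_def)
  qed
  also have "\<dots> = - f ?p * dirichlet_sum g s (rough ?p)"
    unfolding dirichlet_sum_def by (rule infsum_cmult_right')
  finally have d: "dirichlet_sum (\<lambda>m. g (?p * m)) s (rough k) = - f ?p * dirichlet_sum g s (rough ?p)" .
  have alg: "a = (1 - x * c) * b" if "a = b + c * d" "d = - x * b" for a b c d x :: complex
    unfolding that by (simp add: algebra_simps)
  show ?thesis by (rule alg[OF dirichlet_sum_rough_prime[OF g s p] d])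
qed

text \<open>The product of the two sieved series does not depend on \<open>k\<close>, since the
  Euler factors cancel at each prime, and it tends to 1.\<close>

lemma dirichlet_sum_moebius_inverse:
  assumes f: "\<And>n. norm (f n) \<le> 1" and s: "Re s > 1" and mult: "\<And>m n. f (m * n) = f m * f n" and f1: "f 1 = 1"
  shows "dirichlet_sum (\<lambda>n. of_int (moebius_mu n) * f n) s (rough 0) * dirichlet_sum f s (rough 0) = 1"
proof -
  define g where "g = (\<lambda>n. of_int (moebius_mu n) * f n)"
  have g: "norm (g n) \<le> 1" for n
    using f[of n] norm_moebius_mu_le[of n] by (simp add: g_def norm_mult mult_le_one)
  define c where "c = dirichlet_sum g s (rough 0) * dirichlet_sum f s (rough 0)"
  have const: "dirichlet_sum g s (rough k) * dirichlet_sum f s (rough k) = c" for k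
  proof (induction k)
    case (Suc k)
    show ?case
    proof (cases "prime (Suc k)")
      case True
      show ?thesis
        unfolding Suc[symmetric] dirichlet_sum_rough_Suc[OF f s mult True]
        using dirichlet_sum_moebius_rough_Suc[OF f s mult True] by (simp add: g_def mult_ac del: of_nat_Suc)
    qed (use Suc rough_Suc_not_prime in simp)
  qed (simp add: c_def)
  have "(\<lambda>k. dirichlet_sum g s (rough k) * dirichlet_sum f s (rough k)) \<longlonglongrightarrow> 1 * 1"
    by (intro tendsto_mult dirichlet_sum_rough_tendsto f g s) (use f1 moebius_mu_1 in \<open>auto simp: g_def\<close>)
  hence "(\<lambda>k. c) \<longlonglongrightarrow> 1" by (simp add: const)
  hence "c = 1" by (simp add: LIMSEQ_const_iff)
  thus ?thesis unfolding c_def g_def .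
qed

lemma dirichlet_sum_sums:
  assumes f: "\<And>n. norm (f n) \<le> 1" and s: "Re s > 1"
  shows "(\<lambda>n. f n * of_nat n powr -s) sums dirichlet_sum f s (rough 0)"
proof -
  have "infsum (\<lambda>n. f n * of_nat n powr -s) UNIV = infsum (\<lambda>n. f n * of_nat n powr -s) (rough 0)"
    by (rule infsum_cong_neutral) (auto simp: rough_def prime_gt_0_nat)
  thus ?thesis unfolding dirichlet_sum_def
    using has_sum_infsum[OF dirichlet_summable[where f = f and A = UNIV, OF f s]] by (auto dest: has_sum_imp_sums)
qed

section \<open>Non-vanishing on the line of abscissa 1\<close>

definition dirichlet_char :: "nat \<Rightarrow> (nat \<Rightarrow> complex) \<Rightarrow> bool" where
  "dirichlet_char q \<psi> \<longleftrightarrow> q > 0 \<and> \<psi> 1 = 1 \<and> (\<forall>m n. \<psi> (m * n) = \<psi> m * \<psi> n) \<and>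
     (\<forall>n. \<psi> (n + q) = \<psi> n) \<and> (\<forall>n. \<not> coprime n q \<longrightarrow> \<psi> n = 0)"

lemma periodic_mod:
  assumes "\<And>n. f (n + q) = f n"
  shows "f (n mod q) = f (n::nat)"
proof -
  have "f (m + k * q) = f m" for m k
  proof (induction k)
    case (Suc k)
    have "f (m + Suc k * q) = f (m + k * q + q)" by (simp add: algebra_simps)
    with assms Suc show ?case by simp
  qed simp
  from this[of "n mod q" "n div q"] show ?thesis by simp
qed

lemma periodic_cong:
  assumes "\<And>n. f (n + q) = f n" "[m = n] (mod q)"
  shows "f m = f (n::nat)"
  using assms(2) periodic_mod[of f q m] periodic_mod[of f q n] assms(1) by (simp add: cong_def)

context
  fixes q :: nat and \<psi> :: "nat \<Rightarrow> complex"
  assumes \<psi>: "dirichlet_char q \<psi>"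
begin

lemma dchar_props:
  shows dchar_modulus_pos: "q > 0" and dchar_1: "\<psi> 1 = 1" and dchar_mult: "\<And>m n. \<psi> (m * n) = \<psi> m * \<psi> n"
    and dchar_periodic: "\<And>n. \<psi> (n + q) = \<psi> n" and dchar_not_coprime: "\<And>n. \<not> coprime n q \<Longrightarrow> \<psi> n = 0"
  using \<psi> unfolding dirichlet_char_def by auto

lemma dchar_power: "\<psi> (n ^ k) = \<psi> n ^ k"
  using dchar_1 by (induction k) (simp_all add: dchar_mult)

lemma norm_dchar_coprime:
  assumes "coprime n q"
  shows "norm (\<psi> n) = 1"
proof -
  have "[n ^ totient q = 1] (mod q)" using assms by (rule euler_theorem)
  hence "\<psi> (n ^ totient q) = \<psi> 1" by (rule periodic_cong[of \<psi> q, OF dchar_periodic])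
  hence "norm (\<psi> n) ^ totient q = 1" by (metis dchar_power dchar_1 norm_one norm_power)
  thus ?thesis using dchar_modulus_pos by (metis norm_ge_zero power_eq_1_iff totient_gt_0_iff less_not_refl2 real_norm_def abs_norm_cancel)
qed

lemma norm_dchar_le: "norm (\<psi> n) \<le> 1"
  using norm_dchar_coprime[of n] dchar_not_coprime[of n] by (cases "coprime n q") auto

lemma norm_dchar_cases: "norm (\<psi> n) = 1 \<or> \<psi> n = 0"
  using norm_dchar_coprime[of n] dchar_not_coprime[of n] by blast

lemma dchar_square: "dirichlet_char q (\<lambda>n. (\<psi> n)\<^sup>2)"
  using \<psi> unfolding dirichlet_char_def by (auto simp: power_mult_distrib)

text \<open>This is the principal character modulo \<open>q\<close>, obtained without a separate
  definition.\<close>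

lemma dchar_norm: "dirichlet_char q (\<lambda>n. of_real (norm (\<psi> n)))"
  using \<psi> unfolding dirichlet_char_def by (auto simp: norm_mult)

end

text \<open>At \<open>s = 1\<close> division by zero drops the first summand; the value there is the intended one
  only if the mean of \<open>f\<close> is \<open>0\<close>.\<close>
definition L_fun :: "nat \<Rightarrow> (nat \<Rightarrow> complex) \<Rightarrow> complex \<Rightarrow> complex" where
  "L_fun q f s = period_mean q f * (zeta_reg s / (s - 1)) + L_reg q f s"

lemma L_fun_holomorphic:
  assumes "q > 0" and per: "\<And>n. f (n + q) = f n"
  shows "L_fun q f holomorphic_on ({s. Re s > 0} - {1})"
    and "period_mean q f = 0 \<Longrightarrow> L_fun q f holomorphic_on {s. Re s > 0}"
proof -
  have L: "L_reg q f holomorphic_on {s. Re s > 0}" using L_reg_holomorphic[of q f] assms by blast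
  show "L_fun q f holomorphic_on ({s. Re s > 0} - {1})"
    unfolding L_fun_def
    by (intro holomorphic_intros holomorphic_on_subset[OF L] holomorphic_on_subset[OF zeta_reg_holomorphic]) auto
  show "period_mean q f = 0 \<Longrightarrow> L_fun q f holomorphic_on {s. Re s > 0}"
    using L by (simp add: L_fun_def[abs_def])
qed

lemma dirichlet_sum_eq_L_fun:
  assumes "q > 0" and per: "\<And>n. f (n + q) = f n" and f: "\<And>n. norm (f n) \<le> 1" and s: "Re s > 1"
  shows "dirichlet_sum f s (rough 0) = L_fun q f s"
  using L_sums[of q f s] dirichlet_sum_sums[of f s] assms sums_unique2 unfolding L_fun_def by blast

text \<open>The exponents are twice 3, 4, 1, so that only squared norms occur, each of the form
  \<open>1 + u \<le> exp u\<close>. With \<open>c = Re z\<close> the linear terms in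
  \<open>r\<close> add up to \<open>-4 * r * (1 + c)\<^sup>2\<close>, the usual square; bounding by
  \<open>exp\<close> instead of expanding a logarithm costs \<open>exp (8 * r\<^sup>2)\<close>,
  which stays bounded in the product over primes.\<close>

lemma three_four_one_aux:
  fixes r :: real and z :: complex
  assumes "r \<ge> 0" "norm z = 1"
  shows "norm (1 - of_real r :: complex) ^ 6 * norm (1 - of_real r * z) ^ 8 * norm (1 - of_real r * z\<^sup>2) ^ 2 \<le> exp (8 * r\<^sup>2)"
proof -
  define c where "c = Re z"
  have zz: "(Re z)\<^sup>2 + (Im z)\<^sup>2 = 1" using assms(2) by (simp add: cmod_def)
  have 1: "norm (1 - of_real r :: complex) ^ 2 = 1 + (r\<^sup>2 - 2 * r)"
  proof -
    have "norm (1 - of_real r :: complex) = \<bar>1 - r\<bar>" by (metis norm_of_real of_real_1 of_real_diff)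
    thus ?thesis by (simp add: power2_eq_square algebra_simps)
  qed
  have 2: "norm (1 - of_real r * z) ^ 2 = 1 + (r\<^sup>2 - 2 * r * c)"
  proof -
    have "norm (1 - of_real r * z) ^ 2 = 1 - 2 * r * c + r\<^sup>2 * ((Re z)\<^sup>2 + (Im z)\<^sup>2)"
      unfolding cmod_power2 by (simp add: power2_eq_square algebra_simps c_def)
    thus ?thesis using zz by simp
  qed
  have 3: "norm (1 - of_real r * z\<^sup>2) ^ 2 = 1 + (r\<^sup>2 - 2 * r * (2 * c\<^sup>2 - 1))"
  proof -
    have "norm (1 - of_real r * z\<^sup>2) ^ 2 = 1 - 2 * r * ((Re z)\<^sup>2 - (Im z)\<^sup>2) + r\<^sup>2 * ((Re z)\<^sup>2 + (Im z)\<^sup>2)\<^sup>2"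
      unfolding cmod_power2 by (simp add: power2_eq_square algebra_simps)
    moreover have "(Im z)\<^sup>2 = 1 - c\<^sup>2" using zz by (simp add: c_def)
    ultimately show ?thesis using zz by (simp add: c_def)
  qed
  have le: "norm (w::complex) ^ 2 = 1 + u \<Longrightarrow> norm w ^ 2 \<le> exp u" for w u using exp_ge_add_one_self[of u] by linarith
  have "norm (1 - of_real r :: complex) ^ 6 * norm (1 - of_real r * z) ^ 8 * norm (1 - of_real r * z\<^sup>2) ^ 2
     = (norm (1 - of_real r :: complex) ^ 2) ^ 3 * (norm (1 - of_real r * z) ^ 2) ^ 4 * norm (1 - of_real r * z\<^sup>2) ^ 2"
    by (simp flip: power_mult)
  also have "\<dots> \<le> exp (r\<^sup>2 - 2 * r) ^ 3 * exp (r\<^sup>2 - 2 * r * c) ^ 4 * exp (r\<^sup>2 - 2 * r * (2 * c\<^sup>2 - 1))"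
    by (intro mult_mono power_mono le 1 2 3) auto
  also have "\<dots> = exp (8 * r\<^sup>2 - 4 * (r * (1 + c)\<^sup>2))"
    by (simp add: exp_add[symmetric] exp_of_nat_mult[symmetric] power2_eq_square algebra_simps)
  also have "\<dots> \<le> exp (8 * r\<^sup>2)" using assms by simp
  finally show ?thesis .
qed

text \<open>The local inequality is multiplied over the primes up to \<open>k\<close>. Each finite
  Euler product times its L-value tends to 1, which leaves 1 on the left. The constant is
  \<open>exp 8\<close> because the sum of \<open>1 / n\<^sup>2\<close> over \<open>n \<ge> 2\<close>
  is at most 1.\<close>

lemma three_four_one:
  assumes \<psi>: "dirichlet_char q \<psi>" and \<sigma>: "\<sigma> > 1"
  shows "1 \<le> exp 8 * norm (L_fun q (\<lambda>n. of_real (norm (\<psi> n))) (of_real \<sigma>)) ^ 6 *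
     norm (L_fun q \<psi> (of_real \<sigma> + \<i> * of_real t)) ^ 8 *
     norm (L_fun q (\<lambda>n. (\<psi> n)\<^sup>2) (of_real \<sigma> + 2 * \<i> * of_real t)) ^ 2"
proof -
  define f0 where "f0 = (\<lambda>n. complex_of_real (norm (\<psi> n)))"
  define f2 where "f2 = (\<lambda>n. (\<psi> n)\<^sup>2)"
  have f0: "dirichlet_char q f0" and f2: "dirichlet_char q f2"
    unfolding f0_def f2_def by (rule dchar_norm[OF \<psi>], rule dchar_square[OF \<psi>])
  define s0 where "s0 = complex_of_real \<sigma>"
  define s1 where "s1 = of_real \<sigma> + \<i> * of_real t"
  define s2 where "s2 = of_real \<sigma> + 2 * \<i> * of_real t"
  have Re: "Re s0 > 1" "Re s1 > 1" "Re s2 > 1" using \<sigma> by (auto simp: s0_def s1_def s2_def)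
  define P where "P = (\<lambda>f s k. \<Prod>p | prime p \<and> p \<le> k. 1 - f p * complex_of_nat p powr -s)"
  have lim: "(\<lambda>k. P f s k * L_fun q f s) \<longlonglongrightarrow> 1" if "dirichlet_char q f" "Re s > 1" for f s
  proof -
    have "(\<lambda>k. dirichlet_sum f s (rough k)) \<longlonglongrightarrow> 1"
      by (rule dirichlet_sum_rough_tendsto[where f = f, OF norm_dchar_le[OF that(1)] that(2) dchar_1[OF that(1)]])
    also have "(\<lambda>k. dirichlet_sum f s (rough k)) = (\<lambda>k. P f s k * L_fun q f s)"
      unfolding P_def 
      using dirichlet_sum_rough_eq_prod[of f s] dirichlet_sum_eq_L_fun[of q f s]
        dchar_props[OF that(1)] norm_dchar_le[OF that(1)] that(2)
      by simp
    finally show ?thesis .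
  qed
  have prime_bd: "norm (1 - f0 p * of_nat p powr -s0) ^ 6 * norm (1 - \<psi> p * of_nat p powr -s1) ^ 8 *
       norm (1 - f2 p * of_nat p powr -s2) ^ 2 \<le> exp (8 * real p powr (-1 - 1))" if p: "prime p" for p
  proof (cases "\<psi> p = 0")
    case False
    hence 1: "norm (\<psi> p) = 1" using norm_dchar_cases[OF \<psi>] by blast
    have p2: "p \<ge> 2" "p \<noteq> 0" using p prime_ge_2_nat by auto
    define r where "r = real p powr -\<sigma>"
    define z where "z = \<psi> p * of_nat p powr (-\<i> * of_real t)"
    have "norm z = 1" using 1 p2 by (simp add: z_def norm_mult)
    have r: "of_nat p powr -s0 = complex_of_real r"
      using powr_of_real[of "real p" "-\<sigma>"] by (simp add: r_def s0_def)
    have e1: "\<psi> p * of_nat p powr -s1 = of_real r * z"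
    proof -
      have "-s1 = -s0 + (-\<i> * of_real t)" by (simp add: s1_def s0_def)
      thus ?thesis by (simp only: powr_add r z_def mult_ac)
    qed
    have e2: "f2 p * of_nat p powr -s2 = of_real r * z\<^sup>2"
    proof -
      have "-s2 = -s0 + (-\<i> * of_real t) + (-\<i> * of_real t)" by (simp add: s2_def s0_def)
      hence "of_nat p powr -s2 = of_real r * of_nat p powr (-\<i> * of_real t) * of_nat p powr (-\<i> * of_real t)"
        by (simp only: powr_add r)
      thus ?thesis by (simp add: f2_def z_def power2_eq_square mult_ac)
    qed
    have "r\<^sup>2 = real p powr (-2 * \<sigma>)" using p2 by (simp add: r_def power2_eq_square powr_add[symmetric])
    also have "\<dots> \<le> real p powr (-1 - 1)" using p2 \<sigma> by (intro powr_mono) auto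
    finally have le: "exp (8 * r\<^sup>2) \<le> exp (8 * real p powr (-1 - 1))" by simp
    have e0: "f0 p * of_nat p powr -s0 = of_real r" by (simp add: f0_def 1 r)
    show ?thesis
      unfolding e0 e1 e2 using \<open>norm z = 1\<close>
      by (intro order_trans[OF three_four_one_aux le]) (simp_all add: r_def)
  qed (simp add: f0_def f2_def)
  have fin: "finite {p. prime p \<and> p \<le> k}" for k :: nat by (rule finite_subset[of _ "{..k}"]) auto
  have bd: "norm (P f0 s0 k) ^ 6 * norm (P \<psi> s1 k) ^ 8 * norm (P f2 s2 k) ^ 2 \<le> exp 8" for k
  proof -
    have "norm (P f0 s0 k) ^ 6 * norm (P \<psi> s1 k) ^ 8 * norm (P f2 s2 k) ^ 2 = 
       (\<Prod>p | prime p \<and> p \<le> k. norm (1 - f0 p * of_nat p powr -s0) ^ 6 * norm (1 - \<psi> p * of_nat p powr -s1) ^ 8 *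
       norm (1 - f2 p * of_nat p powr -s2) ^ 2)"
      unfolding P_def prod_norm[symmetric] prod_power_distrib[symmetric] prod.distrib by simp
    also have "\<dots> \<le> (\<Prod>p | prime p \<and> p \<le> k. exp (8 * real p powr (-1 - 1)))"
      using prime_bd by (intro prod_mono) auto
    also have "\<dots> = exp (8 * (\<Sum>p | prime p \<and> p \<le> k. real p powr (-1 - 1)))"
      by (simp add: exp_sum[OF fin] sum_distrib_left)
    also have "\<dots> \<le> exp (8 * 1)"
    proof -
      have "(\<Sum>p | prime p \<and> p \<le> k. real p powr (-1 - 1)) \<le> (\<Sum>p\<in>{1<..max k 1}. real p powr (-1 - 1))"
        by (rule sum_mono2) (auto dest: prime_gt_1_nat)
      also have "\<dots> \<le> (real 1 powr -1 - real (max k 1) powr -1) / 1"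
        by (rule sum_powr_tail_le) auto
      also have "\<dots> \<le> 1" by simp
      finally show ?thesis by simp
    qed
    finally show ?thesis by simp
  qed
  let ?A = "norm (L_fun q f0 s0)" and ?B = "norm (L_fun q \<psi> s1)" and ?C = "norm (L_fun q f2 s2)"
  have "(\<lambda>k. norm (P f0 s0 k * L_fun q f0 s0) ^ 6 * norm (P \<psi> s1 k * L_fun q \<psi> s1) ^ 8 * norm (P f2 s2 k * L_fun q f2 s2) ^ 2)
     \<longlonglongrightarrow> norm (1::complex) ^ 6 * norm (1::complex) ^ 8 * norm (1::complex) ^ 2"
    by (intro tendsto_intros lim f0 f2 \<psi> Re)
  hence "1 \<le> exp 8 * (?A ^ 6 * ?B ^ 8 * ?C ^ 2)"
  proof (intro tendsto_upperbound[OF _ always_eventually])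
    show "\<forall>k. norm (P f0 s0 k * L_fun q f0 s0) ^ 6 * norm (P \<psi> s1 k * L_fun q \<psi> s1) ^ 8 * norm (P f2 s2 k * L_fun q f2 s2) ^ 2
       \<le> exp 8 * (?A ^ 6 * ?B ^ 8 * ?C ^ 2)"
    proof
      fix k
      have "norm (P f0 s0 k * L_fun q f0 s0) ^ 6 * norm (P \<psi> s1 k * L_fun q \<psi> s1) ^ 8 * norm (P f2 s2 k * L_fun q f2 s2) ^ 2
        = (norm (P f0 s0 k) ^ 6 * norm (P \<psi> s1 k) ^ 8 * norm (P f2 s2 k) ^ 2) * (?A ^ 6 * ?B ^ 8 * ?C ^ 2)"
        by (simp add: norm_mult power_mult_distrib mult_ac)
      also have "\<dots> \<le> exp 8 * (?A ^ 6 * ?B ^ 8 * ?C ^ 2)"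
        by (intro mult_right_mono bd) auto
      finally show "norm (P f0 s0 k * L_fun q f0 s0) ^ 6 * norm (P \<psi> s1 k * L_fun q \<psi> s1) ^ 8 * norm (P f2 s2 k * L_fun q f2 s2) ^ 2
       \<le> exp 8 * (?A ^ 6 * ?B ^ 8 * ?C ^ 2)" .
    qed
  qed auto
  thus ?thesis unfolding f0_def f2_def s0_def s1_def s2_def by (simp only: mult.assoc)
qed

text \<open>Approach the point from the right at distance \<open>h\<close>. The principal character
  costs at most \<open>h ^ 6\<close> in the denominator, a zero supplies \<open>h ^ 8\<close>, and
  the third factor stays bounded, so the right side of \<open>three_four_one\<close> would be of
  order \<open>h ^ 2\<close>. The third factor is bounded if \<open>2 * t\<close> avoids the
  possible pole or if the squared character has mean 0; this is why a real character at
  \<open>t = 0\<close> escapes the method.\<close>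

lemma L_fun_nonzero_341:
  assumes \<psi>: "dirichlet_char q \<psi>"
    and t: "t \<noteq> 0 \<or> period_mean q \<psi> = 0 \<and> period_mean q (\<lambda>n. (\<psi> n)\<^sup>2) = 0"
  shows "L_fun q \<psi> (1 + \<i> * of_real t) \<noteq> 0"
proof
  assume zero: "L_fun q \<psi> (1 + \<i> * of_real t) = 0"
  define f0 where "f0 = (\<lambda>n. complex_of_real (norm (\<psi> n)))"
  define f2 where "f2 = (\<lambda>n. (\<psi> n)\<^sup>2)"
  have f0: "dirichlet_char q f0" and f2: "dirichlet_char q f2"
    unfolding f0_def f2_def by (rule dchar_norm[OF \<psi>], rule dchar_square[OF \<psi>])
  have op: "open {s::complex. Re s > 0}" "open ({s::complex. Re s > 0} - {1})"
    by (auto simp: open_halfspace_Re_gt)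
  have diff: "L_fun q f field_differentiable at (1 + \<i> * of_real u)"
    if "dirichlet_char q f" "u \<noteq> 0 \<or> period_mean q f = 0" for f u
  proof (cases "u = 0")
    case True
    hence "L_fun q f holomorphic_on {s. Re s > 0}"
      using L_fun_holomorphic(2)[of q f] dchar_props[OF that(1)] that(2) by blast
    thus ?thesis using op(1) by (auto intro: holomorphic_on_imp_differentiable_at)
  next
    case False
    have "L_fun q f holomorphic_on {s. Re s > 0} - {1}"
      using L_fun_holomorphic(1)[of q f] dchar_props[OF that(1)] by blast
    thus ?thesis using op(2) False by (auto intro!: holomorphic_on_imp_differentiable_at)
  qed
  define h where "h = (\<lambda>n::nat. 1 / real (Suc n))"
  have hpos: "h n > 0" for n by (simp add: h_def)
  have h0: "h \<longlonglongrightarrow> 0" unfolding h_def by real_asymp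
  have hc: "(\<lambda>n. complex_of_real (h n)) \<longlonglongrightarrow> 0" using tendsto_of_real[OF h0] by simp
  have fl: "filterlim (\<lambda>n. complex_of_real (h n)) (at 0) sequentially"
    using hc hpos by (auto simp: filterlim_at intro!: always_eventually less_imp_neq[symmetric])
  obtain d where "(L_fun q \<psi> has_field_derivative d) (at (1 + \<i> * of_real t))"
    using diff[OF \<psi>] t by (auto simp: field_differentiable_def)
  hence "((\<lambda>h. (L_fun q \<psi> (1 + \<i> * of_real t + h) - L_fun q \<psi> (1 + \<i> * of_real t)) / h) \<longlongrightarrow> d) (at 0)"
    by (simp add: DERIV_def)
  from filterlim_compose[OF this fl] have l1: "(\<lambda>n. L_fun q \<psi> (1 + \<i> * of_real t + of_real (h n)) / of_real (h n)) \<longlonglongrightarrow> d"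
    unfolding zero by simp
  have "isCont (L_fun q f2) (1 + \<i> * of_real (2 * t))"
    using diff[OF f2, of "2 * t"] t by (intro field_differentiable_imp_continuous_at) (auto simp: f2_def)
  hence l2: "(\<lambda>n. L_fun q f2 (1 + \<i> * of_real (2 * t) + of_real (h n))) \<longlonglongrightarrow> L_fun q f2 (1 + \<i> * of_real (2 * t))"
    using tendsto_add[OF tendsto_const hc] isCont_tendsto_compose by fastforce
  \<comment> \<open>\<open>(s - 1)\<close> times \<open>L\<close> of the principal character, in a
    form that is regular at 1.\<close>
  define G where "G = (\<lambda>s. period_mean q f0 * zeta_reg s + (s - 1) * L_reg q f0 s)"
  have "L_reg q f0 holomorphic_on {s. Re s > 0}"
    using L_reg_holomorphic[of q f0] dchar_props[OF f0] by blast
  hence "G holomorphic_on {s. Re s > 0}"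
    unfolding G_def by (intro holomorphic_intros zeta_reg_holomorphic)
  hence "isCont G 1" using op(1)
    by (auto dest!: holomorphic_on_imp_continuous_on simp: continuous_on_eq_continuous_at)
  hence "(\<lambda>n. G (1 + of_real (h n))) \<longlonglongrightarrow> G 1"
    using tendsto_add[OF tendsto_const hc] isCont_tendsto_compose by fastforce
  moreover have "G (1 + of_real (h n)) = of_real (h n) * L_fun q f0 (1 + of_real (h n))" for n
    using hpos[of n] by (simp add: G_def L_fun_def algebra_simps)
  ultimately have l0: "(\<lambda>n. of_real (h n) * L_fun q f0 (1 + of_real (h n))) \<longlonglongrightarrow> G 1" by simp
  let ?A = "\<lambda>n. of_real (h n) * L_fun q f0 (1 + of_real (h n))"
  let ?B = "\<lambda>n. L_fun q \<psi> (1 + \<i> * of_real t + of_real (h n)) / of_real (h n)"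
  let ?C = "\<lambda>n. L_fun q f2 (1 + \<i> * of_real (2 * t) + of_real (h n))"
  have "(\<lambda>n. exp 8 * norm (?A n) ^ 6 * norm (?B n) ^ 8 * norm (?C n) ^ 2 * h n ^ 2) \<longlonglongrightarrow> 
     exp 8 * norm (G 1) ^ 6 * norm d ^ 8 * norm (L_fun q f2 (1 + \<i> * of_real (2 * t))) ^ 2 * 0 ^ 2"
    by (intro tendsto_intros l0 l1 l2 h0)
  moreover have "1 \<le> exp 8 * norm (?A n) ^ 6 * norm (?B n) ^ 8 * norm (?C n) ^ 2 * h n ^ 2" for n
  proof -
    have "1 \<le> exp 8 * norm (L_fun q f0 (1 + of_real (h n))) ^ 6 *
       norm (L_fun q \<psi> (1 + \<i> * of_real t + of_real (h n))) ^ 8 *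
       norm (?C n) ^ 2"
      using three_four_one[OF \<psi>, of "1 + h n" t] hpos[of n] unfolding f0_def f2_def
      by (simp add: algebra_simps)
    also have "norm (L_fun q f0 (1 + of_real (h n))) = norm (?A n) / h n"
      using hpos[of n] by (simp add: norm_mult)
    also have "norm (L_fun q \<psi> (1 + \<i> * of_real t + of_real (h n))) = norm (?B n) * h n"
      using hpos[of n] by (simp add: norm_divide)
    also have "exp 8 * (norm (?A n) / h n) ^ 6 * (norm (?B n) * h n) ^ 8 * norm (?C n) ^ 2 =
       exp 8 * norm (?A n) ^ 6 * norm (?B n) ^ 8 * norm (?C n) ^ 2 * (h n ^ 8 / h n ^ 6)"
      by (simp only: power_divide power_mult_distrib) simp
    also have "h n ^ 8 / h n ^ 6 = h n ^ 2" using hpos[of n] by (simp add: power_diff[symmetric])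
    finally show ?thesis .
  qed
  ultimately have "1 \<le> exp 8 * norm (G 1) ^ 6 * norm d ^ 8 * norm (L_fun q f2 (1 + \<i> * of_real (2 * t))) ^ 2 * 0 ^ 2"
    by (intro tendsto_lowerbound[OF _ always_eventually]) auto
  thus False by simp
qed

section \<open>Monsky's Lambert series argument for real characters at 1\<close>

lemma sum_sign_powers:
  fixes \<epsilon> :: real
  assumes "\<epsilon> \<in> {-1, 0, 1}"
  shows "(\<Sum>i\<le>k. \<epsilon> ^ i) \<ge> 0" and "even k \<Longrightarrow> (\<Sum>i\<le>k. \<epsilon> ^ i) \<ge> 1"
proof -
  have m: "(\<Sum>i\<le>k. (-1) ^ i) = (if even k then 1 else 0 :: real)" by (induction k) auto
  have z: "(\<Sum>i\<le>k. 0 ^ i) = (1 :: real)" by (induction k) auto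
  from assms consider "\<epsilon> = -1" | "\<epsilon> = 0" | "\<epsilon> = 1" by auto
  hence "(\<Sum>i\<le>k. \<epsilon> ^ i) \<ge> 0 \<and> (even k \<longrightarrow> (\<Sum>i\<le>k. \<epsilon> ^ i) \<ge> 1)"
    by cases (use m z in auto)
  thus "(\<Sum>i\<le>k. \<epsilon> ^ i) \<ge> 0" and "even k \<Longrightarrow> (\<Sum>i\<le>k. \<epsilon> ^ i) \<ge> 1" by auto
qed

lemma divisor_sum_prime_power_mult:
  fixes e :: "nat \<Rightarrow> real"
  assumes mult: "\<And>m n. e (m * n) = e m * e n" and e1: "e 1 = 1"
    and p: "prime p" "\<not> p dvd m"
  shows "(\<Sum>d | d dvd p ^ k * m. e d) = (\<Sum>i\<le>k. e p ^ i) * (\<Sum>d | d dvd m. e d)"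
proof -
  have pow: "e (p ^ i) = e p ^ i" for i using e1 by (induction i) (simp_all add: mult)
  have mp: "multiplicity p (p ^ i * d) = i" if "d dvd m" for i d
  proof (rule multiplicity_eqI)
    have "\<not> p dvd d" using that p(2) dvd_trans by blast
    thus "\<not> p ^ Suc i dvd p ^ i * d"
      using p(1) by (simp add: mult.commute[of p] prime_gt_0_nat)
  qed auto
  have "inj_on (\<lambda>(i, d). p ^ i * d) ({..k} \<times> {d. d dvd m})"
  proof (intro inj_onI, clarify)
    fix i d j d' assume *: "d dvd m" "d' dvd m" "p ^ i * d = p ^ j * d'"
    have "i = j" using mp[OF *(1), of i] mp[OF *(2), of j] *(3) by simp
    thus "i = j \<and> d = d'" using * p(1) by (auto simp: prime_gt_0_nat)
  qed
  moreover have "(\<lambda>(i, d). p ^ i * d) ` ({..k} \<times> {d. d dvd m}) = {d. d dvd p ^ k * m}"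
  proof (intro equalityI subsetI)
    fix n assume "n \<in> {d. d dvd p ^ k * m}"
    then obtain a b where "n = a * b" "a dvd p ^ k" "b dvd m" using division_decomp by blast
    moreover then obtain i where "i \<le> k" "a = p ^ i" using p(1) divides_primepow_nat by blast
    ultimately show "n \<in> (\<lambda>(i, d). p ^ i * d) ` ({..k} \<times> {d. d dvd m})" by force
  qed (auto intro!: mult_dvd_mono le_imp_power_dvd)
  ultimately have "(\<Sum>d | d dvd p ^ k * m. e d) = (\<Sum>(i, d)\<in>{..k} \<times> {d. d dvd m}. e (p ^ i * d))"
    by (intro sum.reindex_cong[of "\<lambda>(i, d). p ^ i * d"]) auto
  also have "\<dots> = (\<Sum>i\<le>k. \<Sum>d | d dvd m. e p ^ i * e d)"
    by (simp add: sum.cartesian_product mult pow)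
  also have "\<dots> = (\<Sum>i\<le>k. e p ^ i) * (\<Sum>d | d dvd m. e d)"
    by (simp add: sum_product)
  finally show ?thesis .
qed

text \<open>The divisor sum is multiplicative, and each local factor is a sum of powers of -1, 0 or
  1, hence non-negative. The induction strips off one full prime power at a time.\<close>

lemma divisor_sum_nonneg:
  fixes e :: "nat \<Rightarrow> real"
  assumes mult: "\<And>m n. e (m * n) = e m * e n" and e1: "e 1 = 1" and vals: "\<And>n. e n \<in> {-1, 0, 1}"
  shows "n > 0 \<Longrightarrow> (\<Sum>d | d dvd n. e d) \<ge> 0"
proof (induction n rule: less_induct)
  case (less n)
  show ?case
  proof (cases "n = 1")
    case False
    then obtain p where p: "prime p" "p dvd n" using prime_factor_nat by blast
    define k where "k = multiplicity p n"
    obtain m where m: "n = p ^ k * m" "\<not> p dvd m"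
      using multiplicity_decompose'[of n p] less.prems p(1) unfolding k_def
      by (metis not_prime_unit less_not_refl)
    have "k > 0" using p less.prems by (simp add: k_def prime_multiplicity_gt_zero_iff)
    hence "p ^ k > 1" by (intro one_less_power prime_gt_1_nat p)
    moreover have "m > 0" using m less.prems by (cases "m = 0") auto
    ultimately have "1 * m < p ^ k * m" by (intro mult_strict_right_mono)
    hence "m < n" using m(1) by simp
    hence "(\<Sum>d | d dvd m. e d) \<ge> 0" using less.IH \<open>m > 0\<close> by blast
    moreover have "(\<Sum>i\<le>k. e p ^ i) \<ge> 0" using sum_sign_powers(1)[OF vals] .
    ultimately show ?thesis
      by (subst m(1), subst divisor_sum_prime_power_mult[OF mult e1 p(1) m(2)]) simp
  qed (simp add: e1[unfolded One_nat_def])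
qed

text \<open>At a square every local factor has an even top exponent and is at least 1. Powers of 4
  form an infinite supply of squares involving a single prime.\<close>

lemma divisor_sum_power_4:
  fixes e :: "nat \<Rightarrow> real"
  assumes mult: "\<And>m n. e (m * n) = e m * e n" and e1: "e 1 = 1" and vals: "\<And>n. e n \<in> {-1, 0, 1}"
  shows "(\<Sum>d | d dvd 4 ^ i. e d) \<ge> 1"
proof -
  have "(4::nat) ^ i = 2 ^ (2 * i) * 1" by (simp add: power_mult)
  hence "(\<Sum>d | d dvd 4 ^ i. e d) = (\<Sum>j\<le>2 * i. e 2 ^ j) * (\<Sum>d | d dvd (1::nat). e d)"
    using divisor_sum_prime_power_mult[OF mult e1, of 2 1 "2 * i"] by simp
  also have "(\<Sum>d | d dvd (1::nat). e d) = 1" using e1 by simp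
  finally show ?thesis using sum_sign_powers(2)[OF vals, of "2 * i" 2] by simp
qed

text \<open>Arithmetic-geometric mean, pairing \<open>j\<close> with \<open>n - 1 - j\<close>. The
  base is written as a square so that the geometric mean is an integral power of
  \<open>y\<close>.\<close>

lemma geometric_sum_ge:
  fixes y :: real
  assumes "0 \<le> y"
  shows "real n * y ^ (n - 1) \<le> (\<Sum>j<n. (y\<^sup>2) ^ j)"
proof -
  have "(\<Sum>j<n. (y\<^sup>2) ^ j) + (\<Sum>j<n. (y\<^sup>2) ^ j) = (\<Sum>j<n. (y\<^sup>2) ^ j) + (\<Sum>j<n. (y\<^sup>2) ^ (n - Suc j))"
    by (subst sum.nat_diff_reindex) simp
  also have "\<dots> = (\<Sum>j<n. (y\<^sup>2) ^ j + (y\<^sup>2) ^ (n - Suc j))" by (simp add: sum.distrib)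
  also have "\<dots> \<ge> (\<Sum>j<n. 2 * y ^ (n - 1))"
  proof (rule sum_mono)
    fix j assume "j \<in> {..<n}"
    hence "y ^ (n - 1) = y ^ j * y ^ (n - Suc j)" by (simp add: power_add[symmetric])
    thus "2 * y ^ (n - 1) \<le> (y\<^sup>2) ^ j + (y\<^sup>2) ^ (n - Suc j)"
      using sum_squares_bound[of "y ^ j" "y ^ (n - Suc j)"]
      by (simp add: power_mult[symmetric] mult_ac)
  qed
  finally show ?thesis by simp
qed

text \<open>Monsky's weights: subtracting \<open>1 / (n * (1 - x))\<close> turns the Lambert weights into a monotone sequence.\<close>
lemma lambert_weight:
  fixes y :: real
  assumes y: "0 < y" "y < 1"
  defines "b \<equiv> \<lambda>n::nat. 1 / (real n * (1 - y\<^sup>2)) - (y\<^sup>2) ^ n / (1 - (y\<^sup>2) ^ n)"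
  shows "n \<ge> 1 \<Longrightarrow> b n \<ge> 0" "n \<ge> 1 \<Longrightarrow> b (Suc n) \<le> b n" "b 1 = 1"
proof -
  define x where "x = y\<^sup>2"
  have x: "0 < x" "x < 1" using y by (auto simp: x_def abs_square_less_1)
  define G where "G = (\<lambda>n. \<Sum>j<n. x ^ j)"
  have xG: "1 - x ^ n = (1 - x) * G n" for n
    unfolding G_def by (rule one_diff_power_eq)
  have Gpos: "G n > 0" if "n \<ge> 1" for n
    unfolding G_def using that x by (intro sum_pos) (auto simp: lessThan_empty_iff)
  have b_eq: "b n = (1 / real n - x ^ n / G n) / (1 - x)" for n
    unfolding b_def x_def[symmetric] xG by (simp add: diff_divide_distrib mult.commute)
  show "b n \<ge> 0" if n: "n \<ge> 1"
  proof -
    have "(\<Sum>j<n. x ^ n) \<le> G n" unfolding G_def using x by (intro sum_mono power_decreasing) auto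
    hence "x ^ n / G n \<le> 1 / real n" using Gpos[OF n] n by (simp add: field_simps)
    thus ?thesis unfolding b_eq using x by simp
  qed
  show "b (Suc n) \<le> b n" if n: "n \<ge> 1"
  proof -
    have G_Suc: "G (Suc n) = 1 + x * G n"
      unfolding G_def by (subst sum.lessThan_Suc_shift) (simp add: sum_distrib_left)
    have G1: "real n * y ^ (n - 1) \<le> G n" and G2: "real (Suc n) * y ^ n \<le> G (Suc n)"
      using geometric_sum_ge[of y n] geometric_sum_ge[of y "Suc n"] y unfolding G_def x_def by auto
    \<comment> \<open>The lower bounds for \<open>G n\<close> and \<open>G (Suc n)\<close> carry the
      exponents \<open>n - 1\<close> and \<open>n\<close> of \<open>y\<close>, one less in total
      than \<open>x ^ n = y ^ (2 * n)\<close>, and \<open>y < 1\<close>.\<close>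
    have "real n * real (Suc n) * x ^ n \<le> (real n * y ^ (n - 1)) * (real (Suc n) * y ^ n)"
    proof -
      have "x ^ n = y ^ n * y ^ n" by (simp add: x_def power2_eq_square power_mult_distrib)
      also have "\<dots> \<le> y ^ (n - 1) * y ^ n" using y by (intro mult_right_mono power_decreasing) auto
      finally have "real n * real (Suc n) * x ^ n \<le> real n * real (Suc n) * (y ^ (n - 1) * y ^ n)"
        by (intro mult_left_mono) auto
      thus ?thesis by (simp only: mult_ac)
    qed
    also have "\<dots> \<le> G n * G (Suc n)" using G1 G2 y by (intro mult_mono) (auto intro: order_trans[rotated])
    finally have key: "real n * real (Suc n) * x ^ n \<le> G n * G (Suc n)" .
    have p: "G n > 0" "G (Suc n) > 0" using Gpos n by auto
    \<comment> \<open>Since \<open>G (Suc n) - x * G n = 1\<close>, the Lambert part decreases by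
      exactly \<open>x ^ n / (G n * G (Suc n))\<close>, to be compared with the decrease
      \<open>1 / (n * Suc n)\<close> of the subtracted part.\<close>
    have "x ^ n / G n - x ^ Suc n / G (Suc n) = x ^ n * (G (Suc n) - x * G n) / (G n * G (Suc n))"
      using p by (simp add: field_simps)
    also have "\<dots> = x ^ n / (G n * G (Suc n))" unfolding G_Suc by simp
    also have "\<dots> \<le> 1 / (real n * real (Suc n))"
      using key p n by (simp add: field_simps del: of_nat_Suc)
    also have "\<dots> = 1 / real n - 1 / real (Suc n)" using n by (simp add: field_simps)
    finally have "1 / real (Suc n) - x ^ Suc n / G (Suc n) \<le> 1 / real n - x ^ n / G n" by simp
    thus ?thesis unfolding b_eq using x by (intro divide_right_mono) auto
  qed
  show "b 1 = 1" unfolding b_def using x by (simp add: x_def[symmetric] diff_divide_distrib[symmetric])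
qed

lemma abel_monotone_bound:
  fixes e b :: "nat \<Rightarrow> real"
  assumes S: "\<And>n. \<bar>\<Sum>d=1..n. e d\<bar> \<le> C"
    and b0: "\<And>n. n \<ge> 1 \<Longrightarrow> b n \<ge> 0" and dec: "\<And>n. n \<ge> 1 \<Longrightarrow> b (Suc n) \<le> b n" and K: "K \<ge> 1"
  shows "\<bar>\<Sum>d=1..K. e d * b d\<bar> \<le> C * b 1"
proof -
  define T where "T = (\<lambda>n. \<Sum>d=1..n. e d)"
  have "\<bar>(\<Sum>d=1..K. e d * b d) - T K * b K\<bar> \<le> C * (b 1 - b K)"
    using K
  proof (induction K rule: dec_induct)
    case (step n)
    have "(\<Sum>d=1..Suc n. e d * b d) - T (Suc n) * b (Suc n) = ((\<Sum>d=1..n. e d * b d) - T n * b n) + T n * (b n - b (Suc n))"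
      by (simp add: T_def algebra_simps)
    also have "\<bar>\<dots>\<bar> \<le> \<bar>(\<Sum>d=1..n. e d * b d) - T n * b n\<bar> + \<bar>T n * (b n - b (Suc n))\<bar>" by (rule abs_triangle_ineq)
    also have "\<bar>T n * (b n - b (Suc n))\<bar> \<le> C * (b n - b (Suc n))"
      using S[of n] dec[of n] step.hyps by (simp add: abs_mult T_def mult_right_mono)
    finally show ?case using step.IH by (simp add: algebra_simps)
  qed (simp add: T_def)
  moreover have "\<bar>T K * b K\<bar> \<le> C * b K"
    using S[of K] b0[OF K] by (simp add: abs_mult T_def mult_right_mono)
  ultimately show ?thesis by (simp add: algebra_simps)
qed

lemma sum_divisor_swap:
  fixes e :: "nat \<Rightarrow> real"
  shows "(\<Sum>n=1..K. (\<Sum>d | d dvd n. e d) * x ^ n) = (\<Sum>d=1..K. e d * (\<Sum>k=1..K div d. (x ^ d) ^ k))"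
proof -
  have "(\<Sum>n=1..K. (\<Sum>d | d dvd n. e d) * x ^ n) = (\<Sum>n=1..K. \<Sum>d | d \<in> {1..K} \<and> d dvd n. e d * x ^ n)"
  proof (rule sum.cong[OF refl])
    fix n assume n: "n \<in> {1..K}"
    hence "{d. d dvd n} = {d \<in> {1..K}. d dvd n}"
      by (auto dest: dvd_imp_le intro: Suc_leI gr0I)
    thus "(\<Sum>d | d dvd n. e d) * x ^ n = (\<Sum>d | d \<in> {1..K} \<and> d dvd n. e d * x ^ n)"
      by (simp add: sum_distrib_right)
  qed
  also have "\<dots> = (\<Sum>d=1..K. \<Sum>n | n \<in> {1..K} \<and> d dvd n. e d * x ^ n)"
    by (rule sum.swap_restrict) auto
  also have "\<dots> = (\<Sum>d=1..K. e d * (\<Sum>k=1..K div d. (x ^ d) ^ k))"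
  proof (rule sum.cong[OF refl])
    fix d assume d: "d \<in> {1..K}"
    have "{n \<in> {1..K}. d dvd n} = (\<lambda>k. d * k) ` {1..K div d}"
    proof (intro equalityI subsetI)
      fix n assume "n \<in> {n \<in> {1..K}. d dvd n}"
      then obtain k where "n = d * k" "1 \<le> d * k" "d * k \<le> K" by auto
      moreover from this have "k \<le> K div d" using d by (simp add: less_eq_div_iff_mult_less_eq mult.commute)
      ultimately show "n \<in> (\<lambda>k. d * k) ` {1..K div d}" by (auto simp: Suc_le_eq)
    qed (use d in \<open>auto simp: less_eq_div_iff_mult_less_eq mult.commute\<close>)
    hence "(\<Sum>n | n \<in> {1..K} \<and> d dvd n. e d * x ^ n) = (\<Sum>k\<in>{1..K div d}. e d * x ^ (d * k))"
      using d by (intro sum.reindex_cong[of "\<lambda>k. d * k"]) (auto simp: inj_on_def)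
    thus "(\<Sum>n | n \<in> {1..K} \<and> d dvd n. e d * x ^ n) = e d * (\<Sum>k=1..K div d. (x ^ d) ^ k)"
      by (simp add: sum_distrib_left power_mult)
  qed
  finally show ?thesis .
qed

text \<open>The Lambert series of \<open>e\<close> is the power series of its divisor sums, which
  are non-negative everywhere and at least 1 at powers of 4; it is therefore unbounded as
  \<open>x\<close> tends to 1 from below. If the sum of \<open>e d / d\<close> were 0, replacing the
  Lambert weights by Monsky's monotone weights would only change the sign, and Abel summation would
  bound the series by \<open>C\<close> uniformly in \<open>x\<close>.\<close>

lemma real_character_sum_nonzero:
  fixes e :: "nat \<Rightarrow> real"
  assumes mult: "\<And>m n. e (m * n) = e m * e n" and e1: "e 1 = 1" and vals: "\<And>n. e n \<in> {-1, 0, 1}"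
    and C: "\<And>n. \<bar>\<Sum>d=1..n. e d\<bar> \<le> C"
  shows "\<not> (\<lambda>K. \<Sum>d=1..K. e d / real d) \<longlonglongrightarrow> 0"
proof
  assume lim0: "(\<lambda>K. \<Sum>d=1..K. e d / real d) \<longlonglongrightarrow> 0"
  define r where "r = (\<lambda>n::nat. \<Sum>d | d dvd n. e d)"
  have ae: "\<bar>e n\<bar> \<le> 1" for n using vals[of n] by auto
  have main: "(\<Sum>i<M. (y\<^sup>2) ^ (4 ^ i)) \<le> C" if y: "0 < y" "y < 1" for y :: real and M
  proof -
    define x where "x = y\<^sup>2"
    have x: "0 < x" "x < 1" using y by (auto simp: x_def abs_square_less_1)
    define b where "b = (\<lambda>n::nat. 1 / (real n * (1 - x)) - x ^ n / (1 - x ^ n))"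
    have b: "\<And>n. n \<ge> 1 \<Longrightarrow> b n \<ge> 0" "\<And>n. n \<ge> 1 \<Longrightarrow> b (Suc n) \<le> b n" "b 1 = 1"
      unfolding b_def x_def by (rule lambert_weight[OF y]; assumption)+
    \<comment> \<open>Everything is truncated at \<open>K\<close>. The last summand pays for cutting
      the inner geometric sums and disappears as \<open>K\<close> tends to infinity with
      \<open>x\<close> fixed.\<close>
    have up: "(\<Sum>i<M. x ^ (4 ^ i)) \<le> (\<Sum>d=1..K. e d / real d) / (1 - x) + C + real K * x ^ K / (1 - x)"
      if K: "K \<ge> 4 ^ M" for K
    proof -
      have K1: "K \<ge> 1" using K by (metis le_trans one_le_numeral one_le_power)
      have "(\<Sum>i<M. x ^ (4 ^ i)) = (\<Sum>n\<in>(\<lambda>i. 4 ^ i) ` {..<M}. x ^ n)"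
        by (subst sum.reindex) (auto simp: inj_on_def)
      also have "\<dots> \<le> (\<Sum>n\<in>(\<lambda>i. 4 ^ i) ` {..<M}. r n * x ^ n)"
        using divisor_sum_power_4[OF mult e1 vals] x by (intro sum_mono) (auto simp: r_def)
      also have "\<dots> \<le> (\<Sum>n=1..K. r n * x ^ n)"
      proof (rule sum_mono2)
        show "(\<lambda>i. 4 ^ i) ` {..<M} \<subseteq> {1..K}"
        proof (intro subsetI, elim imageE)
          fix n i :: nat assume "n = 4 ^ i" "i \<in> {..<M}"
          have "(4::nat) ^ i \<le> 4 ^ M" using \<open>i \<in> {..<M}\<close> by (intro power_increasing) auto
          hence "4 ^ i \<le> K" using K by (rule order_trans)
          thus "n \<in> {1..K}" using \<open>n = 4 ^ i\<close> by simp
        qed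
        show "\<And>n. n \<in> {1..K} - (\<lambda>i. 4 ^ i) ` {..<M} \<Longrightarrow> 0 \<le> r n * x ^ n"
          using divisor_sum_nonneg[OF mult e1 vals] x by (auto simp: r_def)
      qed auto
      also have "\<dots> = (\<Sum>d=1..K. e d * (\<Sum>k=1..K div d. (x ^ d) ^ k))"
        unfolding r_def by (rule sum_divisor_swap)
      also have "\<dots> \<le> (\<Sum>d=1..K. e d * (x ^ d / (1 - x ^ d)) + x ^ K / (1 - x))"
      proof (rule sum_mono)
        fix d assume d: "d \<in> {1..K}"
        have xd: "0 < x ^ d" "x ^ d \<le> x" "x ^ d < 1"
          using d x power_decreasing[of 1 d x] by (auto intro: le_less_trans)
        have "(\<Sum>k=1..n. (x ^ d) ^ k) = x ^ d / (1 - x ^ d) - (x ^ d) ^ Suc n / (1 - x ^ d)" for n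
        proof -
          have "(1 - x ^ d) * (\<Sum>k=1..n. (x ^ d) ^ k) = x ^ d - (x ^ d) ^ Suc n"
          proof (induction n)
            case (Suc n)
            have "(1 - x ^ d) * (\<Sum>k=1..Suc n. (x ^ d) ^ k)
                = (1 - x ^ d) * (\<Sum>k=1..n. (x ^ d) ^ k) + (1 - x ^ d) * (x ^ d) ^ Suc n"
              by (simp add: distrib_left)
            thus ?case unfolding Suc by (simp add: left_diff_distrib)
          qed simp
          hence "(\<Sum>k=1..n. (x ^ d) ^ k) = (x ^ d - (x ^ d) ^ Suc n) / (1 - x ^ d)"
            using xd(3) by (simp add: eq_divide_eq mult.commute)
          thus ?thesis by (simp only: diff_divide_distrib)
        qed
        moreover have "(x ^ d) ^ Suc (K div d) / (1 - x ^ d) \<le> x ^ K / (1 - x)"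
        proof (rule frac_le)
          have "K \<le> d * Suc (K div d)" using d by (metis atLeastAtMost_iff dividend_less_times_div less_imp_le less_le_trans zero_less_one mult_Suc_right add.commute)
          thus "(x ^ d) ^ Suc (K div d) \<le> x ^ K"
            unfolding power_mult[symmetric] using x by (intro power_decreasing) auto
        qed (use x xd in auto)
        moreover have "0 \<le> (x ^ d) ^ Suc (K div d) / (1 - x ^ d)" using x xd by (intro divide_nonneg_pos) auto
        moreover have "- e d * u \<le> u" if "u \<ge> 0" for u using ae[of d] that by (simp add: mult_right_mono abs_le_iff) (metis abs_le_D2 mult_right_mono mult_1 mult_minus_left ae)
        ultimately show "e d * (\<Sum>k=1..K div d. (x ^ d) ^ k) \<le> e d * (x ^ d / (1 - x ^ d)) + x ^ K / (1 - x)"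
          by (smt (verit) mult_minus_left right_diff_distrib)
      qed
      also have "\<dots> = (\<Sum>d=1..K. e d * (x ^ d / (1 - x ^ d))) + real K * x ^ K / (1 - x)"
        by (simp add: sum.distrib)
      also have "(\<Sum>d=1..K. e d * (x ^ d / (1 - x ^ d))) = (\<Sum>d=1..K. e d / real d) / (1 - x) - (\<Sum>d=1..K. e d * b d)"
        unfolding sum_divide_distrib sum_subtractf[symmetric]
        by (intro sum.cong) (auto simp: b_def right_diff_distrib)
      finally have "(\<Sum>i<M. x ^ (4 ^ i)) \<le> (\<Sum>d=1..K. e d / real d) / (1 - x) - (\<Sum>d=1..K. e d * b d)
         + real K * x ^ K / (1 - x)" .
      moreover have "\<bar>\<Sum>d=1..K. e d * b d\<bar> \<le> C"
        using abel_monotone_bound[where e = e and b = b, OF C b(1,2) K1] b(3) by simp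
      ultimately show ?thesis by linarith
    qed
    have "(\<lambda>K. real K * x ^ K) \<longlonglongrightarrow> 0"
      using x by (intro powser_times_n_limit_0) auto
    hence "(\<lambda>K. (\<Sum>d=1..K. e d / real d) / (1 - x) + C + real K * x ^ K / (1 - x)) \<longlonglongrightarrow> 0 / (1 - x) + C + 0 / (1 - x)"
      using x by (intro tendsto_intros lim0) auto
    hence "(\<Sum>i<M. x ^ (4 ^ i)) \<le> 0 / (1 - x) + C + 0 / (1 - x)"
      by (rule tendsto_lowerbound) (use up in \<open>auto intro!: eventually_sequentiallyI[of "4 ^ M"]\<close>)
    thus ?thesis by (simp add: x_def)
  qed
  \<comment> \<open>Since \<open>C\<close> is independent of \<open>y\<close>, letting
    \<open>y\<close> tend to 1 turns the \<open>M\<close> terms on the left into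
    \<open>M\<close>.\<close>
  have "real M \<le> C" for M
  proof -
    have "((\<lambda>y::real. \<Sum>i<M. (y\<^sup>2) ^ (4 ^ i)) \<longlongrightarrow> (\<Sum>i<M. (1\<^sup>2) ^ (4 ^ i))) (at_left 1)"
      by (intro tendsto_intros)
    moreover have "eventually (\<lambda>y::real. y \<in> {0<..<1}) (at_left 1)"
      by (rule eventually_at_left_real) auto
    hence "eventually (\<lambda>y::real. (\<Sum>i<M. (y\<^sup>2) ^ (4 ^ i)) \<le> C) (at_left 1)"
      by eventually_elim (use main in auto)
    ultimately have "(\<Sum>i<M. (1\<^sup>2) ^ (4 ^ i)) \<le> C"
      by (rule tendsto_upperbound) auto
    thus ?thesis by simp
  qed
  thus False using reals_Archimedean2[of C] by (meson not_le)
qed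

section \<open>The Moebius function against characters and periodic functions\<close>

text \<open>Multiplication by \<open>b\<close> permutes the residues. It follows that a character of
  non-zero mean is 1 at every argument coprime to \<open>q\<close>, that is, principal.\<close>

lemma period_mean_shift:
  assumes \<psi>: "dirichlet_char q \<psi>" and b: "coprime b q"
  shows "\<psi> b * period_mean q \<psi> = period_mean q \<psi>"
proof -
  note P = dchar_props[OF \<psi>]
  have q: "q > 0" by (rule P)
  have sum_eq: "(\<Sum>m=1..q. \<psi> m) = (\<Sum>m<q. \<psi> m)"
  proof -
    have "{1..q} = insert q {1..<q}" "{..<q} = insert 0 {1..<q}" using q by auto
    moreover have "\<psi> q = \<psi> 0" using P(4)[of 0] by simp
    ultimately show ?thesis by simp
  qed
  have inj: "inj_on (\<lambda>m. b * m mod q) {..<q}"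
  proof (rule inj_onI)
    fix m n assume "m \<in> {..<q}" "n \<in> {..<q}" "b * m mod q = b * n mod q"
    hence "[b * m = b * n] (mod q)" by (simp add: cong_def)
    hence "[m = n] (mod q)" using b by (simp add: cong_mult_lcancel_nat)
    thus "m = n" using \<open>m \<in> {..<q}\<close> \<open>n \<in> {..<q}\<close> by (simp add: cong_def)
  qed
  have "(\<lambda>m. b * m mod q) ` {..<q} = {..<q}"
    using q by (intro card_subset_eq) (auto simp: card_image[OF inj])
  hence "(\<Sum>m<q. \<psi> m) = (\<Sum>m<q. \<psi> (b * m mod q))"
    using inj by (metis (no_types, lifting) sum.reindex_cong)
  also have "\<dots> = (\<Sum>m<q. \<psi> b * \<psi> m)"
    using periodic_mod[of \<psi> q] P by simp
  finally have "\<psi> b * (\<Sum>m<q. \<psi> m) = (\<Sum>m<q. \<psi> m)"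
    unfolding sum_distrib_left by (rule sym)
  thus ?thesis by (simp add: period_mean_def sum_eq[unfolded One_nat_def])
qed

text \<open>If the squared character has mean 0, the 3-4-1 inequality works at \<open>t = 0\<close>.
  Otherwise the square is principal, so the character takes only the values -1, 0, 1, and Monsky's
  argument applies to its real part.\<close>

lemma L_fun_1_nonzero:
  assumes \<psi>: "dirichlet_char q \<psi>" and mean: "period_mean q \<psi> = 0"
  shows "L_fun q \<psi> 1 \<noteq> 0"
proof (cases "period_mean q (\<lambda>n. (\<psi> n)\<^sup>2) = 0")
  case True
  thus ?thesis using L_fun_nonzero_341[OF \<psi>, of 0] mean by simp
next
  case False
  note P = dchar_props[OF \<psi>]
  have sq: "(\<psi> n)\<^sup>2 = 1" if "coprime n q" for n
    using period_mean_shift[OF dchar_square[OF \<psi>] that] False by simp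
  define e where "e = (\<lambda>n. Re (\<psi> n))"
  have vals': "\<psi> n = -1 \<or> \<psi> n = 0 \<or> \<psi> n = 1" for n
    using sq[of n] P(5)[of n] by (auto simp: power2_eq_1_iff)
  have vals: "e n \<in> {-1, 0, 1}" for n using vals'[of n] by (auto simp: e_def)
  have \<psi>_eq: "\<psi> n = of_real (e n)" for n using vals'[of n] by (auto simp: e_def)
  have mult: "e (m * n) = e m * e n" for m n
    using vals'[of m] vals'[of n] by (auto simp: e_def P(3))
  have e1: "e 1 = 1" using P(2) by (simp add: e_def)
  obtain C where "C \<ge> 0" and C: "\<And>n. norm (mean_error q \<psi> n) \<le> C"
    using mean_error_bounded[of q \<psi>] P by metis
  have "\<bar>\<Sum>d=1..n. e d\<bar> \<le> C" for n
  proof -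
    have "mean_error q \<psi> n = of_real (\<Sum>d=1..n. e d)"
      by (simp add: mean_error_def mean \<psi>_eq)
    thus ?thesis using C[of n] by (simp only: norm_of_real)
  qed
  from real_character_sum_nonzero[OF mult e1 vals this]
  have no: "\<not> (\<lambda>K. \<Sum>d=1..K. e d / real d) \<longlonglongrightarrow> 0" .
  show ?thesis
  proof
    assume "L_fun q \<psi> 1 = 0"
    hence "(\<lambda>n. \<psi> n * of_nat n powr -1) sums 0"
      using L_sums[of q \<psi> 1] P mean by (simp add: L_fun_def)
    hence "(\<lambda>K. \<Sum>n\<le>K. \<psi> n * of_nat n powr -1) \<longlonglongrightarrow> 0" by (simp add: sums_def_le)
    moreover have "(\<Sum>n\<le>K. \<psi> n * of_nat n powr -1) = of_real (\<Sum>d=1..K. e d / real d)" for K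
    proof -
      have "(\<Sum>n\<le>K. \<psi> n * of_nat n powr -1) = (\<Sum>n\<in>{1..K}. \<psi> n * of_nat n powr -1)"
        by (rule sum.mono_neutral_right) (auto simp: not_less_eq_eq)
      also have "\<dots> = of_real (\<Sum>d=1..K. e d / real d)"
        unfolding of_real_sum by (intro sum.cong) (auto simp: \<psi>_eq powr_minus_divide)
      finally show ?thesis .
    qed
    ultimately have "(\<lambda>K. complex_of_real (\<Sum>d=1..K. e d / real d)) \<longlonglongrightarrow> of_real 0" by simp
    hence "(\<lambda>K. \<Sum>d=1..K. e d / real d) \<longlonglongrightarrow> 0" by (simp only: tendsto_of_real_iff)
    with no show False by blast
  qed
qed

lemma L_fun_nonzero:
  assumes \<psi>: "dirichlet_char q \<psi>" and z: "Re z \<ge> 0" "z \<noteq> 0 \<or> period_mean q \<psi> = 0"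
  shows "L_fun q \<psi> (1 + z) \<noteq> 0"
proof (cases "Re z = 0")
  case True
  define t where "t = Im z"
  have zt: "z = \<i> * of_real t" using True by (simp add: complex_eq_iff t_def)
  show ?thesis
  proof (cases "t = 0")
    case True
    thus ?thesis using L_fun_1_nonzero[OF \<psi>] z by (simp add: zt)
  next
    case False
    thus ?thesis unfolding zt by (intro L_fun_nonzero_341[OF \<psi>]) simp
  qed
next
  case False
  note P = dchar_props[OF \<psi>]
  have "Re (1 + z) > 1" using False z by simp
  thus ?thesis
    using dirichlet_sum_moebius_inverse[of \<psi> "1 + z"] norm_dchar_le[OF \<psi>] P
      dirichlet_sum_eq_L_fun[of q \<psi> "1 + z"] by auto
qed

lemma moebius_dchar_sums:
  assumes \<psi>: "dirichlet_char q \<psi>" and z: "Re z > 0"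
  shows "(\<lambda>n. (of_int (moebius_mu n) * \<psi> n) * of_nat n powr (-1 - z)) sums (1 / L_fun q \<psi> (1 + z))"
proof -
  note P = dchar_props[OF \<psi>]
  let ?g = "\<lambda>n. of_int (moebius_mu n) * \<psi> n"
  have re: "Re (1 + z) > 1" using z by simp
  have "norm (?g n) \<le> 1" for n
    using norm_dchar_le[OF \<psi>, of n] norm_moebius_mu_le[of n] by (simp add: norm_mult mult_le_one)
  from dirichlet_sum_sums[of ?g, OF this re]
  have "(\<lambda>n. ?g n * of_nat n powr (-1 - z)) sums dirichlet_sum ?g (1 + z) (rough 0)" by simp
  also have "dirichlet_sum ?g (1 + z) (rough 0) = 1 / L_fun q \<psi> (1 + z)"
  proof -
    have "dirichlet_sum ?g (1 + z) (rough 0) * L_fun q \<psi> (1 + z) = 1"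
      using dirichlet_sum_moebius_inverse[of \<psi> "1 + z"] norm_dchar_le[OF \<psi>] P re
        dirichlet_sum_eq_L_fun[of q \<psi> "1 + z"] by simp
    thus ?thesis by (metis nonzero_eq_divide_eq mult_zero_right zero_neq_one)
  qed
  finally show ?thesis .
qed

definition moebius_null :: "(nat \<Rightarrow> complex) \<Rightarrow> bool" where
  "moebius_null f \<longleftrightarrow> (\<lambda>N. (\<Sum>n=1..N. of_int (moebius_mu n) * f n) / of_nat N) \<longlonglongrightarrow> 0"

text \<open>Supplies the open set \<open>U\<close> of the Tauberian theorem. Continuity extends
  non-vanishing on the closed half plane to a neighbourhood of it, whose width need not be
  known.\<close>

lemma open_nonzero_shift:
  assumes "h holomorphic_on {s. Re s > 0}"
  shows "open {z. Re z > -1 \<and> h (1 + z) \<noteq> 0}"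
    and "(\<lambda>z. h (1 + z)) holomorphic_on {z. Re z > -1 \<and> h (1 + z) \<noteq> 0}"
proof -
  have *: "(\<lambda>z. h (1 + z)) holomorphic_on {z. Re z > -1}"
  proof -
    have "h \<circ> (\<lambda>z. 1 + z) holomorphic_on {z. Re z > -1}"
      by (rule holomorphic_on_compose_gen[OF _ assms]) (auto intro!: holomorphic_intros)
    thus ?thesis by (simp add: o_def)
  qed
  have "open ({z. Re z > -1} \<inter> (\<lambda>z. h (1 + z)) -` (-{0}))"
    by (rule continuous_open_preimage[OF holomorphic_on_imp_continuous_on[OF *]])
       (auto simp: open_halfspace_Re_gt)
  thus "open {z. Re z > -1 \<and> h (1 + z) \<noteq> 0}" by (simp add: Collect_conj_eq vimage_def Compl_eq)
  show "(\<lambda>z. h (1 + z)) holomorphic_on {z. Re z > -1 \<and> h (1 + z) \<noteq> 0}"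
    by (rule holomorphic_on_subset[OF *]) auto
qed

text \<open>The pole helps here: \<open>1 / L\<close> at \<open>1 + z\<close> equals
  \<open>z / \<Lambda> (1 + z)\<close>, so the factor \<open>z\<close> demanded by Newman's theorem
  is already present.\<close>

lemma moebius_null_dchar_principal:
  assumes \<psi>: "dirichlet_char q \<psi>" and mean: "period_mean q \<psi> \<noteq> 0"
  shows "moebius_null \<psi>"
proof -
  note P = dchar_props[OF \<psi>]
  define \<Lambda> where "\<Lambda> = (\<lambda>s. period_mean q \<psi> * zeta_reg s + (s - 1) * L_reg q \<psi> s)"
  have hol: "\<Lambda> holomorphic_on {s. Re s > 0}"
    unfolding \<Lambda>_def using L_reg_holomorphic[of q \<psi>] P by (auto intro!: holomorphic_intros zeta_reg_holomorphic)
  have eq: "\<Lambda> (1 + z) = z * L_fun q \<psi> (1 + z)" if "z \<noteq> 0" for z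
    using that by (simp add: \<Lambda>_def L_fun_def algebra_simps)
  let ?U = "{z. Re z > -1 \<and> \<Lambda> (1 + z) \<noteq> 0}"
  have "\<Lambda> (1 + z) \<noteq> 0" if "Re z \<ge> 0" for z
  proof (cases "z = 0")
    case True
    thus ?thesis using mean by (simp add: \<Lambda>_def zeta_reg_1)
  next
    case False
    thus ?thesis using eq[OF False] L_fun_nonzero[OF \<psi> that] by simp
  qed
  hence sub: "{z. Re z \<ge> 0} \<subseteq> ?U" by auto
  have g: "(\<lambda>z. 1 / \<Lambda> (1 + z)) holomorphic_on ?U"
    using open_nonzero_shift(2)[OF hol] by (intro holomorphic_intros) auto
  have "(\<lambda>N. \<Sum>n\<le>N. (of_int (moebius_mu n) * \<psi> n) / of_nat n) \<longlonglongrightarrow> 0"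
  proof (rule newman_tauberian[OF _ open_nonzero_shift(1)[OF hol] sub g])
    fix z :: complex assume z: "Re z > 0"
    hence "z \<noteq> 0" by auto
    hence "z * (1 / \<Lambda> (1 + z)) = 1 / L_fun q \<psi> (1 + z)" by (simp add: eq)
    thus "(\<lambda>n. of_int (moebius_mu n) * \<psi> n * of_nat n powr (-1 - z)) sums (z * (1 / \<Lambda> (1 + z)))"
      using moebius_dchar_sums[OF \<psi> z] by simp
  next
    show "norm (of_int (moebius_mu n) * \<psi> n) \<le> 1" for n
      using norm_dchar_le[OF \<psi>, of n] norm_moebius_mu_le[of n] by (simp add: norm_mult mult_le_one)
  qed
  thus ?thesis unfolding moebius_null_def by (rule cesaro_mean_of_weighted_sums)
qed

text \<open>Now \<open>1 / L\<close> does not vanish at 1. Subtracting its value \<open>c\<close>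
  from the first coefficient makes the limit function divisible by \<open>z\<close>, and changes the
  mean value only by \<open>c / N\<close>.\<close>

lemma moebius_null_dchar_nonprincipal:
  assumes \<psi>: "dirichlet_char q \<psi>" and mean: "period_mean q \<psi> = 0"
  shows "moebius_null \<psi>"
proof -
  note P = dchar_props[OF \<psi>]
  define c where "c = 1 / L_fun q \<psi> 1"
  have hol: "L_fun q \<psi> holomorphic_on {s. Re s > 0}"
    using L_fun_holomorphic(2)[of q \<psi>] P mean by blast
  let ?U = "{z. Re z > -1 \<and> L_fun q \<psi> (1 + z) \<noteq> 0}"
  have sub: "{z. Re z \<ge> 0} \<subseteq> ?U" using L_fun_nonzero[OF \<psi>] mean by auto
  define F where "F = (\<lambda>z. 1 / L_fun q \<psi> (1 + z) - c)"
  have F: "F holomorphic_on ?U"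
    unfolding F_def using open_nonzero_shift(2)[OF hol] by (intro holomorphic_intros) auto
  define g where "g = (\<lambda>z. if z = 0 then deriv F 0 else F z / z)"
  have F0: "F 0 = 0" by (simp add: F_def c_def)
  have g: "g holomorphic_on ?U"
    by (rule pole_theorem_open_0[OF F open_nonzero_shift(1)[OF hol], of 0]) (auto simp: g_def F0)
  define a where "a = (\<lambda>n. of_int (moebius_mu n) * \<psi> n - (if n = 1 then c else 0))"
  have "(\<lambda>N. \<Sum>n\<le>N. a n / of_nat n) \<longlonglongrightarrow> 0"
  proof (rule newman_tauberian[OF _ open_nonzero_shift(1)[OF hol] sub g])
    fix z :: complex assume z: "Re z > 0"
    hence "z \<noteq> 0" by auto
    hence "z * g z = 1 / L_fun q \<psi> (1 + z) - c" by (simp add: g_def F_def)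
    moreover have "(\<lambda>n. (if n = 1 then c else 0) * of_nat n powr (-1 - z)) sums c"
      using sums_single[of 1 "\<lambda>n. c * of_nat n powr (-1 - z)"] by (simp add: if_distrib if_distribR cong: if_cong)
    ultimately show "(\<lambda>n. a n * of_nat n powr (-1 - z)) sums (z * g z)"
      unfolding a_def left_diff_distrib using sums_diff[OF moebius_dchar_sums[OF \<psi> z]] by simp
  next
    show "norm (a n) \<le> 1 + norm c" for n
    proof -
      have "norm (of_int (moebius_mu n) * \<psi> n) \<le> 1"
        using norm_dchar_le[OF \<psi>, of n] norm_moebius_mu_le[of n] by (simp add: norm_mult mult_le_one)
      moreover have "norm (if n = 1 then c else 0) \<le> norm c" by simp
      ultimately show ?thesis unfolding a_def by (meson add_mono norm_triangle_ineq4 order_trans)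
    qed
  qed
  hence "(\<lambda>N. (\<Sum>n=1..N. a n) / of_nat N) \<longlonglongrightarrow> 0" by (rule cesaro_mean_of_weighted_sums)
  moreover have "(\<lambda>N. c / of_nat N) \<longlonglongrightarrow> 0" by (rule lim_const_over_n)
  ultimately have "(\<lambda>N. (\<Sum>n=1..N. a n) / of_nat N + c / of_nat N) \<longlonglongrightarrow> 0 + 0"
    by (rule tendsto_add)
  moreover have "eventually (\<lambda>N. (\<Sum>n=1..N. a n) / of_nat N + c / of_nat N =
     (\<Sum>n=1..N. of_int (moebius_mu n) * \<psi> n) / of_nat N) sequentially"
    using eventually_ge_at_top[of 1]
  proof eventually_elim
    case (elim N)
    hence "(\<Sum>n=1..N. a n) = (\<Sum>n=1..N. of_int (moebius_mu n) * \<psi> n) - c"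
      by (simp add: a_def sum_subtractf)
    thus ?case by (simp add: diff_divide_distrib)
  qed
  ultimately show ?thesis unfolding moebius_null_def by (simp add: filterlim_cong)
qed

lemma moebius_null_dchar: "dirichlet_char q \<psi> \<Longrightarrow> moebius_null \<psi>"
  using moebius_null_dchar_principal moebius_null_dchar_nonprincipal by blast

section \<open>From Dirichlet characters to periodic functions\<close>

lemma moebius_null_sum:
  assumes "finite I" "\<And>i. i \<in> I \<Longrightarrow> moebius_null (f i)"
  shows "moebius_null (\<lambda>n. \<Sum>i\<in>I. f i n)"
proof -
  have "(\<lambda>N. \<Sum>i\<in>I. (\<Sum>n=1..N. of_int (moebius_mu n) * f i n) / of_nat N) \<longlonglongrightarrow> (\<Sum>i\<in>I. 0)"
    using assms(2) unfolding moebius_null_def by (intro tendsto_sum)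
  moreover have "(\<Sum>i\<in>I. (\<Sum>n=1..N. of_int (moebius_mu n) * f i n) / of_nat N) =
     (\<Sum>n=1..N. of_int (moebius_mu n) * (\<Sum>i\<in>I. f i n)) / of_nat N" for N
    unfolding sum_divide_distrib[symmetric] sum_distrib_left by (subst sum.swap) simp
  ultimately show ?thesis unfolding moebius_null_def by simp
qed

lemma moebius_null_scale:
  assumes "moebius_null f"
  shows "moebius_null (\<lambda>n. c * f n)"
proof -
  have "(\<lambda>N. (\<Sum>n=1..N. of_int (moebius_mu n) * (c * f n)) / of_nat N)
      = (\<lambda>N. c * ((\<Sum>n=1..N. of_int (moebius_mu n) * f n) / of_nat N))"
    by (simp add: sum_distrib_left mult_ac)
  thus ?thesis
    using assms unfolding moebius_null_def by (simp only: tendsto_mult_right_zero)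
qed

lemma sum_powers_root_of_unity:
  assumes "0 < k" "k < m"
  shows "(\<Sum>j<m. (cis (2 * pi / real m) ^ j) ^ k) = 0"
proof -
  define w where "w = cis (2 * pi * real k / real m)"
  have bij: "bij_betw (\<lambda>k. cis (2 * pi * real k / real m)) {..<m} {z. z ^ m = 1}"
    by (rule Complex.bij_betw_roots_unity) (use assms in auto)
  have "w \<noteq> 1"
    using inj_onD[OF bij_betw_imp_inj_on[OF bij], of k 0] assms by (auto simp: w_def)
  moreover have "w ^ m = 1"
    using bij_betwE[OF bij] assms by (auto simp: w_def)
  moreover have "(cis (2 * pi / real m) ^ j) ^ k = w ^ j" for j
  proof -
    have "real k * (real j * (2 * pi / real m)) = real j * (2 * pi * real k / real m)" by simp
    thus ?thesis by (simp only: w_def Complex.DeMoivre)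
  qed
  ultimately show ?thesis by (simp add: geometric_sum)
qed

text \<open>Simultaneous diagonalisation of the commuting operators \<open>f \<mapsto> f \<circ> (*) b\<close>, one \<open>b\<close> at a time:
  a function that is an eigenvector for all \<open>b\<close> outside \<open>A\<close> is split by the Fourier projections of
  \<open>b \<in> A\<close>. For \<open>A = {}\<close> only multiples of Dirichlet characters remain.\<close>
lemma moebius_null_eigenfunction:
  assumes "finite A" "q > 0"
    and "\<And>n. f (n + q) = f n" "\<And>n. \<not> coprime n q \<Longrightarrow> f n = 0"
    and "\<And>b. b < q \<Longrightarrow> b \<notin> A \<Longrightarrow> coprime b q \<Longrightarrow> \<exists>l. \<forall>n. f (b * n) = l * f n"
  shows "moebius_null f"
  using assms
proof (induction A arbitrary: f rule: finite_induct)
  case empty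
  note per = empty.prems(2) and nc = empty.prems(3)
  have eig: "\<exists>l. \<forall>n. f (b * n) = l * f n" if "coprime b q" for b
  proof -
    have "f (b * n) = f (b mod q * n)" for n
      by (rule periodic_cong[of f q, OF per]) (simp add: cong_def mod_mult_left_eq)
    moreover have "coprime (b mod q) q" using that empty.prems(1) by simp
    ultimately show ?thesis using empty.prems(1) empty.prems(4)[of "b mod q"] by simp
  qed
  show ?case
  proof (cases "f 1 = 0")
    case True
    have "f n = 0" for n
    proof (cases "coprime n q")
      case True
      then obtain l where "\<forall>m. f (n * m) = l * f m" using eig by blast
      from this[rule_format, of 1] show ?thesis using \<open>f 1 = 0\<close> by simp
    qed (use nc in auto)
    thus ?thesis by (simp add: moebius_null_def)
  next
    case False
    define \<psi> where "\<psi> = (\<lambda>n. f n / f 1)"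
    have "\<psi> (m * n) = \<psi> m * \<psi> n" for m n
    proof (cases "coprime m q")
      case True
      then obtain l where l: "\<forall>n. f (m * n) = l * f n" using eig by blast
      have "\<psi> m = l" using l[rule_format, of 1] False by (simp add: \<psi>_def)
      thus ?thesis using l by (simp add: \<psi>_def)
    next
      case nm: False
      hence "\<not> coprime (m * n) q" by simp
      thus ?thesis using nc nm by (simp add: \<psi>_def)
    qed
    hence "dirichlet_char q \<psi>"
      using empty.prems(1) per nc False by (auto simp: dirichlet_char_def \<psi>_def)
    hence "moebius_null (\<lambda>n. f 1 * \<psi> n)" by (intro moebius_null_scale moebius_null_dchar)
    thus ?thesis using False by (simp add: \<psi>_def)
  qed
next
  case (insert b A)
  note q = insert.prems(1) and per = insert.prems(2) and nc = insert.prems(3) and eig = insert.prems(4)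
  show ?case
  proof (cases "coprime b q")
    case False
    show ?thesis by (rule insert.IH[of f, OF q per nc]) (use eig False in auto)
  next
    case b: True
    \<comment> \<open>By Euler's theorem the \<open>m\<close>-th iterate of the operator is the
      identity on \<open>f\<close>, so its eigenvalues are \<open>m\<close>-th roots of
      unity.\<close>
    define m where "m = totient q"
    have m: "m > 0" using q by (simp add: m_def)
    define u where "u = cis (2 * pi / real m)"
    have "real m * (2 * pi / real m) = 2 * pi" using m by simp
    hence um: "u ^ m = 1" by (simp only: u_def Complex.DeMoivre cis_2pi)
    have fbm: "f (b ^ m * n) = f n" for n
    proof -
      have "[b ^ m * n = 1 * n] (mod q)"
        unfolding m_def using b by (intro cong_scalar_right euler_theorem)
      thus ?thesis using periodic_cong[of f q, OF per] by simp
    qed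
    \<comment> \<open>Up to the factor \<open>m\<close>, the projection of \<open>f\<close> onto the
      eigenspace for \<open>u ^ j\<close>. The exponent \<open>m - k\<close> replaces
      \<open>-k\<close> to keep powers natural. Eigenvectors for the other \<open>c\<close> are
      preserved because the operators commute.\<close>
    define F where "F = (\<lambda>j n. \<Sum>k<m. (u ^ j) ^ (m - k) * f (b ^ k * n))"
    have F_b: "F j (b * n) = u ^ j * F j n" for j n
    proof -
      have uj: "(u ^ j) ^ m = 1" by (metis um power_mult mult.commute power_one)
      define T where "T = (\<lambda>k. (u ^ j) ^ (m - k) * f (b ^ k * n))"
      have "F j (b * n) = (\<Sum>k<m. (u ^ j) ^ (m - k) * f (b ^ Suc k * n))"
        by (simp add: F_def mult_ac)
      also have "\<dots> = (\<Sum>k<m. u ^ j * T (Suc k))"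
      proof (rule sum.cong[OF refl])
        fix k assume "k \<in> {..<m}"
        hence "m - k = Suc (m - Suc k)" by auto
        thus "(u ^ j) ^ (m - k) * f (b ^ Suc k * n) = u ^ j * T (Suc k)"
          by (simp only: T_def power_Suc mult_ac)
      qed
      also have "\<dots> = u ^ j * (\<Sum>k<m. T (Suc k))" by (simp add: sum_distrib_left)
      also have "(\<Sum>k<m. T (Suc k)) = (\<Sum>k<m. T k)"
      proof -
        have "T m = T 0" using uj fbm by (simp add: T_def)
        moreover have "(\<Sum>k<m. T (Suc k)) + T 0 = (\<Sum>k<m. T k) + T m"
          using sum.lessThan_Suc_shift[of T m] by simp
        ultimately show ?thesis by simp
      qed
      finally show ?thesis by (simp add: F_def T_def)
    qed
    have F_null: "moebius_null (F j)" for j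
    proof (rule insert.IH[OF q])
      show "F j (n + q) = F j n" for n
      proof -
        have "f (b ^ k * (n + q)) = f (b ^ k * n)" for k
          by (rule periodic_cong[of f q, OF per]) (simp add: cong_def distrib_left)
        thus ?thesis by (simp add: F_def)
      qed
      show "F j n = 0" if "\<not> coprime n q" for n
        using nc that by (simp add: F_def)
      fix c assume c: "c < q" "c \<notin> A" "coprime c q"
      show "\<exists>l. \<forall>n. F j (c * n) = l * F j n"
      proof (cases "c = b")
        case False
        then obtain l where l: "\<forall>n. f (c * n) = l * f n" using eig[of c] c by auto
        have "F j (c * n) = l * F j n" for n
        proof -
          have "f (b ^ k * (c * n)) = l * f (b ^ k * n)" for k
            using l[rule_format, of "b ^ k * n"] by (simp add: mult_ac)
          thus ?thesis by (simp add: F_def sum_distrib_left mult_ac)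
        qed
        thus ?thesis by blast
      qed (use F_b in blast)
    qed
    have "(\<Sum>j<m. F j n) = of_nat m * f n" for n
    proof -
      have "(\<Sum>j<m. F j n) = (\<Sum>k<m. (\<Sum>j<m. (u ^ j) ^ (m - k)) * f (b ^ k * n))"
        unfolding F_def by (subst sum.swap) (simp add: sum_distrib_right)
      \<comment> \<open>For \<open>k > 0\<close> the coefficient is a full sum of powers of a root
        of unity other than 1, which is 0.\<close>
      also have "\<dots> = (\<Sum>k\<in>{0}. (\<Sum>j<m. (u ^ j) ^ (m - k)) * f (b ^ k * n))"
      proof (rule sum.mono_neutral_right)
        show "\<forall>k\<in>{..<m} - {0}. (\<Sum>j<m. (u ^ j) ^ (m - k)) * f (b ^ k * n) = 0"
          using sum_powers_root_of_unity[of "m - k" m for k] unfolding u_def by auto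
      qed (use m in auto)
      also have "\<dots> = of_nat m * f n"
      proof -
        have "(u ^ j) ^ m = 1" for j by (metis um power_mult mult.commute power_one)
        thus ?thesis by simp
      qed
      finally show ?thesis .
    qed
    moreover have "moebius_null (\<lambda>n. (1 / of_nat m) * (\<Sum>j<m. F j n))"
      by (intro moebius_null_scale moebius_null_sum F_null) auto
    ultimately show ?thesis using m by simp
  qed
qed

lemma moebius_null_coprime_support:
  assumes "q > 0" and per: "\<And>n. f (n + q) = f n" and "\<And>n. \<not> coprime n q \<Longrightarrow> f n = 0"
  shows "moebius_null f"
  by (rule moebius_null_eigenfunction[of "{..<q}" q]) (use assms in auto)

lemma moebius_mu_mult_coprime:
  assumes "d > 0" "m > 0"
  shows "moebius_mu (d * m) = (if coprime d m then moebius_mu d * moebius_mu m else 0)"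
proof (cases "coprime d m")
  case True
  have "squarefree (d * m) \<longleftrightarrow> squarefree d \<and> squarefree m"
    using True squarefree_mult_coprime squarefree_multD by blast
  moreover have "prime_factors (d * m) = prime_factors d \<union> prime_factors m"
    using assms by (simp add: prime_factors_product)
  moreover have "prime_factors d \<inter> prime_factors m = {}"
    using True by (auto simp: in_prime_factors_iff dest: coprime_common_divisor not_prime_unit)
  ultimately show ?thesis using True by (simp add: moebius_mu_def card_Un_disjoint power_add)
next
  case False
  then obtain p where p: "prime p" "p dvd d" "p dvd m"
    using assms by (metis coprime_iff_gcd_eq_1 gcd_greatest_iff prime_factor_nat gcd_dvd1 gcd_dvd2 dvd_trans)
  hence "p\<^sup>2 dvd d * m" by (simp add: power2_eq_square mult_dvd_mono)
  moreover have "\<not> p dvd 1" using p by auto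
  ultimately have "\<not> squarefree (d * m)" by (rule not_squarefreeI)
  thus ?thesis using False by (simp add: moebius_mu_def)
qed

text \<open>Split by \<open>d = gcd n q\<close> and write \<open>n = d * m\<close>,
  \<open>q = d * e\<close>. The gcd condition says that \<open>m\<close> is coprime to
  \<open>e\<close>, and mu vanishes at \<open>d * m\<close> unless \<open>m\<close> is coprime to
  \<open>d\<close>. Together these say that \<open>m\<close> is coprime to \<open>q\<close>, which
  is the case already treated.\<close>

lemma moebius_null_periodic:
  assumes q: "q > 0" and per: "\<And>n. f (n + q) = f n"
  shows "moebius_null f"
proof -
  define D where "D = {d. d dvd q}"
  have D: "finite D" "\<And>d. d \<in> D \<Longrightarrow> d > 0" using q by (auto simp: D_def intro: gr0I)
  define fd where "fd = (\<lambda>d n. if gcd n q = d then f n else 0)"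
  have "moebius_null (fd d)" if d: "d \<in> D" for d
  proof -
    have d0: "d > 0" using D d by blast
    obtain e where e: "q = d * e" using d by (auto simp: D_def)
    define h where "h = (\<lambda>m. if coprime m q then f (d * m) else 0)"
    have h: "moebius_null h"
    proof (rule moebius_null_coprime_support[OF q])
      show "h (n + q) = h n" for n
      proof -
        have "f (d * (n + q)) = f (d * n)"
          by (rule periodic_cong[of f q, OF per]) (simp add: cong_def distrib_left)
        moreover have "coprime (n + q) q \<longleftrightarrow> coprime n q"
          by (simp only: coprime_iff_gcd_eq_1 gcd_add1)
        ultimately show ?thesis by (simp add: h_def)
      qed
    qed (simp add: h_def)
    have reindex: "(\<Sum>n=1..N. of_int (moebius_mu n) * fd d n) = 
       of_int (moebius_mu d) * (\<Sum>m=1..N div d. of_int (moebius_mu m) * h m)" for N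
    proof -
      have "(\<Sum>n=1..N. of_int (moebius_mu n) * fd d n) = (\<Sum>n\<in>(\<lambda>m. d * m) ` {1..N div d}. of_int (moebius_mu n) * fd d n)"
      proof (rule sum.mono_neutral_right)
        show "(\<lambda>m. d * m) ` {1..N div d} \<subseteq> {1..N}"
          using d0 by (auto simp: less_eq_div_iff_mult_less_eq mult.commute)
        show "\<forall>n\<in>{1..N} - (\<lambda>m. d * m) ` {1..N div d}. of_int (moebius_mu n) * fd d n = 0"
        proof
          fix n assume n: "n \<in> {1..N} - (\<lambda>m. d * m) ` {1..N div d}"
          have "gcd n q \<noteq> d"
          proof
            assume "gcd n q = d"
            then obtain m where "n = d * m" by (metis dvdE gcd_dvd1)
            moreover have "m \<in> {1..N div d}"
              using n d0 \<open>n = d * m\<close> by (auto simp: less_eq_div_iff_mult_less_eq mult.commute Suc_le_eq)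
            ultimately show False using n by blast
          qed
          thus "of_int (moebius_mu n) * fd d n = 0" by (simp add: fd_def)
        qed
      qed auto
      also have "\<dots> = (\<Sum>m=1..N div d. of_int (moebius_mu (d * m)) * fd d (d * m))"
        using d0 by (subst sum.reindex) (auto simp: inj_on_def)
      also have "\<dots> = (\<Sum>m=1..N div d. of_int (moebius_mu d) * (of_int (moebius_mu m) * h m))"
      proof (rule sum.cong[OF refl])
        fix m assume "m \<in> {1..N div d}"
        hence m: "m > 0" by auto
        have "gcd (d * m) q = d \<longleftrightarrow> coprime m e"
        proof -
          have "gcd (d * m) q = d * gcd m e" by (simp only: e gcd_mult_distrib_nat)
          moreover have "d * gcd m e = d \<longleftrightarrow> gcd m e = 1" using d0 by auto
          ultimately show ?thesis by (simp only: coprime_iff_gcd_eq_1)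
        qed
        moreover have "coprime m q \<longleftrightarrow> coprime m d \<and> coprime m e" unfolding e by simp
        ultimately show "of_int (moebius_mu (d * m)) * fd d (d * m) = of_int (moebius_mu d) * (of_int (moebius_mu m) * h m)"
          by (auto simp: moebius_mu_mult_coprime[OF d0 m] fd_def h_def coprime_commute)
      qed
      finally show ?thesis by (simp add: sum_distrib_left)
    qed
    define S where "S = (\<lambda>N. (\<Sum>m=1..N. of_int (moebius_mu m) * h m) / of_nat N)"
    have "filterlim (\<lambda>N. N div d) at_top sequentially"
      unfolding filterlim_at_top
    proof
      fix Z show "eventually (\<lambda>N. Z \<le> N div d) sequentially"
        using d0 by (intro eventually_sequentiallyI[of "Z * d"]) (simp add: less_eq_div_iff_mult_less_eq)
    qed
    hence "(\<lambda>N. S (N div d)) \<longlonglongrightarrow> 0"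
      using h unfolding moebius_null_def S_def by (rule filterlim_compose[rotated])
    hence lim: "(\<lambda>N. norm (S (N div d))) \<longlonglongrightarrow> 0" by (rule tendsto_norm_zero)
    have "norm ((\<Sum>n=1..N. of_int (moebius_mu n) * fd d n) / of_nat N) \<le> norm (S (N div d))" for N
    proof (cases "N div d = 0")
      case True
      thus ?thesis unfolding reindex by simp
    next
      case False
      have "norm ((\<Sum>n=1..N. of_int (moebius_mu n) * fd d n) / of_nat N)
         \<le> 1 * norm (\<Sum>m=1..N div d. of_int (moebius_mu m) * h m) / real N"
        unfolding reindex norm_divide norm_mult norm_of_nat using norm_moebius_mu_le[of d]
        by (intro divide_right_mono mult_right_mono) auto
      also have "\<dots> \<le> 1 * norm (\<Sum>m=1..N div d. of_int (moebius_mu m) * h m) / real (N div d)"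
        using False by (intro divide_left_mono) (auto intro!: mult_pos_pos gr0I)
      finally show ?thesis by (simp add: S_def norm_divide)
    qed
    thus ?thesis unfolding moebius_null_def
      by (intro Lim_null_comparison[OF _ lim] always_eventually) auto
  qed
  hence "moebius_null (\<lambda>n. \<Sum>d\<in>D. fd d n)" by (intro moebius_null_sum D) auto
  moreover have "(\<Sum>d\<in>D. fd d n) = f n" for n
    using D(1) by (simp add: fd_def D_def)
  ultimately show ?thesis by simp
qed

section \<open>Multiplicative functions close to 1\<close>

lemma card_multiples_upto:
  assumes "d > 0"
  shows "card {n \<in> {1..N}. d dvd n} = N div d"
proof -
  have "{n \<in> {1..N}. d dvd n} = (\<lambda>k. d * k) ` {1..N div d}"
  proof (intro equalityI subsetI)
    fix n assume "n \<in> {n \<in> {1..N}. d dvd n}"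
    then obtain k where k: "n = d * k" "1 \<le> d * k" "d * k \<le> N" by auto
    hence "k \<le> N div d" using assms by (simp add: less_eq_div_iff_mult_less_eq mult.commute)
    thus "n \<in> (\<lambda>k. d * k) ` {1..N div d}" using k by (auto simp: Suc_le_eq)
  qed (use assms in \<open>auto simp: less_eq_div_iff_mult_less_eq mult.commute\<close>)
  thus ?thesis using assms by (simp add: card_image inj_on_def)
qed

lemma card_multiples_upto':
  assumes "d > 0"
  shows "card ({Suc 0..N} \<inter> {n. d dvd n}) = N div d"
proof -
  have "{Suc 0..N} \<inter> {n. d dvd n} = {n \<in> {1..N}. d dvd n}" by auto
  thus ?thesis using card_multiples_upto[OF assms, of N] by simp
qed

lemma sum_indicator_dvd:
  assumes "d > 0"
  shows "(\<Sum>n=1..N. of_bool (d dvd n)) = real (N div d)"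
  by (simp add: card_multiples_upto'[OF assms])

lemma real_div_bounds:
  "real (N div d) \<le> real N / real d" "d > 0 \<Longrightarrow> real N / real d - 1 \<le> real (N div d)"
proof -
  show "real (N div d) \<le> real N / real d" by (rule of_nat_div_le_of_nat)
  assume "d > 0"
  have "real N = real (N div d) * real d + real (N mod d)"
    by (metis div_mult_mod_eq of_nat_add of_nat_mult)
  moreover have "real (N mod d) \<le> real d" using \<open>d > 0\<close> by (simp add: less_imp_le)
  ultimately show "real N / real d - 1 \<le> real (N div d)" using \<open>d > 0\<close> by (simp add: field_simps)
qed

lemma sum_indicator_dvd_le: "d > 0 \<Longrightarrow> (\<Sum>n=1..N. of_bool (d dvd n)) \<le> real N / real d"
  using sum_indicator_dvd real_div_bounds(1) by metis

text \<open>With exact densities the expression would be 0. Three quotients are rounded down, for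
  \<open>p * q\<close>, \<open>p\<close> and \<open>q\<close>, and each rounding contributes an
  error of at most 1.\<close>

lemma covariance_distinct_primes:
  assumes p: "prime p" "prime q" "p \<noteq> q"
  shows "\<bar>\<Sum>n=1..N. (of_bool (p dvd n) - 1 / real p) * (of_bool (q dvd n) - 1 / real q)\<bar> \<le> 3"
proof -
  have pos: "p > 0" "q > 0" using p by (auto simp: prime_gt_0_nat)
  have cop: "coprime p q" using p by (simp add: primes_coprime)
  have "(of_bool (p dvd n) - 1 / real p) * (of_bool (q dvd n) - 1 / real q)
      = of_bool (p * q dvd n) - of_bool (q dvd n) / real p - of_bool (p dvd n) / real q + 1 / (real p * real q)" for n
  proof -
    have "p * q dvd n \<longleftrightarrow> p dvd n \<and> q dvd n" using cop divides_mult dvd_mult_left dvd_mult_right by metis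
    thus ?thesis by (auto simp: algebra_simps of_bool_def)
  qed
  hence "(\<Sum>n=1..N. (of_bool (p dvd n) - 1 / real p) * (of_bool (q dvd n) - 1 / real q))
     = real (N div (p * q)) - real (N div q) / real p - real (N div p) / real q + real N / (real p * real q)"
    using pos by (simp add: sum.distrib sum_subtractf sum_divide_distrib[symmetric]
        card_multiples_upto')
  moreover have "real N / (real p * real q) - 1 \<le> real (N div (p * q))" "real (N div (p * q)) \<le> real N / (real p * real q)"
    using real_div_bounds[where N = N and d = "p * q"] pos by auto
  moreover have b: "real N / (real p * real q) - 1 \<le> real (N div q) / real p \<and> real (N div q) / real p \<le> real N / (real p * real q)"
    if "p > 0" "q > 0" for p q :: nat
  proof -
    have "1 / real p \<le> 1" using that by simp
    moreover have "(real N / real q - 1) / real p \<le> real (N div q) / real p" "real (N div q) / real p \<le> real N / real q / real p"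
      using divide_right_mono[OF real_div_bounds(2)[OF that(2)], of "real p" N]
        divide_right_mono[OF real_div_bounds(1)[of N q], of "real p"] by simp_all
    ultimately show ?thesis by (simp add: diff_divide_distrib mult.commute)
  qed
  moreover note b[OF pos] b[OF pos(2,1)]
  ultimately show ?thesis by (simp add: abs_le_iff mult.commute)
qed

lemma variance_prime:
  assumes "p > 0"
  shows "(\<Sum>n=1..N. (of_bool (p dvd n) - 1 / real p)\<^sup>2) \<le> 2 * real N / real p"
proof -
  have "(of_bool (p dvd n) - 1 / real p)\<^sup>2 \<le> of_bool (p dvd n) + 1 / real p" for n
  proof -
    define u where "u = 1 / real p"
    have "0 \<le> u" "u \<le> 1" using assms by (auto simp: u_def)
    moreover from this have "u\<^sup>2 \<le> u" unfolding power2_eq_square by (intro mult_left_le)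
    ultimately show ?thesis unfolding u_def[symmetric] by (auto simp: of_bool_def power2_diff)
  qed
  hence "(\<Sum>n=1..N. (of_bool (p dvd n) - 1 / real p)\<^sup>2) \<le> (\<Sum>n=1..N. of_bool (p dvd n) + 1 / real p)"
    by (intro sum_mono)
  also have "\<dots> \<le> 2 * real N / real p"
    using sum_indicator_dvd_le[OF assms, of N] by (simp add: sum.distrib)
  finally show ?thesis .
qed

text \<open>Expand the square. The diagonal contributes at most twice \<open>N\<close> times the
  weighted sum on the right. The remaining pairs have covariance at most 3, and Cauchy-Schwarz
  bounds \<open>(\<Sum>p\<in>P. norm (e p))\<^sup>2\<close> by that same sum times the sum of the
  primes in \<open>P\<close>, which is at most \<open>z\<^sup>2 \<le> N\<close>. Hence the constant
  5 and the restriction to primes below the square root of \<open>N\<close>.\<close>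

lemma turan_kubilius:
  fixes e :: "nat \<Rightarrow> complex"
  assumes P: "\<And>p. p \<in> P \<Longrightarrow> prime p \<and> p \<le> z" and z: "z\<^sup>2 \<le> N"
  shows "(\<Sum>n=1..N. (norm ((\<Sum>p | p \<in> P \<and> p dvd n. e p) - (\<Sum>p\<in>P. e p / of_nat p)))\<^sup>2)
           \<le> 5 * real N * (\<Sum>p\<in>P. (norm (e p))\<^sup>2 / real p)"
proof -
  have fin: "finite P" using P by (intro finite_subset[of P "{..z}"]) auto
  have pos: "p > 0" if "p \<in> P" for p using P[OF that] by (simp add: prime_gt_0_nat)
  define \<delta> where "\<delta> = (\<lambda>p n. of_bool (p dvd n) - 1 / real p)"
  define V where "V = (\<lambda>p q. \<Sum>n=1..N. \<delta> p n * \<delta> q n)"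
  define E where "E = (\<Sum>p\<in>P. (norm (e p))\<^sup>2 / real p)"
  define w where "w = (\<lambda>n. \<Sum>p\<in>P. e p * of_real (\<delta> p n))"
  have w_eq: "(\<Sum>p | p \<in> P \<and> p dvd n. e p) - (\<Sum>p\<in>P. e p / of_nat p) = w n" for n
  proof -
    have "(\<Sum>p | p \<in> P \<and> p dvd n. e p) = (\<Sum>p\<in>P. e p * of_bool (p dvd n))"
      using fin by (simp add: sum.inter_filter of_bool_def if_distrib cong: if_cong)
    thus ?thesis
      by (auto simp: w_def \<delta>_def sum_subtractf[symmetric] right_diff_distrib of_bool_def intro!: sum.cong)
  qed
  have sq: "complex_of_real ((norm (w n))\<^sup>2) = (\<Sum>p\<in>P. \<Sum>q\<in>P. e p * cnj (e q) * of_real (\<delta> p n * \<delta> q n))" for n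
    unfolding complex_norm_square by (simp add: w_def sum_product mult_ac)
  have "of_real (\<Sum>n=1..N. (norm (w n))\<^sup>2) = (\<Sum>n=1..N. \<Sum>p\<in>P. \<Sum>q\<in>P. e p * cnj (e q) * of_real (\<delta> p n * \<delta> q n))"
    unfolding of_real_sum sq ..
  also have "\<dots> = (\<Sum>p\<in>P. \<Sum>n=1..N. \<Sum>q\<in>P. e p * cnj (e q) * of_real (\<delta> p n * \<delta> q n))"
    by (rule sum.swap)
  also have "\<dots> = (\<Sum>p\<in>P. \<Sum>q\<in>P. \<Sum>n=1..N. e p * cnj (e q) * of_real (\<delta> p n * \<delta> q n))"
    by (intro sum.cong refl sum.swap)
  also have "\<dots> = (\<Sum>p\<in>P. \<Sum>q\<in>P. e p * cnj (e q) * of_real (V p q))"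
    by (simp only: V_def of_real_sum sum_distrib_left)
  finally have eq: "complex_of_real (\<Sum>n=1..N. (norm (w n))\<^sup>2) = (\<Sum>p\<in>P. \<Sum>q\<in>P. e p * cnj (e q) * of_real (V p q))" .
  have "(\<Sum>n=1..N. (norm (w n))\<^sup>2) = \<bar>\<Sum>n=1..N. (norm (w n))\<^sup>2\<bar>"
    by (rule abs_of_nonneg[symmetric]) (simp add: sum_nonneg)
  also have "\<dots> = norm (\<Sum>p\<in>P. \<Sum>q\<in>P. e p * cnj (e q) * of_real (V p q))"
    unfolding eq[symmetric] norm_of_real ..
  also have "\<dots> \<le> (\<Sum>p\<in>P. \<Sum>q\<in>P. norm (e p) * norm (e q) * \<bar>V p q\<bar>)"
    by (intro sum_norm_le) (simp add: norm_mult)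
  also have "\<dots> \<le> (\<Sum>p\<in>P. \<Sum>q\<in>P. norm (e p) * norm (e q) * 3 + (if p = q then (norm (e p))\<^sup>2 * (2 * real N / real p) else 0))"
  proof (intro sum_mono)
    fix p q assume pq: "p \<in> P" "q \<in> P"
    show "norm (e p) * norm (e q) * \<bar>V p q\<bar> \<le> norm (e p) * norm (e q) * 3 + (if p = q then (norm (e p))\<^sup>2 * (2 * real N / real p) else 0)"
    proof (cases "p = q")
      case True
      have "V p p = (\<Sum>n=1..N. (of_bool (p dvd n) - 1 / real p)\<^sup>2)"
        by (simp add: V_def \<delta>_def power2_eq_square)
      moreover from this have "V p p \<ge> 0" by (simp add: sum_nonneg)
      ultimately have "\<bar>V p p\<bar> \<le> 2 * real N / real p" using variance_prime[OF pos[OF pq(1)], of N] by simp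
      hence "(norm (e p))\<^sup>2 * \<bar>V p p\<bar> \<le> (norm (e p))\<^sup>2 * (2 * real N / real p)"
        by (intro mult_left_mono) auto
      moreover have "0 \<le> norm (e p) * norm (e p) * 3" by simp
      moreover have "norm (e p) * norm (e p) * \<bar>V p p\<bar> = (norm (e p))\<^sup>2 * \<bar>V p p\<bar>"
        by (simp add: power2_eq_square)
      ultimately have "norm (e p) * norm (e p) * \<bar>V p p\<bar> \<le> norm (e p) * norm (e p) * 3 + (norm (e p))\<^sup>2 * (2 * real N / real p)"
        by linarith
      thus ?thesis using True by simp
    next
      case False
      have "\<bar>V p q\<bar> \<le> 3"
        using covariance_distinct_primes[of p q N] P pq False by (simp add: V_def \<delta>_def)
      hence "norm (e p) * norm (e q) * \<bar>V p q\<bar> \<le> norm (e p) * norm (e q) * 3"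
        by (intro mult_left_mono) auto
      thus ?thesis using False by simp
    qed
  qed
  also have "\<dots> = 3 * (\<Sum>p\<in>P. norm (e p))\<^sup>2 + 2 * real N * E"
    using fin by (simp add: sum.distrib power2_eq_square sum_product sum_distrib_left sum.delta E_def mult_ac)
  also have "(\<Sum>p\<in>P. norm (e p))\<^sup>2 \<le> real N * E"
  proof -
    have "(\<Sum>p\<in>P. norm (e p)) = (\<Sum>p\<in>P. (norm (e p) / sqrt (real p)) * sqrt (real p))"
      using pos by (intro sum.cong) auto
    hence 1: "(\<Sum>p\<in>P. norm (e p))\<^sup>2 \<le> (\<Sum>p\<in>P. (norm (e p) / sqrt (real p))\<^sup>2) * (\<Sum>p\<in>P. (sqrt (real p))\<^sup>2)"
      using Cauchy_Schwarz_ineq_sum by metis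
    have 2: "(\<Sum>p\<in>P. (norm (e p) / sqrt (real p))\<^sup>2) = E"
      unfolding E_def by (intro sum.cong) (auto simp: power_divide)
    have 3: "(\<Sum>p\<in>P. (sqrt (real p))\<^sup>2) \<le> real N"
    proof -
      have "(\<Sum>p\<in>P. (sqrt (real p))\<^sup>2) \<le> (\<Sum>p\<in>P. real z)"
        using P by (intro sum_mono) auto
      also have "\<dots> \<le> (\<Sum>p\<in>{1..z}. real z)"
        using P pos by (intro sum_mono2) (auto simp: Suc_le_eq)
      also have "\<dots> = real (z\<^sup>2)" by (simp add: power2_eq_square)
      also have "\<dots> \<le> real N" using z by (rule of_nat_mono)
      finally show ?thesis .
    qed
    have "E * (\<Sum>p\<in>P. (sqrt (real p))\<^sup>2) \<le> E * real N"
      using 3 by (intro mult_left_mono) (auto simp: E_def intro!: sum_nonneg)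
    with 1 show ?thesis unfolding 2 by (simp add: mult.commute)
  qed
  finally show ?thesis unfolding w_eq E_def by simp
qed

section \<open>Approximation in mean by periodic functions\<close>

lemma multiplicative_fun_prod_coprime:
  assumes g: "multiplicative_fun g" and "finite P" "\<And>p. p \<in> P \<Longrightarrow> prime p"
  shows "g (\<Prod>p\<in>P. p ^ k p) = (\<Prod>p\<in>P. g (p ^ k p))"
  using assms(2,3)
proof (induction P rule: finite_induct)
  case empty
  thus ?case using g by (simp add: multiplicative_fun_def)
next
  case (insert p P)
  have "coprime (p ^ k p) (\<Prod>p\<in>P. p ^ k p)"
    using insert by (intro prod_coprime_right coprime_power_left_iff[THEN iffD2] coprime_power_right_iff[THEN iffD2] disjI1)
      (auto intro!: primes_coprime)
  moreover have "(\<Prod>p\<in>P. p ^ k p) > 0" "p ^ k p > 0"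
    using insert by (auto intro!: prod_pos simp: prime_gt_0_nat)
  ultimately show ?case using g insert by (simp add: multiplicative_fun_def)
qed

lemma multiplicative_fun_prime_factors:
  assumes g: "multiplicative_fun g" and n: "n > 0"
  shows "g n = (\<Prod>p\<in>prime_factors n. g (p ^ multiplicity p n))"
proof -
  have "n = (\<Prod>p\<in>prime_factors n. p ^ multiplicity p n)"
    using n by (simp add: prod_prime_factors)
  hence "g n = g (\<Prod>p\<in>prime_factors n. p ^ multiplicity p n)" by metis
  also have "\<dots> = (\<Prod>p\<in>prime_factors n. g (p ^ multiplicity p n))"
    by (rule multiplicative_fun_prod_coprime[OF g]) auto
  finally show ?thesis .
qed

lemma norm_exp_diff_le:
  assumes "Re a \<le> 0" "Re b \<le> 0"
  shows "norm (exp a - exp b) \<le> norm (a - b)"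
proof -
  have "norm (exp a - exp b) \<le> 1 * norm (a - b)"
    by (rule field_differentiable_bound[of "{z. Re z \<le> 0}" exp exp])
       (use assms in \<open>auto simp: convex_halfspace_Re_le intro!: derivative_eq_intros\<close>)
  thus ?thesis by simp
qed

text \<open>The hypothesis forces \<open>norm w \<le> 2\<close>, which is where \<open>exp 2\<close>
  comes from.\<close>

lemma norm_one_plus_minus_exp_le:
  fixes w :: complex
  assumes "norm (1 + w) \<le> 1"
  shows "norm (1 + w - exp w) \<le> exp 2 * (norm w)\<^sup>2"
proof -
  have "norm w \<le> 2" using norm_triangle_ineq4[of "1 + w" 1] assms by simp
  hence re: "\<bar>Re w\<bar> \<le> 2" using abs_Re_le_cmod[of w] by linarith
  have "norm (exp w - (\<Sum>k\<le>1. w ^ k / fact k)) \<le> exp \<bar>Re w\<bar> * norm w ^ Suc 1 / fact 1"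
    by (rule Taylor_exp)
  hence "norm (exp w - (1 + w)) \<le> exp \<bar>Re w\<bar> * (norm w)\<^sup>2" by (simp add: numeral_2_eq_2)
  also have "\<dots> \<le> exp 2 * (norm w)\<^sup>2" using re by (intro mult_right_mono) auto
  finally show ?thesis by (simp add: norm_minus_commute)
qed

lemma Re_le_0_of_norm_one_plus:
  assumes "norm (1 + w) \<le> 1"
  shows "Re w \<le> 0"
  using complex_Re_le_cmod[of "1 + w"] assms by simp

text \<open>Both sides are products of numbers in the unit disc, so the difference is at most the
  sum of the differences of the factors. A prime dividing \<open>b\<close> once gives a second-order
  error if \<open>p \<le> z\<close>; above \<open>z\<close> its factor is compared with 1, a
  first-order error. If \<open>p\<^sup>2\<close> divides \<open>b\<close>, the trivial bound 2 is
  used.\<close>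

lemma multiplicative_fun_exp_approx:
  assumes g: "multiplicative_fun g" and bd: "\<And>n. n \<ge> 1 \<Longrightarrow> norm (g n) \<le> 1" and b: "b > 0"
  shows "norm (g b - exp (\<Sum>p | p \<in> prime_factors b \<and> p \<le> z. g p - 1))
     \<le> (\<Sum>p\<in>prime_factors b. (if p \<le> z then exp 2 * (norm (g p - 1))\<^sup>2 else norm (g p - 1)) + 2 * of_bool (p\<^sup>2 dvd b))"
proof -
  define w where "w = (\<lambda>p. if p \<le> z then g p - 1 else 0)"
  have g1: "norm (g p) \<le> 1" if "prime p" for p using bd[of p] that prime_ge_1_nat by blast
  have Re_w: "Re (w p) \<le> 0" if "prime p" for p
    using Re_le_0_of_norm_one_plus[of "g p - 1"] g1[OF that] by (simp add: w_def)
  have "exp (\<Sum>p | p \<in> prime_factors b \<and> p \<le> z. g p - 1) = exp (\<Sum>p\<in>prime_factors b. w p)"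
    unfolding w_def by (subst sum.inter_filter) auto
  also have "\<dots> = (\<Prod>p\<in>prime_factors b. exp (w p))" by (rule exp_sum) simp
  finally have eq: "exp (\<Sum>p | p \<in> prime_factors b \<and> p \<le> z. g p - 1) = (\<Prod>p\<in>prime_factors b. exp (w p))" .
  have "norm (g b - exp (\<Sum>p | p \<in> prime_factors b \<and> p \<le> z. g p - 1))
     = norm ((\<Prod>p\<in>prime_factors b. g (p ^ multiplicity p b)) - (\<Prod>p\<in>prime_factors b. exp (w p)))"
    unfolding eq using multiplicative_fun_prime_factors[OF g b] by simp
  also have "\<dots> \<le> (\<Sum>p\<in>prime_factors b. norm (g (p ^ multiplicity p b) - exp (w p)))"
  proof (rule norm_prod_diff)
    fix p assume "p \<in> prime_factors b"
    hence p: "prime p" by auto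
    show "norm (g (p ^ multiplicity p b)) \<le> 1" using p by (intro bd) (simp add: Suc_leI prime_gt_0_nat)
    show "norm (exp (w p)) \<le> 1" using Re_w[OF p] by simp
  qed
  also have "\<dots> \<le> (\<Sum>p\<in>prime_factors b. (if p \<le> z then exp 2 * (norm (g p - 1))\<^sup>2 else norm (g p - 1)) + 2 * of_bool (p\<^sup>2 dvd b))"
  proof (rule sum_mono)
    fix p assume pb: "p \<in> prime_factors b"
    hence p: "prime p" "p dvd b" by auto
    show "norm (g (p ^ multiplicity p b) - exp (w p)) \<le> (if p \<le> z then exp 2 * (norm (g p - 1))\<^sup>2 else norm (g p - 1)) + 2 * of_bool (p\<^sup>2 dvd b)"
    proof (cases "p\<^sup>2 dvd b")
      case True
      have "norm (g (p ^ multiplicity p b)) \<le> 1" using p by (intro bd) (simp add: Suc_leI prime_gt_0_nat)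
      moreover have "norm (exp (w p)) \<le> 1" using Re_w[OF p(1)] by simp
      ultimately have "norm (g (p ^ multiplicity p b) - exp (w p)) \<le> 2"
        using norm_triangle_ineq4[of "g (p ^ multiplicity p b)" "exp (w p)"] by linarith
      moreover have "0 \<le> (if p \<le> z then exp 2 * (norm (g p - 1))\<^sup>2 else norm (g p - 1))" by simp
      ultimately show ?thesis using True by simp
    next
      case False
      have "multiplicity p b = 1"
        by (rule multiplicity_eqI) (use p False in \<open>auto simp: power2_eq_square\<close>)
      thus ?thesis
        using norm_one_plus_minus_exp_le[of "g p - 1"] g1[OF p(1)] by (simp add: w_def False)
    qed
  qed
  finally show ?thesis .
qed

lemma summable_on_tail_small:
  fixes f :: "nat \<Rightarrow> real"
  assumes f: "f summable_on A" and nonneg: "\<And>n. n \<in> A \<Longrightarrow> f n \<ge> 0" and \<eta>: "\<eta> > 0"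
  obtains y where "\<And>F. finite F \<Longrightarrow> F \<subseteq> A \<inter> {y<..} \<Longrightarrow> sum f F \<le> \<eta>"
proof -
  obtain F0 where F0: "finite F0" "F0 \<subseteq> A" "dist (sum f F0) (infsum f A) \<le> \<eta>"
    using has_sum_finite_approximation[OF has_sum_infsum[OF f] \<eta>] by blast
  define y where "y = Max (insert 0 F0)"
  have "sum f F \<le> \<eta>" if F: "finite F" "F \<subseteq> A \<inter> {y<..}" for F
  proof -
    have "F0 \<inter> F = {}"
    proof -
      have "n \<le> y" if "n \<in> F0" for n using F0(1) that by (simp add: y_def)
      thus ?thesis using F(2) by fastforce
    qed
    hence "sum f F0 + sum f F = sum f (F0 \<union> F)" using F0 F by (simp add: sum.union_disjoint)
    also have "\<dots> \<le> infsum f A"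
      using F0 F nonneg by (intro finite_sum_le_infsum f) auto
    finally show ?thesis using F0(3) by (simp add: dist_real_def)
  qed
  thus ?thesis by (rule that)
qed

context
  fixes y K n :: nat
  assumes n: "n > 0" and K: "K > 0"
begin

lemma prime_dvd_fact_power_iff: "prime p \<Longrightarrow> p dvd fact y ^ K \<longleftrightarrow> p \<le> y"
  using K by (simp add: prime_dvd_power_iff prime_dvd_fact_iff)

text \<open>The gcd is meant to be the \<open>y\<close>-smooth part of \<open>n\<close>. Each prime
  up to \<open>y\<close> divides \<open>fact y ^ K\<close> at least \<open>K\<close> times, so the
  gcd misses some of that prime only if \<open>n\<close> contains it more than \<open>K\<close>
  times, which is rare for large \<open>K\<close>.\<close>

lemma smooth_part_not_coprime:
  assumes "\<not> coprime (gcd n (fact y ^ K)) (n div gcd n (fact y ^ K))"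
  obtains p where "prime p" "p \<le> y" "p ^ Suc K dvd n"
proof -
  let ?d = "gcd n (fact y ^ K)"
  have nd: "n = n div ?d * ?d" by simp
  have "gcd ?d (n div ?d) \<noteq> 1" using assms by (simp only: coprime_iff_gcd_eq_1 not_False_eq_True)
  then obtain p where "prime p" "p dvd gcd ?d (n div ?d)" using prime_factor_nat by blast
  hence p: "prime p" "p dvd ?d" "p dvd n div ?d" using dvd_trans[OF _ gcd_dvd1] dvd_trans[OF _ gcd_dvd2] by blast+
  have py: "p \<le> y" using p by (simp add: prime_dvd_fact_power_iff)
  define v where "v = multiplicity p n"
  have "p ^ Suc K dvd n"
  proof (rule ccontr)
    assume "\<not> p ^ Suc K dvd n"
    hence "v \<le> K"
      using multiplicity_dvd'[of "Suc K" p n] unfolding v_def by (meson not_less_eq_eq)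
    have "p ^ K dvd fact y ^ K"
      using py p(1) by (intro dvd_power_same) (simp add: prime_dvd_fact_iff)
    hence "p ^ v dvd fact y ^ K" using le_imp_power_dvd[OF \<open>v \<le> K\<close>] dvd_trans by blast
    moreover have "p ^ v dvd n" by (simp add: v_def multiplicity_dvd)
    ultimately have "p ^ v dvd ?d" by simp
    hence "p * p ^ v dvd n div ?d * ?d" using p(3) by (intro mult_dvd_mono)
    hence "p ^ Suc v dvd n" using nd by simp
    hence "Suc v \<le> v"
      unfolding v_def using n p(1) by (subst (asm) power_dvd_iff_le_multiplicity) auto
    thus False by simp
  qed
  with p py that show ?thesis by blast
qed

lemma prime_factors_rough_part:
  assumes "coprime (gcd n (fact y ^ K)) (n div gcd n (fact y ^ K))"
  shows "prime_factors (n div gcd n (fact y ^ K)) = {p. prime p \<and> y < p \<and> p dvd n}"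
proof -
  let ?d = "gcd n (fact y ^ K)"
  have nd: "n = n div ?d * ?d" by simp
  have b0: "n div ?d > 0" using n by (simp add: dvd_imp_le div_greater_zero_iff)
  have "p dvd n div ?d \<longleftrightarrow> y < p \<and> p dvd n" if p: "prime p" for p
  proof
    assume pb: "p dvd n div ?d"
    hence pn: "p dvd n" by (subst nd) (rule dvd_mult2)
    have "\<not> p dvd ?d" using assms pb p by (meson coprime_common_divisor not_prime_unit)
    thus "y < p \<and> p dvd n" using pn p by (auto simp: prime_dvd_fact_power_iff)
  next
    assume *: "y < p \<and> p dvd n"
    hence "\<not> p dvd ?d" using p by (auto simp: prime_dvd_fact_power_iff)
    moreover have "p dvd n div ?d * ?d" using * by simp
    ultimately show "p dvd n div ?d" using p by (simp only: prime_dvd_mult_iff) blast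
  qed
  thus ?thesis using b0 by (auto simp: in_prime_factors_iff)
qed

end

lemma sum_indicator_weighted_le:
  fixes a :: "nat \<Rightarrow> real"
  assumes "finite F" "\<And>p. p \<in> F \<Longrightarrow> a p \<ge> 0" "\<And>p. p \<in> F \<Longrightarrow> d p > 0"
  shows "(\<Sum>n=1..N. \<Sum>p\<in>F. a p * of_bool (d p dvd n)) \<le> real N * (\<Sum>p\<in>F. a p / real (d p))"
proof -
  have "(\<Sum>n=1..N. \<Sum>p\<in>F. a p * of_bool (d p dvd n)) = (\<Sum>p\<in>F. a p * (\<Sum>n=1..N. of_bool (d p dvd n)))"
    unfolding sum_distrib_left by (rule sum.swap)
  also have "\<dots> \<le> (\<Sum>p\<in>F. a p * (real N / real (d p)))"
    using assms by (intro sum_mono mult_left_mono sum_indicator_dvd_le)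
  also have "\<dots> = real N * (\<Sum>p\<in>F. a p / real (d p))" by (simp add: sum_distrib_left mult_ac)
  finally show ?thesis .
qed

lemma sum_le_sqrt_sum_squares:
  fixes x :: "nat \<Rightarrow> real"
  assumes "(\<Sum>n=1..N. (x n)\<^sup>2) \<le> real N * B"
  shows "(\<Sum>n=1..N. x n) \<le> real N * sqrt B"
proof -
  have "(\<Sum>n=1..N. 1 * x n)\<^sup>2 \<le> (\<Sum>n=1..N. 1\<^sup>2) * (\<Sum>n=1..N. (x n)\<^sup>2)" by (rule Cauchy_Schwarz_ineq_sum)
  also have "\<dots> \<le> real N * (real N * B)" using assms by (simp add: mult_left_mono)
  finally have "(\<Sum>n=1..N. x n)\<^sup>2 \<le> real N * (real N * B)" by simp
  hence "(\<Sum>n=1..N. x n) \<le> sqrt (real N * (real N * B))" by (rule real_le_rsqrt)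
  also have "\<dots> = real N * sqrt B" by (simp add: real_sqrt_mult)
  finally show ?thesis .
qed

lemma sum_inverse_squares_tail:
  assumes "finite F" "F \<subseteq> {y<..}" "y \<ge> 1"
  shows "(\<Sum>p\<in>F. 1 / (real p)\<^sup>2) \<le> 1 / real y"
proof -
  define M where "M = Max (insert y F)"
  have M: "y \<le> M" "F \<subseteq> {y<..M}" using assms by (auto simp: M_def)
  have "(\<Sum>p\<in>F. 1 / (real p)\<^sup>2) \<le> (\<Sum>p\<in>{y<..M}. 1 / (real p)\<^sup>2)"
    by (intro sum_mono2 M) auto
  also have "\<dots> = (\<Sum>p\<in>{y<..M}. real p powr (-1 - 1))"
    by (intro sum.cong) (auto simp: powr_minus_divide)
  also have "\<dots> \<le> (real y powr -1 - real M powr -1) / 1"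
    by (intro sum_powr_tail_le M assms) auto
  also have "\<dots> \<le> real y powr -1" by simp
  finally show ?thesis using assms by (simp add: powr_minus_divide)
qed

text \<open>Split \<open>n\<close> into its \<open>y\<close>-smooth part and a cofactor
  \<open>b\<close>; \<open>g b\<close> is close to \<open>exp (W n)\<close>, and \<open>W n\<close>
  concentrates around its mean \<open>A\<close>. The five error terms come, in order, from
  \<open>n\<close> divisible by a high power of a prime up to \<open>y\<close>, from linearising
  \<open>g p\<close> for \<open>p \<le> z\<close>, from primes above \<open>z\<close>, from squares
  of primes above \<open>y\<close>, and from the deviation of \<open>W n\<close> via
  Turan-Kubilius.\<close>

lemma multiplicative_approx_bound:
  fixes g :: "nat \<Rightarrow> complex"
  assumes g: "multiplicative_fun g" and bd: "\<And>n. n \<ge> 1 \<Longrightarrow> norm (g n) \<le> 1"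
    and y: "y \<ge> 1" and K: "K > 0"
    and tail: "\<And>F. finite F \<Longrightarrow> F \<subseteq> {p. prime p} \<inter> {y<..} \<Longrightarrow> (\<Sum>p\<in>F. (norm (g p - 1))\<^sup>2 / real p) \<le> \<eta>"
  obtains c where "norm c \<le> 1"
    "(\<Sum>n=1..N. norm (g n - c * g (gcd n (fact y ^ K)))) 
      \<le> real N * (real y / 2 ^ K + exp 2 * \<eta> + sqrt \<eta> + 2 / real y + sqrt (5 * \<eta>))"
proof -
  define e where "e = (\<lambda>p. g p - 1)"
  \<comment> \<open>\<open>z\<close> is the integer square root of \<open>N\<close>: small enough
    for Turan-Kubilius, large enough that no \<open>n \<le> N\<close> has two distinct prime factors
    above \<open>z\<close>.\<close>
  have "\<exists>k<Suc N. (\<forall>i\<le>k. \<not> N < i\<^sup>2) \<and> N < (Suc k)\<^sup>2"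
    by (rule ex_least_nat_less) (auto simp: power2_eq_square)
  then obtain z where z: "z\<^sup>2 \<le> N" "N < (Suc z)\<^sup>2" by (auto simp: not_less)
  define PP where "PP = {p. prime p \<and> y < p \<and> p \<le> N}"
  define P where "P = {p \<in> PP. p \<le> z}"
  have fin: "finite PP" "finite P" by (auto simp: PP_def P_def)
  have PPpos: "p > 0" if "p \<in> PP" for p using that by (simp add: PP_def prime_gt_0_nat)
  have sub: "P \<subseteq> PP" by (auto simp: P_def)
  define E where "E = (\<lambda>F. \<Sum>p\<in>F. (norm (e p))\<^sup>2 / real p)"
  have E: "E F \<le> \<eta>" if "F \<subseteq> PP" for F
    unfolding E_def e_def using that fin by (intro tail) (auto simp: PP_def intro: finite_subset)
  have \<eta>0: "\<eta> \<ge> 0" using E[of "{}"] by (simp add: E_def)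
  define A where "A = (\<Sum>p\<in>P. e p / of_nat p)"
  have Re_e: "Re (e p) \<le> 0" if "p \<in> PP" for p
    using Re_le_0_of_norm_one_plus[of "e p"] bd[of p] PPpos[OF that] by (simp add: e_def)
  have "Re A = (\<Sum>p\<in>P. Re (e p) / real p)" unfolding A_def by simp
  also have "\<dots> \<le> 0" using Re_e sub by (intro sum_nonpos divide_nonpos_nonneg) auto
  finally have ReA: "Re A \<le> 0" .
  define W where "W = (\<lambda>n. \<Sum>p | p \<in> P \<and> p dvd n. e p)"
  have ReW: "Re (W n) \<le> 0" for n
    unfolding W_def Re_sum using Re_e sub by (intro sum_nonpos) auto
  define d where "d = (\<lambda>n::nat. gcd n (fact y ^ K))"
  define Rbad where "Rbad = (\<lambda>n. \<Sum>p | prime p \<and> p \<le> y. 2 * of_bool (p ^ Suc K dvd n) :: real)"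
  define Ra where "Ra = (\<lambda>n. \<Sum>p\<in>P. exp 2 * (norm (e p))\<^sup>2 * of_bool (p dvd n))"
  define Rb where "Rb = (\<lambda>n. \<Sum>p\<in>PP - P. norm (e p) * of_bool (p dvd n))"
  define Rc where "Rc = (\<lambda>n. \<Sum>p\<in>PP. 2 * of_bool (p\<^sup>2 dvd n) :: real)"
  have finy: "finite {p::nat. prime p \<and> p \<le> y}" by (rule finite_subset[of _ "{..y}"]) auto
  have nonneg: "Rbad n \<ge> 0" "Ra n \<ge> 0" "Rb n \<ge> 0" "Rc n \<ge> 0" for n
    by (auto simp: Rbad_def Ra_def Rb_def Rc_def intro!: sum_nonneg)
  have pointwise: "norm (g n - exp A * g (d n)) \<le> Rbad n + Ra n + Rb n + Rc n + norm (W n - A)"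
    if n: "n \<in> {1..N}" for n
  proof (cases "coprime (d n) (n div d n)")
    case False
    have n0: "n > 0" using n by auto
    obtain p where p: "prime p" "p \<le> y" "p ^ Suc K dvd n"
      using smooth_part_not_coprime[OF n0 K] False unfolding d_def by metis
    have "2 * of_bool (p ^ Suc K dvd n) \<le> Rbad n"
      unfolding Rbad_def by (rule member_le_sum) (use p finy in auto)
    hence "2 \<le> Rbad n" using p(3) by simp
    moreover have "norm (g n - exp A * g (d n)) \<le> 1 + 1 * 1"
    proof -
      have "norm (g n) \<le> 1" "norm (g (d n)) \<le> 1"
        using n by (auto intro!: bd simp: d_def Suc_le_eq)
      moreover have "norm (exp A) \<le> 1" using ReA by simp
      ultimately show ?thesis
        by (intro order_trans[OF norm_triangle_ineq4] add_mono) (auto simp: norm_mult mult_le_one)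
    qed
    ultimately show ?thesis using nonneg[of n] norm_ge_zero[of "W n - A"] by linarith
  next
    case True
    define b where "b = n div d n"
    have n0: "n > 0" using n by auto
    have d0: "d n > 0" using n0 by (simp add: d_def)
    have nb: "n = d n * b" by (simp add: b_def d_def)
    have b0: "b > 0" unfolding b_def d_def using n0 by (simp add: dvd_imp_le div_greater_zero_iff)
    have PFb: "prime_factors b = {p \<in> PP. p dvd n}"
      using prime_factors_rough_part[OF n0 K True[unfolded d_def]] n n0
      by (auto simp: b_def d_def PP_def dest: dvd_imp_le)
    have "g n = g (d n) * g b"
    proof -
      have "g (d n * b) = g (d n) * g b"
        using g True d0 b0 unfolding multiplicative_fun_def b_def by blast
      thus ?thesis by (subst nb)
    qed
    hence "norm (g n - exp A * g (d n)) = norm (g (d n)) * norm (g b - exp A)"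
      by (simp add: norm_mult[symmetric] algebra_simps)
    also have "\<dots> \<le> 1 * norm (g b - exp A)"
      using d0 by (intro mult_right_mono bd) auto
    also have "\<dots> \<le> norm (g b - exp (W n)) + norm (exp (W n) - exp A)"
      using norm_triangle_ineq[of "g b - exp (W n)" "exp (W n) - exp A"] by simp
    also have "norm (exp (W n) - exp A) \<le> norm (W n - A)"
      by (rule norm_exp_diff_le[OF ReW ReA])
    also have "norm (g b - exp (W n)) \<le> Ra n + Rb n + Rc n"
    proof -
      have "{p. p \<in> prime_factors b \<and> p \<le> z} = {p \<in> P. p dvd n}" by (auto simp: PFb P_def)
      hence "norm (g b - exp (W n)) \<le> (\<Sum>p\<in>prime_factors b. (if p \<le> z then exp 2 * (norm (e p))\<^sup>2 else norm (e p)) + 2 * of_bool (p\<^sup>2 dvd b))"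
        using multiplicative_fun_exp_approx[OF g bd b0, of z] unfolding W_def e_def by (simp only:)
      also have "\<dots> \<le> (\<Sum>p | p \<in> PP \<and> p dvd n. (if p \<in> P then exp 2 * (norm (e p))\<^sup>2 else norm (e p)) + 2 * of_bool (p\<^sup>2 dvd n))"
        unfolding PFb
      proof (rule sum_mono)
        fix p assume p: "p \<in> {p \<in> PP. p dvd n}"
        have "p\<^sup>2 dvd b \<Longrightarrow> p\<^sup>2 dvd n" by (subst nb) (rule dvd_mult)
        thus "(if p \<le> z then exp 2 * (norm (e p))\<^sup>2 else norm (e p)) + 2 * of_bool (p\<^sup>2 dvd b)
          \<le> (if p \<in> P then exp 2 * (norm (e p))\<^sup>2 else norm (e p)) + 2 * of_bool (p\<^sup>2 dvd n)"
          using p by (auto simp: P_def)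
      qed
      also have "\<dots> \<le> (\<Sum>p\<in>PP. (if p \<in> P then exp 2 * (norm (e p))\<^sup>2 else norm (e p)) * of_bool (p dvd n) + 2 * of_bool (p\<^sup>2 dvd n))"
        using fin by (subst sum.inter_filter) (auto intro!: sum_mono)
      also have "\<dots> = (\<Sum>p\<in>PP. (if p \<in> P then exp 2 * (norm (e p))\<^sup>2 else norm (e p)) * of_bool (p dvd n)) + Rc n"
        by (simp add: sum.distrib Rc_def)
      also have "(\<Sum>p\<in>PP. (if p \<in> P then exp 2 * (norm (e p))\<^sup>2 else norm (e p)) * of_bool (p dvd n)) = Rb n + Ra n"
        unfolding sum.subset_diff[OF sub fin(1)] Ra_def Rb_def
        by (intro arg_cong2[of _ _ _ _ "(+)"] sum.cong) auto
      finally show ?thesis by simp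
    qed
    finally show ?thesis using nonneg(1)[of n] by linarith
  qed
  have S1: "(\<Sum>n=1..N. Rbad n) \<le> real N * (real y / 2 ^ K)"
  proof -
    have "(\<Sum>n=1..N. Rbad n) \<le> real N * (\<Sum>p | prime p \<and> p \<le> y. 2 / real (p ^ Suc K))"
      unfolding Rbad_def by (rule sum_indicator_weighted_le) (use finy in \<open>auto simp: prime_gt_0_nat\<close>)
    also have "(\<Sum>p | prime p \<and> p \<le> y. 2 / real (p ^ Suc K)) \<le> (\<Sum>p | prime p \<and> p \<le> y. 2 / 2 ^ Suc K)"
    proof (rule sum_mono)
      fix p assume "p \<in> {p. prime p \<and> p \<le> y}"
      hence "2 \<le> real p" using prime_ge_2_nat by auto
      hence "2 ^ Suc K \<le> real p ^ Suc K" by (intro power_mono) auto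
      thus "2 / real (p ^ Suc K) \<le> 2 / 2 ^ Suc K" by (intro frac_le) simp_all
    qed
    also have "\<dots> = real (card {p. prime p \<and> p \<le> y}) / 2 ^ K" by simp
    also have "\<dots> \<le> real y / 2 ^ K"
    proof -
      have "card {p. prime p \<and> p \<le> y} \<le> card {1..y}" by (rule card_mono) (auto simp: prime_gt_0_nat Suc_le_eq)
      thus ?thesis by (intro divide_right_mono) auto
    qed
    finally show ?thesis by (simp add: mult_left_mono)
  qed
  have S2: "(\<Sum>n=1..N. Ra n) \<le> real N * (exp 2 * \<eta>)"
  proof -
    have "(\<Sum>n=1..N. Ra n) \<le> real N * (\<Sum>p\<in>P. exp 2 * (norm (e p))\<^sup>2 / real p)"
      unfolding Ra_def by (rule sum_indicator_weighted_le[where d = "\<lambda>p. p"]) (use fin PPpos sub in auto)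
    also have "(\<Sum>p\<in>P. exp 2 * (norm (e p))\<^sup>2 / real p) = exp 2 * E P"
      by (simp add: E_def sum_distrib_left)
    also have "real N * (exp 2 * E P) \<le> real N * (exp 2 * \<eta>)" using E[OF sub] by (intro mult_left_mono) auto
    finally show ?thesis .
  qed
  have S3: "(\<Sum>n=1..N. Rb n) \<le> real N * sqrt \<eta>"
  proof (rule sum_le_sqrt_sum_squares)
    \<comment> \<open>At most one prime in \<open>PP - P\<close> divides \<open>n\<close>, so the
      square has no cross terms. This makes Cauchy-Schwarz affordable for errors that are only first
      order in \<open>norm (e p)\<close>.\<close>
    have "(Rb n)\<^sup>2 = (\<Sum>p\<in>PP - P. (norm (e p))\<^sup>2 * of_bool (p dvd n))" if n: "n \<in> {1..N}" for n
    proof (cases "\<exists>p\<in>PP - P. p dvd n")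
      case True
      then obtain p where p: "p \<in> PP - P" "p dvd n" by blast
      have uniq: "\<not> q dvd n" if q: "q \<in> PP - P" "q \<noteq> p" for q
      proof
        assume "q dvd n"
        have "coprime p q" using p q by (auto simp: PP_def intro: primes_coprime)
        hence "p * q dvd n" using p(2) \<open>q dvd n\<close> by (simp add: divides_mult)
        hence "p * q \<le> N" using n by (auto dest: dvd_imp_le)
        moreover have "Suc z * Suc z \<le> p * q" using p q by (intro mult_le_mono) (auto simp: P_def)
        ultimately show False using z(2) by (simp only: power2_eq_square)
      qed
      have "(\<Sum>q\<in>PP - P. f q * of_bool (q dvd n)) = f p" for f :: "nat \<Rightarrow> real"
      proof -
        have "(\<Sum>q\<in>PP - P. f q * of_bool (q dvd n)) = (\<Sum>q\<in>PP - P. if p = q then f q else 0)"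
          using uniq p(2) by (intro sum.cong) auto
        also have "\<dots> = f p" using p(1) fin by (subst sum.delta') auto
        finally show ?thesis .
      qed
      thus ?thesis by (simp add: Rb_def)
    qed (simp add: Rb_def)
    hence "(\<Sum>n=1..N. (Rb n)\<^sup>2) = (\<Sum>n=1..N. \<Sum>p\<in>PP - P. (norm (e p))\<^sup>2 * of_bool (p dvd n))" by (intro sum.cong) auto
    also have "\<dots> \<le> real N * E (PP - P)"
      unfolding E_def by (rule sum_indicator_weighted_le[where d = "\<lambda>p. p"]) (use fin PPpos in auto)
    also have "\<dots> \<le> real N * \<eta>" by (intro mult_left_mono E) auto
    finally show "(\<Sum>n=1..N. (Rb n)\<^sup>2) \<le> real N * \<eta>" .
  qed
  have S4: "(\<Sum>n=1..N. Rc n) \<le> real N * (2 / real y)"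
  proof -
    have "(\<Sum>n=1..N. Rc n) \<le> real N * (\<Sum>p\<in>PP. 2 / real (p\<^sup>2))"
      unfolding Rc_def by (rule sum_indicator_weighted_le) (use fin PPpos in auto)
    also have "(\<Sum>p\<in>PP. 2 / real (p\<^sup>2)) = 2 * (\<Sum>p\<in>PP. 1 / (real p)\<^sup>2)" by (simp add: sum_distrib_left)
    also have "real N * (2 * (\<Sum>p\<in>PP. 1 / (real p)\<^sup>2)) \<le> real N * (2 * (1 / real y))"
      by (intro mult_left_mono sum_inverse_squares_tail fin y) (auto simp: PP_def)
    finally show ?thesis by simp
  qed
  have S5: "(\<Sum>n=1..N. norm (W n - A)) \<le> real N * sqrt (5 * \<eta>)"
  proof (rule sum_le_sqrt_sum_squares)
    have "(\<Sum>n=1..N. (norm (W n - A))\<^sup>2) \<le> 5 * real N * E P"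
      unfolding W_def A_def E_def by (rule turan_kubilius[OF _ z(1)]) (auto simp: P_def PP_def)
    also have "\<dots> \<le> 5 * real N * \<eta>" by (intro mult_left_mono E sub) auto
    finally show "(\<Sum>n=1..N. (norm (W n - A))\<^sup>2) \<le> real N * (5 * \<eta>)" by simp
  qed
  show ?thesis
  proof (rule that[of "exp A"])
    show "norm (exp A) \<le> 1" using ReA by simp
    have "(\<Sum>n=1..N. norm (g n - exp A * g (d n))) \<le> (\<Sum>n=1..N. Rbad n + Ra n + Rb n + Rc n + norm (W n - A))"
      by (intro sum_mono pointwise)
    also have "\<dots> = (\<Sum>n=1..N. Rbad n) + (\<Sum>n=1..N. Ra n) + (\<Sum>n=1..N. Rb n) + (\<Sum>n=1..N. Rc n) + (\<Sum>n=1..N. norm (W n - A))"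
      by (simp only: sum.distrib)
    also have "\<dots> \<le> real N * (real y / 2 ^ K) + real N * (exp 2 * \<eta>) + real N * sqrt \<eta> + real N * (2 / real y) + real N * sqrt (5 * \<eta>)"
      by (intro add_mono S1 S2 S3 S4 S5)
    finally show "(\<Sum>n=1..N. norm (g n - exp A * g (gcd n (fact y ^ K)))) 
      \<le> real N * (real y / 2 ^ K + exp 2 * \<eta> + sqrt \<eta> + 2 / real y + sqrt (5 * \<eta>))"
      unfolding d_def by (simp only: distrib_left)
  qed
qed

text \<open>The parameters are chosen in the order \<open>\<eta>\<close>, \<open>y\<close>,
  \<open>K\<close>, all before \<open>N\<close>; so \<open>Q\<close> and \<open>h\<close> serve
  every \<open>N\<close>, and only \<open>c\<close> varies. The error budget is three thirds of
  \<open>\<epsilon>\<close>: the terms in \<open>\<eta>\<close>, the term \<open>2 / y\<close>, and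
  \<open>y / 2 ^ K\<close>.\<close>

lemma multiplicative_approx_periodic:
  fixes g :: "nat \<Rightarrow> complex"
  assumes g: "multiplicative_fun g" and bd: "\<And>n. n \<ge> 1 \<Longrightarrow> norm (g n) \<le> 1"
    and sm: "(\<lambda>p. (norm (g p - 1))\<^sup>2 / real p) summable_on {p. prime p}" and \<epsilon>: "\<epsilon> > 0"
  obtains Q :: nat and h where "Q > 0" "\<And>n. h (n + Q) = h n" "\<And>n. norm (h n) \<le> 1"
    "\<And>N. \<exists>c. norm c \<le> 1 \<and> (\<Sum>n=1..N. norm (g n - c * h n)) \<le> real N * \<epsilon>"
proof -
  have "((\<lambda>\<eta>. exp 2 * \<eta> + sqrt \<eta> + sqrt (5 * \<eta>)) \<longlongrightarrow> exp 2 * 0 + sqrt 0 + sqrt (5 * 0)) (at_right 0)"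
    by (intro tendsto_intros)
  hence "eventually (\<lambda>\<eta>. exp 2 * \<eta> + sqrt \<eta> + sqrt (5 * \<eta>) < \<epsilon> / 3) (at_right 0)"
    using \<epsilon> by (intro order_tendstoD(2)) auto
  moreover have "eventually (\<lambda>\<eta>::real. \<eta> > 0) (at_right 0)" by (rule eventually_at_right_less)
  ultimately have "eventually (\<lambda>\<eta>. exp 2 * \<eta> + sqrt \<eta> + sqrt (5 * \<eta>) < \<epsilon> / 3 \<and> \<eta> > 0) (at_right 0)"
    by (rule eventually_conj)
  then obtain \<eta> where \<eta>: "exp 2 * \<eta> + sqrt \<eta> + sqrt (5 * \<eta>) < \<epsilon> / 3" "\<eta> > 0"
    using eventually_happens'[OF trivial_limit_at_right_real] by blast
  obtain y0 where y0: "\<And>F. finite F \<Longrightarrow> F \<subseteq> {p. prime p} \<inter> {y0<..} \<Longrightarrow> (\<Sum>p\<in>F. (norm (g p - 1))\<^sup>2 / real p) \<le> \<eta>"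
    using summable_on_tail_small[OF sm _ \<eta>(2)] by auto
  obtain y1 :: nat where y1: "6 / \<epsilon> < real y1" using reals_Archimedean2 by blast
  define y where "y = max (max y0 y1) 1"
  have y: "y \<ge> 1" by (simp add: y_def)
  have "6 / \<epsilon> < real y" using y1 by (simp add: y_def)
  hence y2: "2 / real y \<le> \<epsilon> / 3" using \<epsilon> y by (simp add: field_simps)
  have "(\<lambda>K. real y / 2 ^ K) \<longlonglongrightarrow> 0" by real_asymp
  hence "eventually (\<lambda>K. real y / 2 ^ K < \<epsilon> / 3) sequentially"
    using \<epsilon> by (intro order_tendstoD(2)) auto
  hence "eventually (\<lambda>K. real y / 2 ^ K < \<epsilon> / 3 \<and> K > 0) sequentially"
    using eventually_gt_at_top by (rule eventually_conj)
  then obtain K where K: "real y / 2 ^ K < \<epsilon> / 3" "K > 0"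
    using eventually_happens'[OF sequentially_bot] by blast
  define Q :: nat where "Q = fact y ^ K"
  show ?thesis
  proof (rule that[of Q "\<lambda>n. g (gcd n Q)"])
    show "Q > 0" by (simp add: Q_def)
    thus "norm (g (gcd n Q)) \<le> 1" for n by (intro bd) (simp add: Suc_le_eq)
    show "g (gcd (n + Q) Q) = g (gcd n Q)" for n by simp
    show "\<exists>c. norm c \<le> 1 \<and> (\<Sum>n=1..N. norm (g n - c * g (gcd n Q))) \<le> real N * \<epsilon>" for N
    proof -
      have tail: "(\<Sum>p\<in>F. (norm (g p - 1))\<^sup>2 / real p) \<le> \<eta>" if "finite F" "F \<subseteq> {p. prime p} \<inter> {y<..}" for F
        using y0[OF that(1)] that(2) by (auto simp: y_def subset_iff)
      obtain c where c: "norm c \<le> 1" "(\<Sum>n=1..N. norm (g n - c * g (gcd n (fact y ^ K)))) 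
          \<le> real N * (real y / 2 ^ K + exp 2 * \<eta> + sqrt \<eta> + 2 / real y + sqrt (5 * \<eta>))"
        using multiplicative_approx_bound[OF g bd y K(2) tail] by blast
      have "real y / 2 ^ K + exp 2 * \<eta> + sqrt \<eta> + 2 / real y + sqrt (5 * \<eta>) \<le> \<epsilon>"
        using K(1) y2 \<eta>(1) by linarith
      hence "real N * (real y / 2 ^ K + exp 2 * \<eta> + sqrt \<eta> + 2 / real y + sqrt (5 * \<eta>)) \<le> real N * \<epsilon>"
        by (intro mult_left_mono) auto
      with c show ?thesis unfolding Q_def by (intro exI[of _ c]) linarith
    qed
  qed
qed

section \<open>The shifted correlation\<close>

lemma shifted_correlation_tendsto:
  fixes g1 g2 :: "nat \<Rightarrow> complex"
  assumes g: "multiplicative_fun g1" "multiplicative_fun g2"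
    and bd: "\<And>n. n \<ge> 1 \<Longrightarrow> norm (g1 n) \<le> 1" "\<And>n. n \<ge> 1 \<Longrightarrow> norm (g2 n) \<le> 1"
    and sm: "(\<lambda>p. (norm (g1 p - 1))\<^sup>2 / real p) summable_on {p. prime p}"
      "(\<lambda>p. (norm (g2 p - 1))\<^sup>2 / real p) summable_on {p. prime p}"
  shows "(\<lambda>N. (\<Sum>n=1..N. g1 (n + 3) * g2 (n + 2) * of_int (moebius_mu (n + 1))) / of_nat N) \<longlonglongrightarrow> 0"
proof (rule tendstoI)
  fix \<epsilon> :: real assume \<epsilon>: "\<epsilon> > 0"
  \<comment> \<open>The two approximations, summed up to \<open>N + 3\<close> and
    \<open>N + 2\<close>, cost \<open>(2 * N + 5) * (\<epsilon> / 12)\<close>. Divided by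
    \<open>N\<close> this tends to \<open>\<epsilon> / 6\<close>, leaving room for the vanishing
    terms.\<close>
  have \<epsilon>4: "\<epsilon> / 12 > 0" using \<epsilon> by simp
  obtain Q1 h1 where h1: "Q1 > 0" "\<And>n. h1 (n + Q1) = h1 n" "\<And>n. norm (h1 n) \<le> 1"
    "\<And>N. \<exists>c. norm c \<le> 1 \<and> (\<Sum>n=1..N. norm (g1 n - c * h1 n)) \<le> real N * (\<epsilon> / 12)"
    using multiplicative_approx_periodic[OF g(1) bd(1) sm(1) \<epsilon>4] by blast
  obtain Q2 h2 where h2: "Q2 > 0" "\<And>n. h2 (n + Q2) = h2 n" "\<And>n. norm (h2 n) \<le> 1"
    "\<And>N. \<exists>c. norm c \<le> 1 \<and> (\<Sum>n=1..N. norm (g2 n - c * h2 n)) \<le> real N * (\<epsilon> / 12)"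
    using multiplicative_approx_periodic[OF g(2) bd(2) sm(2) \<epsilon>4] by blast
  \<comment> \<open>Written in terms of \<open>m = n + 1\<close>, the argument of mu.\<close>
  define F where "F = (\<lambda>m. h1 (m + 2) * h2 (m + 1))"
  have "F (n + Q1 * Q2) = F n" for n
  proof -
    have "h1 (a + Q1 * Q2) = h1 a" for a
      by (rule periodic_cong[of h1 Q1, OF h1(2)]) (simp add: cong_def)
    moreover have "h2 (a + Q1 * Q2) = h2 a" for a
      by (rule periodic_cong[of h2 Q2, OF h2(2)]) (simp add: cong_def)
    moreover have "n + Q1 * Q2 + 2 = (n + 2) + Q1 * Q2" "n + Q1 * Q2 + 1 = (n + 1) + Q1 * Q2" by simp_all
    ultimately show ?thesis unfolding F_def by presburger
  qed
  hence "moebius_null F" using h1(1) h2(1) by (intro moebius_null_periodic[of "Q1 * Q2"]) auto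
  define M where "M = (\<lambda>N. \<Sum>n=1..N. of_int (moebius_mu n) * F n)"
  have lim: "(\<lambda>N. M N / of_nat N) \<longlonglongrightarrow> 0"
    using \<open>moebius_null F\<close> unfolding moebius_null_def M_def .
  have "(\<lambda>N. M (Suc N) / of_nat (Suc N)) \<longlonglongrightarrow> 0" using LIMSEQ_Suc[OF lim] by simp
  hence l1: "(\<lambda>N. norm (M (Suc N) / of_nat (Suc N))) \<longlonglongrightarrow> 0" by (rule tendsto_norm_zero)
  have "(\<lambda>N. norm (M (Suc N) / of_nat (Suc N)) * (real (Suc N) / real N) + 1 / real N + (real (2 * N + 5) / real N) * (\<epsilon> / 12)) \<longlonglongrightarrow> 0 * 1 + 0 + 2 * (\<epsilon> / 12)"
    by (intro tendsto_add tendsto_mult l1 tendsto_const; real_asymp)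
  hence "eventually (\<lambda>N. norm (M (Suc N) / of_nat (Suc N)) * (real (Suc N) / real N) + 1 / real N + (real (2 * N + 5) / real N) * (\<epsilon> / 12) < \<epsilon>) sequentially"
    by (rule order_tendstoD(2)) (use \<epsilon> in simp)
  thus "eventually (\<lambda>N. dist ((\<Sum>n=1..N. g1 (n + 3) * g2 (n + 2) * of_int (moebius_mu (n + 1))) / of_nat N) 0 < \<epsilon>) sequentially"
    using eventually_ge_at_top[of 1]
  proof eventually_elim
    case (elim N)
    obtain c1 where c1: "norm c1 \<le> 1" "(\<Sum>n=1..N+3. norm (g1 n - c1 * h1 n)) \<le> real (N + 3) * (\<epsilon> / 12)"
      using h1(4) by blast
    obtain c2 where c2: "norm c2 \<le> 1" "(\<Sum>n=1..N+2. norm (g2 n - c2 * h2 n)) \<le> real (N + 2) * (\<epsilon> / 12)"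
      using h2(4) by blast
    let ?\<mu> = "\<lambda>n. complex_of_int (moebius_mu n)"
    have shift: "(\<Sum>n=1..N. u (n + j)) \<le> (\<Sum>n=1..N+j. u n)" if "\<And>n. u n \<ge> 0" for u :: "nat \<Rightarrow> real" and j
    proof -
      have "(\<Sum>n=1..N. u (n + j)) = (\<Sum>n\<in>(\<lambda>n. n + j) ` {1..N}. u n)" by (subst sum.reindex) auto
      also have "\<dots> \<le> (\<Sum>n=1..N+j. u n)" by (intro sum_mono2) (auto simp: that)
      finally show ?thesis .
    qed
    have pw: "norm (g1 (n + 3) * g2 (n + 2) * ?\<mu> (n + 1) - c1 * c2 * (?\<mu> (n + 1) * F (n + 1)))
       \<le> norm (g1 (n + 3) - c1 * h1 (n + 3)) + norm (g2 (n + 2) - c2 * h2 (n + 2))" for n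
    proof -
      have F_n: "F (n + 1) = h1 (n + 3) * h2 (n + 2)" by (simp add: F_def numeral_3_eq_3)
      define a b a' b' where "a = g1 (n + 3)" and "b = g2 (n + 2)" and "a' = c1 * h1 (n + 3)" and "b' = c2 * h2 (n + 2)"
      have "norm b \<le> 1" unfolding b_def by (rule bd(2)) simp
      have "norm a' \<le> 1" unfolding a'_def norm_mult using c1(1) h1(3) by (intro mult_le_one) auto
      have "g1 (n + 3) * g2 (n + 2) * ?\<mu> (n + 1) - c1 * c2 * (?\<mu> (n + 1) * F (n + 1)) = ((a - a') * b + a' * (b - b')) * ?\<mu> (n + 1)"
        unfolding F_n a_def b_def a'_def b'_def by (simp add: algebra_simps)
      also have "norm \<dots> \<le> norm ((a - a') * b + a' * (b - b'))"
        unfolding norm_mult[of _ "?\<mu> (n + 1)"] by (intro mult_right_le_one_le norm_moebius_mu_le) auto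
      also have "\<dots> \<le> norm (a - a') * norm b + norm a' * norm (b - b')"
        by (metis norm_mult norm_triangle_ineq)
      also have "\<dots> \<le> norm (a - a') + norm (b - b')"
        using \<open>norm b \<le> 1\<close> \<open>norm a' \<le> 1\<close> by (intro add_mono mult_right_le_one_le mult_left_le_one_le) auto
      finally show ?thesis unfolding a_def b_def a'_def b'_def .
    qed
    \<comment> \<open>Since \<open>n\<close> starts at 1, the term \<open>m = 1\<close> of
      \<open>M (Suc N)\<close> has to be removed; it equals \<open>F 1\<close> because mu is 1
      there.\<close>
    have main: "(\<Sum>n=1..N. ?\<mu> (n + 1) * F (n + 1)) = M (Suc N) - F 1"
    proof -
      have "M (Suc N) = (\<Sum>n=0..N. ?\<mu> (n + 1) * F (n + 1))"
        unfolding M_def One_nat_def by (subst sum.shift_bounds_cl_Suc_ivl) simp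
      also have "\<dots> = F 1 + (\<Sum>n=1..N. ?\<mu> (n + 1) * F (n + 1))"
        by (subst sum.atLeast_Suc_atMost) (simp_all add: moebius_mu_1[unfolded One_nat_def])
      finally show ?thesis by simp
    qed
    let ?S = "\<Sum>n=1..N. g1 (n + 3) * g2 (n + 2) * ?\<mu> (n + 1)"
    have "norm (?S - c1 * c2 * (M (Suc N) - F 1)) =
       norm (\<Sum>n=1..N. g1 (n + 3) * g2 (n + 2) * ?\<mu> (n + 1) - c1 * c2 * (?\<mu> (n + 1) * F (n + 1)))"
      unfolding main[symmetric] sum_subtractf sum_distrib_left ..
    also have "\<dots> \<le> (\<Sum>n=1..N. norm (g1 (n + 3) - c1 * h1 (n + 3)) + norm (g2 (n + 2) - c2 * h2 (n + 2)))"
      by (intro sum_norm_le pw)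
    also have "\<dots> \<le> real (N + 3) * (\<epsilon> / 12) + real (N + 2) * (\<epsilon> / 12)"
      unfolding sum.distrib
      using shift[of "\<lambda>n. norm (g1 n - c1 * h1 n)" 3] shift[of "\<lambda>n. norm (g2 n - c2 * h2 n)" 2] c1(2) c2(2)
      by simp
    finally have d: "norm (?S - c1 * c2 * (M (Suc N) - F 1)) \<le> real (2 * N + 5) * (\<epsilon> / 12)"
      by (simp add: field_simps)
    have "norm (c1 * c2 * (M (Suc N) - F 1)) \<le> norm (M (Suc N) - F 1)"
      unfolding norm_mult[of "c1 * c2"] norm_mult[of c1]
      using c1(1) c2(1) by (intro mult_left_le_one_le) (auto intro: mult_le_one)
    also have "\<dots> \<le> norm (M (Suc N)) + 1"
    proof -
      have "norm (F 1) \<le> 1" unfolding F_def norm_mult using h1(3) h2(3) by (intro mult_le_one) auto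
      thus ?thesis using norm_triangle_ineq4[of "M (Suc N)" "F 1"] by linarith
    qed
    finally have "norm ?S \<le> norm (M (Suc N)) + 1 + real (2 * N + 5) * (\<epsilon> / 12)"
      using d norm_triangle_sub[of ?S "c1 * c2 * (M (Suc N) - F 1)"] by linarith
    hence "norm ?S / real N \<le> (norm (M (Suc N)) + 1 + real (2 * N + 5) * (\<epsilon> / 12)) / real N"
      by (intro divide_right_mono) auto
    also have "\<dots> = norm (M (Suc N) / of_nat (Suc N)) * (real (Suc N) / real N) + 1 / real N + (real (2 * N + 5) / real N) * (\<epsilon> / 12)"
    proof -
      have "norm (M (Suc N)) / real N = norm (M (Suc N) / of_nat (Suc N)) * (real (Suc N) / real N)"
        by (simp add: norm_divide del: of_nat_Suc)
      thus ?thesis by (simp only: add_divide_distrib times_divide_eq_left)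
    qed
    also have "\<dots> < \<epsilon>" by (rule elim(1))
    finally show ?case by (simp add: norm_divide)
  qed
qed

theorem theorem3:
  fixes g1 g2 :: "nat \<Rightarrow> complex"
  assumes "multiplicative_fun g1" and "multiplicative_fun g2"
    and "\<And>n. n \<ge> 1 \<Longrightarrow> norm (g1 n) \<le> 1" and "\<And>n. n \<ge> 1 \<Longrightarrow> norm (g2 n) \<le> 1"
    and "(\<lambda>p. (norm (g1 p - 1))\<^sup>2 / real p + (norm (g2 p - 1))\<^sup>2 / real p)
           summable_on {p::nat. prime p}"
  shows "(\<lambda>x::real. 1 / complex_of_real x *
            (\<Sum>n = 1..nat \<lfloor>x\<rfloor>. g1 (n + 3) * g2 (n + 2) * of_int (moebius_mu (n + 1))))
         \<in> o[at_top](\<lambda>_. 1)"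
proof -
  define S where "S = (\<lambda>N. \<Sum>n = 1..N. g1 (n + 3) * g2 (n + 2) * complex_of_int (moebius_mu (n + 1)))"
  have sm: "(\<lambda>p. (norm (g1 p - 1))\<^sup>2 / real p) summable_on {p. prime p}"
      "(\<lambda>p. (norm (g2 p - 1))\<^sup>2 / real p) summable_on {p. prime p}"
    by (rule summable_on_comparison_test[OF assms(5)]; simp)+
  have "filterlim (\<lambda>x::real. nat \<lfloor>x\<rfloor>) sequentially at_top"
    by (rule filterlim_compose[OF filterlim_nat_sequentially filterlim_floor_sequentially])
  hence "((\<lambda>x::real. S (nat \<lfloor>x\<rfloor>) / of_nat (nat \<lfloor>x\<rfloor>)) \<longlongrightarrow> 0) at_top"
    using shifted_correlation_tendsto[OF assms(1-4) sm] unfolding S_def by (rule filterlim_compose[rotated])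
  hence lim: "((\<lambda>x::real. norm (S (nat \<lfloor>x\<rfloor>) / of_nat (nat \<lfloor>x\<rfloor>))) \<longlongrightarrow> 0) at_top"
    by (rule tendsto_norm_zero)
  \<comment> \<open>Dividing by \<open>x\<close> instead of its floor can only make the quotient
    smaller, so the integer case dominates.\<close>
  have "((\<lambda>x::real. 1 / complex_of_real x * S (nat \<lfloor>x\<rfloor>)) \<longlongrightarrow> 0) at_top"
  proof (rule Lim_null_comparison[OF _ lim])
    show "eventually (\<lambda>x::real. norm (1 / complex_of_real x * S (nat \<lfloor>x\<rfloor>)) \<le> norm (S (nat \<lfloor>x\<rfloor>) / of_nat (nat \<lfloor>x\<rfloor>))) at_top"
      using eventually_ge_at_top[of 1]
    proof eventually_elim
      case (elim x)
      have "0 < real (nat \<lfloor>x\<rfloor>)" "real (nat \<lfloor>x\<rfloor>) \<le> x" using elim by (auto simp: of_nat_nat)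
      hence "norm (S (nat \<lfloor>x\<rfloor>)) / x \<le> norm (S (nat \<lfloor>x\<rfloor>)) / real (nat \<lfloor>x\<rfloor>)"
        using elim by (intro divide_left_mono) auto
      thus ?case using elim by (simp add: norm_mult norm_divide)
    qed
  qed
  thus ?thesis unfolding S_def by (intro smalloI_tendsto) auto
qed

end
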